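(* Let $L=K_1\cup K_2$ and $L'=K_1'\cup K_2'$ be oriented $2$-component virtual links with $\lambda(L)=\lambda(L')=0$. Then $L$ and $L'$ are related by a finite sequence of shell moves (that is, they are S-equivalent) if and only if (i) $J_n(K_1;L)=J_n(K_1';L')$ for any $n\ne 0,1$, (ii) $J_n(K_2;L)=J_n(K_2';L')$ for any $n\ne 0,1$, and (iii) $F(L)=F(L')$.
   Context: Gauss diagrams. A Gauss diagram is a disjoint union of oriented circles $C_1,\dots,C_\mu$ together with finitely many chords. Each chord joins two points of the circles (its endpoints; all endpoints of all chords are distinct), is oriented from its initial to its terminal endpoint, and carries a sign $\varepsilon\in\{+1,-1\}$. For a chord of sign $\varepsilon$, the initial endpoint is given the sign $-\varepsilon$ and the terminal endpoint the sign $\varepsilon$. Only the cyclic order of the endpoints on each circle matters. A chord is a self-chord if both endpoints lie on the same circle, otherwise a nonself-chord; a nonself-chord is of type $(i,j)$ if it is oriented from $C_i$ to $C_j$. Endpoints are adjacent (consecutive) if they bound an arc of a circle containing no other endpoint in its interior. Reidemeister moves. R1: insert or delete a self-chord (of any sign and orientation) whose two endpoints are adjacent. R2: insert or delete two chords of opposite signs whose initial endpoints are adjacent and whose terminal endpoints are adjacent (in any order). R3: let $a,b,c$ be three chords of the same sign such that, along the orientation of the circles, the initial endpoint of $a$ is immediately followed by the initial endpoint of $b$, the terminal endpoint of $a$ is immediately followed by the initial endpoint of $c$, and the terminal endpoint of $b$ is immediately followed by the terminal endpoint of $c$; exchange the two endpoints in each of these three adjacent pairs (or the inverse). An oriented $\mu$-component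 virtual link is an equivalence class of Gauss diagrams with $\mu$ (ordered) circles under R1, R2, R3; $L=K_1\cup K_2$ means that $K_i$ corresponds to $C_i$. Shells. Shells for a chord $\gamma$ at an endpoint $p$ of $\gamma$ are self-chords surrounding $p$ in parallel: for shells $s_1,\dots,s_k$ the consecutive endpoints on the circle are: one endpoint of $s_k$, ..., one endpoint of $s_1$, then $p$, then the other endpoint of $s_1$, ..., the other endpoint of $s_k$. If $p$ has positive sign, each shell is oriented as the circle (its initial endpoint precedes $p$ and its terminal endpoint follows $p$); if $p$ has negative sign, each shell is oriented oppositely. The sign of a shell is arbitrary. Shell moves. S1: delete a shell immediately surrounding one endpoint of a chord $\gamma$, and insert a shell of the same sign immediately surrounding the other endpoint of $\gamma$. S2: let $p,q$ be endpoints of two distinct chords with $p$ immediately followed by $q$ along the circle, with signs $\varepsilon_p,\varepsilon_q$; exchange their positions, and add a shell of sign $\varepsilon_p\varepsilon_q$ immediately surrounding $p$ and a shell of sign $-\varepsilon_p\varepsilon_q$ immediately surrounding $q$. Inverses are also allowed. Two virtual links are S-equivalent (related by a finite sequence of shell moves) if their Gauss diagrams are related by a finite sequence of R1, R2, R3, S1, S2. Invariants. Let $G$ be a Gauss diagram of $L=K_1\cup K_2$. ${\rm Lk}(K_i,K_j)$ is the sum of signs of all nonself-chords of type $(i,j)$, and $\lambda=\lambda(L)={\rm Lk}(K_1,K_2)-{\rm Lk}(K_2,K_1)$. For a self-chord $\gamma$ on $C_i$, ${\rm Ind}'(\gamma)$ is the sum of the signs of endpoints of all (self- and nonself-) chords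 on the open arc of $C_i$ running along the orientation from the initial endpoint of $\gamma$ to its terminal endpoint. $J_n(K_1;L)$ for $n\ne 0,-\lambda$ (resp. $J_n(K_2;L)$ for $n\neq 0,\lambda$) is the sum of signs of the self-chords $\gamma$ on $C_1$ (resp. $C_2$) with ${\rm Ind}'(\gamma)=n$; these do not depend on the choice of $G$. Linking class. Take $G$ with at least one nonself-chord and fix a nonself-chord $\gamma_0$. For a nonself-chord $\gamma$ of type $(i,j)$, ${\rm Ind}'(\gamma;\gamma_0)$ is the sum of the signs of endpoints of all chords on $\alpha\cup\beta$, where $\alpha$ is the arc of $C_i$ running along the orientation from the initial endpoint of $\gamma$ to the endpoint of $\gamma_0$ on $C_i$, and $\beta$ is the arc of $C_j$ running along the orientation from the endpoint of $\gamma_0$ on $C_j$ to the terminal endpoint of $\gamma$ (endpoints of $\gamma$ and $\gamma_0$ themselves not counted; ${\rm Ind}'(\gamma_0;\gamma_0)=0$). Let $J_n^{ij}(G;\gamma_0)$ be the sum of signs of nonself-chords $\gamma$ of type $(i,j)$ with ${\rm Ind}'(\gamma;\gamma_0)=n$ and $F_{ij}(t;\gamma_0)=\sum_{n\in\mathbb{Z}}J_n^{ij}(G;\gamma_0)t^n$. For $s\ge 0$ let $\Lambda_s=\mathbb{Z}[t,t^{-1}]/(t^s-1)$ (so $\Lambda_0=\mathbb{Z}[t,t^{-1}]$, $\Lambda_1=\mathbb{Z}$), and let $\Gamma(s)$ be the quotient of $\Lambda_s\times\Lambda_s$ by $(f,g)\sim(t^kf,t^{-k}g)$, $k\in\mathbb{Z}$;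 classes are written $[f,g]$. The linking class $F(L)=[F_{12}(t;\gamma_0),F_{21}(t;\gamma_0)]\in\Gamma(\lambda)$ (for $\lambda\ge0$) does not depend on $\gamma_0$ or $G$. *)

theory Defs
  imports Main "HOL-Library.Poly_Mapping" "HOL-Combinatorics.Transposition"
begin

section \<open>Gauss diagrams\<close>

text \<open>
  The label only serves to tell chords of a diagram apart; diagrams are considered up to
  relabelling, see \<open>isomorphic\<close> below.  A chord \<open>\<gamma>\<close> is oriented from \<open>Ini \<gamma>\<close> to \<open>Ter \<gamma>\<close>.
\<close>

datatype chord = Chord (chord_label: nat) (chord_sign: int)

datatype 'c endpoint = Ini 'c | Ter 'c

fun endpoint_sign :: "chord endpoint \<Rightarrow> int" where
  "endpoint_sign (Ini \<gamma>) = - chord_sign \<gamma>"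
| "endpoint_sign (Ter \<gamma>) = chord_sign \<gamma>"

fun chord_of :: "'c endpoint \<Rightarrow> 'c" where
  "chord_of (Ini \<gamma>) = \<gamma>"
| "chord_of (Ter \<gamma>) = \<gamma>"

text \<open>
  A diagram is the list of its circles \<open>C\<^sub>1, \<dots>, C\<^sub>\<mu>\<close>, so \<open>C\<^sub>i\<close> is the entry with index \<open>i - 1\<close>.
  Each circle is the word of the endpoints met when running along its orientation from an
  arbitrary base point that is not an endpoint.
\<close>

type_synonym diagram = "chord endpoint list list"

definition gauss_diagram :: "nat \<Rightarrow> diagram \<Rightarrow> bool" where
  "gauss_diagram \<mu> G \<longleftrightarrow>
     length G = \<mu> \<and>
     distinct (concat G) \<and>
     (\<forall>\<gamma>. Ini \<gamma> \<in> set (concat G) \<longleftrightarrow> Ter \<gamma> \<in> set (concat G)) \<and>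
     (\<forall>\<gamma>. Ini \<gamma> \<in> set (concat G) \<longrightarrow> chord_sign \<gamma> \<in> {1, -1})"

definition chords :: "diagram \<Rightarrow> chord set" where
  "chords G = {\<gamma>. Ini \<gamma> \<in> set (concat G)}"

text \<open>For \<open>i = j\<close> these are the self-chords of the circle.\<close>

definition chords_of_type :: "diagram \<Rightarrow> nat \<Rightarrow> nat \<Rightarrow> chord set" where
  "chords_of_type G i j = {\<gamma>. Ini \<gamma> \<in> set (G ! i) \<and> Ter \<gamma> \<in> set (G ! j)}"

definition nonself_chords :: "diagram \<Rightarrow> chord set" where
  "nonself_chords G =
     {\<gamma>. \<exists>i<length G. \<exists>j<length G. i \<noteq> j \<and> \<gamma> \<in> chords_of_type G i j}"

text \<open>Change of the base points and of the labels.\<close>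

definition isomorphic :: "diagram \<Rightarrow> diagram \<Rightarrow> bool" where
  "isomorphic G H \<longleftrightarrow>
     length H = length G \<and>
     (\<exists>f k. inj_on f (chords G) \<and>
        (\<forall>\<gamma>\<in>chords G. chord_sign (f \<gamma>) = chord_sign \<gamma>) \<and>
        (\<forall>i<length G. H ! i = rotate (k i) (map (map_endpoint f) (G ! i))))"

text \<open>\<open>p\<close> is immediately followed by \<open>q\<close> along the orientation of a circle.\<close>

definition followed_by :: "diagram \<Rightarrow> chord endpoint \<Rightarrow> chord endpoint \<Rightarrow> bool" where
  "followed_by G p q \<longleftrightarrow> (\<exists>i<length G. \<exists>k vs. rotate k (G ! i) = p # q # vs)"

definition adjacent :: "diagram \<Rightarrow> chord endpoint \<Rightarrow> chord endpoint \<Rightarrow> bool" where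
  "adjacent G p q \<longleftrightarrow> followed_by G p q \<or> followed_by G q p"

text \<open>The endpoints on the open arc running along the orientation from \<open>p\<close> to \<open>q\<close>.\<close>

definition arc :: "diagram \<Rightarrow> chord endpoint \<Rightarrow> chord endpoint \<Rightarrow> chord endpoint set" where
  "arc G p q =
     {x. \<exists>i<length G. \<exists>k us vs. rotate k (G ! i) = p # us @ q # vs \<and> x \<in> set us}"

definition delete_chords :: "chord set \<Rightarrow> diagram \<Rightarrow> diagram" where
  "delete_chords S G = map (filter (\<lambda>p. chord_of p \<notin> S)) G"

definition exchange :: "chord endpoint \<Rightarrow> chord endpoint \<Rightarrow> diagram \<Rightarrow> diagram" where
  "exchange p q G = map (map (Transposition.transpose p q)) G"


section \<open>Reidemeister moves and shell moves\<close>

text \<open>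
  Each move is given in one direction only; the inverses enter through \<^const>\<open>equivclp\<close> below.
  The insertion of chords is described by deleting them from the resulting diagram.
\<close>

definition R1 :: "diagram \<Rightarrow> diagram \<Rightarrow> bool" where
  "R1 G H \<longleftrightarrow> (\<exists>\<gamma>. adjacent G (Ini \<gamma>) (Ter \<gamma>) \<and> H = delete_chords {\<gamma>} G)"

definition R2 :: "diagram \<Rightarrow> diagram \<Rightarrow> bool" where
  "R2 G H \<longleftrightarrow>
     (\<exists>a b. chord_sign a = - chord_sign b \<and>
        adjacent G (Ini a) (Ini b) \<and> adjacent G (Ter a) (Ter b) \<and>
        H = delete_chords {a, b} G)"

definition R3 :: "diagram \<Rightarrow> diagram \<Rightarrow> bool" where
  "R3 G H \<longleftrightarrow>
     (\<exists>a b c. distinct [a, b, c] \<and>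
        chord_sign a = chord_sign b \<and> chord_sign b = chord_sign c \<and>
        followed_by G (Ini a) (Ini b) \<and>
        followed_by G (Ter a) (Ini c) \<and>
        followed_by G (Ter b) (Ter c) \<and>
        H = exchange (Ini a) (Ini b) (exchange (Ter a) (Ini c) (exchange (Ter b) (Ter c) G)))"

text \<open>\<open>s\<close> is a shell immediately surrounding the endpoint \<open>p\<close>.\<close>

definition shell_at :: "diagram \<Rightarrow> chord endpoint \<Rightarrow> chord \<Rightarrow> bool" where
  "shell_at G p s \<longleftrightarrow>
     (if endpoint_sign p > 0
      then followed_by G (Ini s) p \<and> followed_by G p (Ter s)
      else followed_by G (Ter s) p \<and> followed_by G p (Ini s))"

definition S1 :: "diagram \<Rightarrow> diagram \<Rightarrow> bool" where
  "S1 G H \<longleftrightarrow>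
     (\<exists>\<gamma> p q s s'. {p, q} = {Ini \<gamma>, Ter \<gamma>} \<and>
        shell_at G p s \<and> shell_at H q s' \<and> chord_sign s = chord_sign s' \<and>
        delete_chords {s} G = delete_chords {s'} H)"

text \<open>
  In \<open>H\<close> the cyclic order around the exchanged endpoints is: shell endpoint, \<open>q\<close>, shell endpoint,
  shell endpoint, \<open>p\<close>, shell endpoint.
\<close>

definition S2 :: "diagram \<Rightarrow> diagram \<Rightarrow> bool" where
  "S2 G H \<longleftrightarrow>
     (\<exists>p q s s'. chord_of p \<noteq> chord_of q \<and> followed_by G p q \<and>
        chord_sign s = endpoint_sign p * endpoint_sign q \<and> shell_at H p s \<and>
        chord_sign s' = - endpoint_sign p * endpoint_sign q \<and> shell_at H q s' \<and>
        s \<notin> chords G \<and> s' \<notin> chords G \<and>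
        delete_chords {s, s'} H = exchange p q G)"

definition reidemeister_step :: "nat \<Rightarrow> diagram \<Rightarrow> diagram \<Rightarrow> bool" where
  "reidemeister_step \<mu> G H \<longleftrightarrow>
     gauss_diagram \<mu> G \<and> gauss_diagram \<mu> H \<and>
     (isomorphic G H \<or> R1 G H \<or> R2 G H \<or> R3 G H)"

definition shell_step :: "nat \<Rightarrow> diagram \<Rightarrow> diagram \<Rightarrow> bool" where
  "shell_step \<mu> G H \<longleftrightarrow> gauss_diagram \<mu> G \<and> gauss_diagram \<mu> H \<and> (S1 G H \<or> S2 G H)"


section \<open>Virtual links and S-equivalence\<close>

definition reidemeister_rel :: "nat \<Rightarrow> (diagram \<times> diagram) set" where
  "reidemeister_rel \<mu> =
     {(G, H). gauss_diagram \<mu> G \<and> gauss_diagram \<mu> H \<and> equivclp (reidemeister_step \<mu>) G H}"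

type_synonym link = "diagram set"

definition virtual_links :: "nat \<Rightarrow> link set" where
  "virtual_links \<mu> = {G. gauss_diagram \<mu> G} // reidemeister_rel \<mu>"

definition S_equivalent :: "nat \<Rightarrow> link \<Rightarrow> link \<Rightarrow> bool" where
  "S_equivalent \<mu> L L' \<longleftrightarrow>
     (\<exists>G\<in>L. \<exists>G'\<in>L'. equivclp (\<lambda>A B. reidemeister_step \<mu> A B \<or> shell_step \<mu> A B) G G')"


section \<open>Invariants\<close>

text \<open>
  Invariants of a link are read off from an arbitrarily chosen Gauss diagram of it.  Circle
  indices start at \<open>0\<close>: \<open>K\<^sub>1\<close>, \<open>K\<^sub>2\<close> have the indices \<open>0\<close>, \<open>1\<close>.
\<close>

definition Lk_diagram :: "diagram \<Rightarrow> nat \<Rightarrow> nat \<Rightarrow> int" where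
  "Lk_diagram G i j = (\<Sum>\<gamma>\<in>chords_of_type G i j. chord_sign \<gamma>)"

definition Lk :: "link \<Rightarrow> nat \<Rightarrow> nat \<Rightarrow> int" where
  "Lk L i j = (SOME z. \<exists>G\<in>L. z = Lk_diagram G i j)"

definition linking_difference :: "link \<Rightarrow> int" where
  "linking_difference L = Lk L 0 1 - Lk L 1 0"

definition Ind :: "diagram \<Rightarrow> chord \<Rightarrow> int" where
  "Ind G \<gamma> = (\<Sum>p\<in>arc G (Ini \<gamma>) (Ter \<gamma>). endpoint_sign p)"

definition J_diagram :: "diagram \<Rightarrow> nat \<Rightarrow> int \<Rightarrow> int" where
  "J_diagram G i n = (\<Sum>\<gamma>\<in>{\<gamma> \<in> chords_of_type G i i. Ind G \<gamma> = n}. chord_sign \<gamma>)"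

text \<open>
  Independent of the diagram only for \<open>n \<noteq> 0, -\<lambda>\<close> on \<open>K\<^sub>1\<close> and for \<open>n \<noteq> 0, \<lambda>\<close> on \<open>K\<^sub>2\<close>, where
  \<open>\<lambda>\<close> is the linking difference.
\<close>

definition J :: "link \<Rightarrow> nat \<Rightarrow> int \<Rightarrow> int" where
  "J L i n = (SOME z. \<exists>G\<in>L. z = J_diagram G i n)"

definition endpoint_on :: "diagram \<Rightarrow> nat \<Rightarrow> chord \<Rightarrow> chord endpoint" where
  "endpoint_on G i \<gamma> = (if Ini \<gamma> \<in> set (G ! i) then Ini \<gamma> else Ter \<gamma>)"

text \<open>The index of a nonself-chord \<open>\<gamma>\<close> of type \<open>(i, j)\<close> relative to the nonself-chord \<open>\<gamma>\<^sub>0\<close>.\<close>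

definition Ind_rel :: "diagram \<Rightarrow> chord \<Rightarrow> nat \<Rightarrow> nat \<Rightarrow> chord \<Rightarrow> int" where
  "Ind_rel G \<gamma>\<^sub>0 i j \<gamma> =
     (if \<gamma> = \<gamma>\<^sub>0 then 0
      else (\<Sum>p\<in>arc G (Ini \<gamma>) (endpoint_on G i \<gamma>\<^sub>0) \<union> arc G (endpoint_on G j \<gamma>\<^sub>0) (Ter \<gamma>).
              endpoint_sign p))"

definition J_rel :: "diagram \<Rightarrow> chord \<Rightarrow> nat \<Rightarrow> nat \<Rightarrow> int \<Rightarrow> int" where
  "J_rel G \<gamma>\<^sub>0 i j n =
     (\<Sum>\<gamma>\<in>{\<gamma> \<in> chords_of_type G i j. Ind_rel G \<gamma>\<^sub>0 i j \<gamma> = n}. chord_sign \<gamma>)"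

text \<open>The Laurent polynomial ring \<open>\<int>[t, t\<inverse>]\<close> is the group ring of \<open>\<int>\<close>.\<close>

type_synonym laurent = "int \<Rightarrow>\<^sub>0 int"

definition t_pow :: "int \<Rightarrow> laurent" where
  "t_pow k = Poly_Mapping.single k 1"

definition F_poly :: "diagram \<Rightarrow> chord \<Rightarrow> nat \<Rightarrow> nat \<Rightarrow> laurent" where
  "F_poly G \<gamma>\<^sub>0 i j = Sum_any (\<lambda>n. of_int (J_rel G \<gamma>\<^sub>0 i j n) * t_pow n)"

text \<open>The class of \<open>f\<close> in \<open>\<Lambda>\<^sub>s = \<int>[t, t\<inverse>] / (t\<^sup>s - 1)\<close>.\<close>

definition Lambda_class :: "nat \<Rightarrow> laurent \<Rightarrow> laurent set" where
  "Lambda_class s f = {h. t_pow (int s) - 1 dvd h - f}"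

text \<open>The class \<open>[f, g]\<close> in \<open>\<Gamma>(s)\<close>, as a subset of \<open>\<Lambda>\<^sub>s \<times> \<Lambda>\<^sub>s\<close>.\<close>

definition Gamma_class :: "nat \<Rightarrow> laurent \<Rightarrow> laurent \<Rightarrow> (laurent set \<times> laurent set) set" where
  "Gamma_class s f g =
     {(Lambda_class s (t_pow k * f), Lambda_class s (t_pow (- k) * g)) | k. True}"

text \<open>
  Meant for a 2-component link with nonnegative linking difference.  The chosen diagram ranges
  over those diagrams of the link that have a nonself-chord.
\<close>

definition linking_class :: "link \<Rightarrow> (laurent set \<times> laurent set) set" where
  "linking_class L =
     (SOME c. \<exists>G\<in>L. \<exists>\<gamma>\<^sub>0\<in>nonself_chords G.
        c = Gamma_class (nat (linking_difference L)) (F_poly G \<gamma>\<^sub>0 0 1) (F_poly G \<gamma>\<^sub>0 1 0))"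

end

theory Submission
  imports Defs "HOL-Library.Multiset"
begin

text \<open>
  Run along a circle and add up the signs of the endpoints passed so far.  If the linking
  difference is \<open>0\<close>, then the signs on each circle add up to \<open>0\<close>, so every endpoint \<open>p\<close> gets a
  height \<open>h p\<close>, and the heights are unique up to one constant for each circle.  All indices can be
  read off from them: \<open>height_index h \<gamma> = h (Ter \<gamma>) - h (Ini \<gamma>) + \<epsilon>\<close>, where \<open>\<epsilon>\<close> is the sign of
  \<open>\<gamma>\<close>, is \<open>Ind'\<close> of a self-chord, and differs from \<open>Ind'\<close> of a nonself-chord relative to \<open>\<gamma>\<^sub>0\<close> by
  a constant that depends on the type only and is opposite for the two types.  Hence
  \<open>J\<close> and the linking class together are the sums of the signs of the chords of given type and
  height index, up to a relative shift of the heights of the two circles.  Two diagrams with the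
  same sums satisfy \<open>same_data\<close>.

  The data do not change under the moves because heights can be carried along.  R1 deletes a
  self-chord of index \<open>0\<close>, R2 deletes two chords of opposite signs with the same type and index, and
  R3 keeps all indices.  A shell of sign \<open>\<sigma>\<close> around either endpoint of \<open>\<gamma>\<close> lowers the index of \<open>\<gamma>\<close>
  by \<open>\<sigma>\<epsilon>\<close>, affects no other chord, and has index \<open>1\<close> itself.  So S1 keeps the indices, and in S2
  the two shells make up for the effect of the exchange.  Apart from self-chords
  of index \<open>0\<close> and \<open>1\<close>, chords are inserted and deleted only in pairs of opposite signs with the
  same type and index.

  For the converse, shells are treated as decorations of an underlying diagram \<open>w\<close>.  The index of a
  chord is its index in \<open>w\<close>, corrected by the sum of the signs of its shells, and S1 and R2 show that
  only this sum matters.  In this language S2 says that neighbouring endpoints of different chords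
  may be exchanged if all indices are kept.  Neighbouring endpoints of the same chord may also be
  exchanged, by going once around the circle.  Hence the chords with their signs, their types and
  their indices determine the diagram up to S-equivalence (\<open>realization_unique\<close>), and every
  further step may be carried out in the most convenient arrangement: a self-chord of index \<open>0\<close>
  is isolated and removed by R1, a self-chord of index \<open>1\<close> is turned into a shell, and two chords of
  opposite signs with the same type and index are made parallel and removed by R2.  So a set of
  chords without net data can be inserted or removed (\<open>equivalent_remove_zero_data\<close>).  If \<open>G\<close> and
  \<open>H\<close> have the same data, let \<open>-H\<close> be a copy of the chords of \<open>H\<close> with the opposite signs.  Then
  \<open>G\<close> is equivalent to \<open>G\<close>, \<open>H\<close> and \<open>-H\<close> together, as \<open>H\<close> and \<open>-H\<close> cancel, and this is equivalent
  to \<open>H\<close>, as \<open>G\<close> and \<open>-H\<close> cancel.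
\<close>

section \<open>Recognizing Gauss diagrams\<close>

text \<open>
  Apart from the number of circles, being a Gauss diagram depends on the multiset of endpoints
  only.  So moves that permute endpoints preserve it, and insertions of chords are easily checked.
\<close>

lemma gauss_diagram_mset_cong:
  assumes "length G = length H" and "mset (concat G) = mset (concat H)"
  shows "gauss_diagram \<mu> G \<longleftrightarrow> gauss_diagram \<mu> H"
proof -
  have "distinct (concat G) = distinct (concat H)" and "set (concat G) = set (concat H)"
    using assms(2) by (metis mset_eq_imp_distinct_iff, metis mset_eq_setD)
  with assms(1) show ?thesis unfolding gauss_diagram_def by simp
qed

lemma gauss_diagram_insert_chord:
  assumes "length H = length G"
    and m: "mset (concat H) = mset (concat G) + {#Ini c, Ter c#}"
    and c: "Ini c \<notin> set (concat G)" "Ter c \<notin> set (concat G)" "chord_sign c \<in> {1, -1}"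
    and G: "gauss_diagram \<mu> G"
  shows "gauss_diagram \<mu> H"
proof -
  have "mset (concat H) = mset (Ini c # Ter c # concat G)" using m by simp
  then have "distinct (concat H) = distinct (Ini c # Ter c # concat G)"
    and s: "set (concat H) = set (Ini c # Ter c # concat G)"
    by (metis mset_eq_imp_distinct_iff, metis mset_eq_setD)
  moreover have "distinct (Ini c # Ter c # concat G)"
    using c G unfolding gauss_diagram_def by auto
  ultimately show ?thesis
    using assms(1) c G unfolding gauss_diagram_def by auto
qed

lemma gauss_diagram_distinct_nth:
  "gauss_diagram \<mu> G \<Longrightarrow> i < \<mu> \<Longrightarrow> distinct (G ! i)"
  unfolding gauss_diagram_def by (metis distinct_concat_iff nth_mem)

lemma distinct_concat_same_index:
  assumes "distinct (concat G)" "i < length G" "j < length G" "x \<in> set (G ! i)" "x \<in> set (G ! j)"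
  shows "i = j"
  using assms
proof (induction G arbitrary: i j)
  case (Cons a G)
  have "\<And>k. k < length G \<Longrightarrow> x \<in> set (G ! k) \<Longrightarrow> x \<notin> set a"
    using Cons.prems(1) nth_mem by fastforce
  with Cons show ?case by (cases i; cases j; simp; blast)
qed simp

lemma gauss_diagram_same_index:
  assumes "gauss_diagram \<mu> G" "i < \<mu>" "j < \<mu>" "x \<in> set (G ! i)" "x \<in> set (G ! j)"
  shows "i = j"
  using assms distinct_concat_same_index unfolding gauss_diagram_def by metis

lemma in_concat_nth: "x \<in> set (concat G) \<longleftrightarrow> (\<exists>i<length G. x \<in> set (G ! i))"
  by (auto simp: in_set_conv_nth) (metis nth_mem in_set_conv_nth)+

lemma finite_chords: "finite (chords G)"
proof -
  have "chords G \<subseteq> chord_of ` set (concat G)" unfolding chords_def by force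
  then show ?thesis by (rule finite_subset) simp
qed

lemma finite_chords_of_type: "finite (chords_of_type G i j)"
proof -
  have "chords_of_type G i j \<subseteq> chord_of ` set (G ! i)" unfolding chords_of_type_def by force
  then show ?thesis by (rule finite_subset) simp
qed

lemma endpoint_in_gauss_diagram:
  assumes "gauss_diagram \<mu> G"
  shows "p \<in> set (concat G) \<longleftrightarrow> chord_of p \<in> chords G"
  using assms unfolding gauss_diagram_def chords_def by (cases p) auto

lemma chord_sign_in_gauss_diagram:
  "gauss_diagram \<mu> G \<Longrightarrow> c \<in> chords G \<Longrightarrow> chord_sign c = 1 \<or> chord_sign c = -1"
  unfolding gauss_diagram_def chords_def by auto

lemma endpoint_sign_in_gauss_diagram:
  "gauss_diagram \<mu> G \<Longrightarrow> p \<in> set (concat G) \<Longrightarrow> endpoint_sign p = 1 \<or> endpoint_sign p = -1"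
  using chord_sign_in_gauss_diagram[of \<mu> G "chord_of p"] endpoint_in_gauss_diagram[of \<mu> G p]
  by (cases p) auto


section \<open>Heights along the circles\<close>

definition tot :: "chord endpoint list \<Rightarrow> int" where
  "tot ws = sum_list (map endpoint_sign ws)"

primrec climbs :: "(chord endpoint \<Rightarrow> int) \<Rightarrow> int \<Rightarrow> chord endpoint list \<Rightarrow> bool" where
  "climbs h c [] = True"
| "climbs h c (x # xs) = (h x = c \<and> climbs h (c + endpoint_sign x) xs)"

text \<open>
  A word of total sign \<open>0\<close> carries consistent heights wherever its base point is; the constant \<open>c\<close>
  is the height at the base point.  Both parts together are invariant under rotation, so cyclic
  adjacency never needs a case distinction.
\<close>

definition level :: "(chord endpoint \<Rightarrow> int) \<Rightarrow> chord endpoint list \<Rightarrow> bool" where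
  "level h ws \<longleftrightarrow> tot ws = 0 \<and> (\<exists>c. climbs h c ws)"

definition potential :: "diagram \<Rightarrow> (chord endpoint \<Rightarrow> int) \<Rightarrow> bool" where
  "potential G h \<longleftrightarrow> (\<forall>ws\<in>set G. level h ws)"

text \<open>
  For a self-chord this is the sum of the signs on the open arc from \<open>Ini \<gamma>\<close> to \<open>Ter \<gamma>\<close>: the
  height \<open>h (Ter \<gamma>)\<close> before the terminal endpoint minus the height \<open>h (Ini \<gamma>) - chord_sign \<gamma>\<close>
  after the initial endpoint.
\<close>

definition height_index :: "(chord endpoint \<Rightarrow> int) \<Rightarrow> chord \<Rightarrow> int" where
  "height_index h \<gamma> = h (Ter \<gamma>) - h (Ini \<gamma>) + chord_sign \<gamma>"

lemma tot_simps [simp]: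
  "tot [] = 0" "tot (x # xs) = endpoint_sign x + tot xs" "tot (xs @ ys) = tot xs + tot ys"
  by (simp_all add: tot_def)

lemma tot_rotate [simp]: "tot (rotate k ws) = tot ws"
proof -
  have "tot ws = tot (take (k mod length ws) ws @ drop (k mod length ws) ws)" by simp
  then show ?thesis unfolding rotate_drop_take tot_simps by simp
qed

lemma climbs_append [simp]: "climbs h c (xs @ ys) \<longleftrightarrow> climbs h c xs \<and> climbs h (c + tot xs) ys"
  by (induction xs arbitrary: c) (auto simp: algebra_simps)

lemma climbs_cong: "climbs h c ws \<Longrightarrow> (\<And>x. x \<in> set ws \<Longrightarrow> h' x = h x) \<Longrightarrow> climbs h' c ws"
  by (induction ws arbitrary: c) auto

lemma climbs_shift: "climbs h c ws \<Longrightarrow> (\<And>x. x \<in> set ws \<Longrightarrow> h' x = h x + d) \<Longrightarrow> climbs h' (c + d) ws"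
proof (induction ws arbitrary: c)
  case (Cons a ws)
  have "climbs h' (c + endpoint_sign a + d) ws" using Cons by auto
  with Cons.prems show ?case by (simp add: algebra_simps)
qed simp

lemma climbs_unique:
  "climbs h c ws \<Longrightarrow> climbs h' c' ws \<Longrightarrow> x \<in> set ws \<Longrightarrow> h' x = h x + (c' - c)"
  by (induction ws arbitrary: c c') force+

lemma climbs_exists: "distinct ws \<Longrightarrow> \<exists>h. climbs h c ws"
proof (induction ws arbitrary: c)
  case (Cons x ws)
  then obtain h where "climbs h (c + endpoint_sign x) ws" by fastforce
  then have "climbs (h(x := c)) (c + endpoint_sign x) ws"
    by (rule climbs_cong) (use Cons.prems in auto)
  then have "climbs (h(x := c)) c (x # ws)" by simp
  then show ?case by blast
qed simp

lemma level_cong: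
  assumes "\<And>x. x \<in> set ws \<Longrightarrow> h x = h' x" shows "level h ws = level h' ws"
proof -
  have "climbs h c ws = climbs h' c ws" for c
    using assms climbs_cong[of h c ws h'] climbs_cong[of h' c ws h] by auto
  then show ?thesis unfolding level_def by simp
qed

text \<open>
  Moving the base point past \<open>xs\<close> changes its height by \<open>tot xs\<close>, and the total sign \<open>0\<close> makes the
  heights match again at the old base point.
\<close>

lemma level_swap: "level h (xs @ ys) \<Longrightarrow> level h (ys @ xs)"
proof -
  assume "level h (xs @ ys)"
  then obtain c where c: "climbs h c xs" "climbs h (c + tot xs) ys" "tot xs + tot ys = 0"
    unfolding level_def by auto
  have "c + tot xs + tot ys = c" using c(3) by simp
  then have "climbs h (c + tot xs) (ys @ xs)" unfolding climbs_append using c(1,2) by metis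
  then show "level h (ys @ xs)" unfolding level_def using c(3) by (auto simp: algebra_simps)
qed

lemma level_rotate [simp]: "level h (rotate k ws) \<longleftrightarrow> level h ws"
proof -
  have split: "rotate k ws = drop (k mod length ws) ws @ take (k mod length ws) ws"
    by (rule rotate_drop_take)
  show ?thesis
  proof
    assume "level h (rotate k ws)"
    from level_swap[OF this[unfolded split]] show "level h ws" by simp
  next
    assume "level h ws"
    then have "level h (take (k mod length ws) ws @ drop (k mod length ws) ws)" by simp
    from level_swap[OF this] show "level h (rotate k ws)" unfolding split .
  qed
qed

lemma potential_exists:
  assumes "distinct (concat G)" and "\<And>ws. ws \<in> set G \<Longrightarrow> tot ws = 0"
  shows "\<exists>h. potential G h \<and> (\<forall>ws\<in>set G. climbs h 0 ws)"
  using assms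
proof (induction G)
  case Nil
  then show ?case by (simp add: potential_def)
next
  case (Cons ws G)
  then obtain h where h: "potential G h" "\<forall>ws\<in>set G. climbs h 0 ws" by auto
  obtain h' where h': "climbs h' 0 ws" using climbs_exists Cons.prems(1) by fastforce
  let ?h = "\<lambda>x. if x \<in> set ws then h' x else h x"
  have "climbs ?h 0 ws" by (rule climbs_cong[OF h']) simp
  moreover have "climbs ?h 0 vs" if "vs \<in> set G" for vs
  proof -
    have "set vs \<inter> set ws = {}" using Cons.prems(1) that by auto
    then show ?thesis using h(2) that by (rule_tac climbs_cong[of h]) auto
  qed
  ultimately show ?case using Cons.prems(2) unfolding potential_def level_def
    by (intro exI[of _ ?h]) auto
qed

lemma followed_by_word: "i < length G \<Longrightarrow> G ! i = us @ p # q # vs \<Longrightarrow> followed_by G p q"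
  unfolding followed_by_def by (metis append_Cons rotate_append)

text \<open>
  Words are cyclic only up to a rotation, so filtering a rotated word gives a rotation of the
  filtered word, by an amount that depends on the word.
\<close>

lemma filter_rotate: "\<exists>k'. filter P (rotate k ws) = rotate k' (filter P ws)"
proof -
  let ?t = "take (k mod length ws) ws" and ?d = "drop (k mod length ws) ws"
  have "filter P (rotate k ws) = filter P ?d @ filter P ?t"
    by (simp add: rotate_drop_take)
  also have "\<dots> = rotate (length (filter P ?t)) (filter P ?t @ filter P ?d)"
    by (simp add: rotate_append)
  also have "filter P ?t @ filter P ?d = filter P ws"
    by (metis append_take_drop_id filter_append)
  finally show ?thesis by blast
qed

definition remove_endpoints :: "chord endpoint set \<Rightarrow> diagram \<Rightarrow> diagram" where
  "remove_endpoints E G = map (filter (\<lambda>p. p \<notin> E)) G"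

lemma delete_chords_eq_remove: "delete_chords S G = remove_endpoints {p. chord_of p \<in> S} G"
  by (simp add: delete_chords_def remove_endpoints_def)

lemma endpoints_of_chord: "{p. chord_of p \<in> {c}} = {Ini c, Ter c}"
proof (intro set_eqI iffI)
  show "p \<in> {Ini c, Ter c}" if "p \<in> {p. chord_of p \<in> {c}}" for p using that by (cases p) auto
qed auto

lemma remove_endpoints_Un: "remove_endpoints (E \<union> F) G = remove_endpoints F (remove_endpoints E G)"
  by (simp add: remove_endpoints_def conj_commute)

lemma remove_endpoints_followed_by:
  assumes "followed_by G x y" "x \<notin> E" "y \<notin> E"
  shows "followed_by (remove_endpoints E G) x y"
proof -
  from assms(1) obtain i k vs where i: "i < length G" "rotate k (G ! i) = x # y # vs"
    unfolding followed_by_def by auto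
  obtain k' where "filter (\<lambda>p. p \<notin> E) (rotate k (G ! i)) = rotate k' (filter (\<lambda>p. p \<notin> E) (G ! i))"
    using filter_rotate by blast
  with i assms(2,3) have "rotate k' (remove_endpoints E G ! i) = x # y # filter (\<lambda>p. p \<notin> E) vs"
    by (simp add: remove_endpoints_def)
  with i(1) show ?thesis unfolding followed_by_def remove_endpoints_def
    by (metis length_map)
qed

lemma distinct_concat_remove: "distinct (concat G) \<Longrightarrow> distinct (concat (remove_endpoints E G))"
  by (induction G) (auto simp: remove_endpoints_def)

text \<open>
  The height after two neighbouring endpoints of opposite signs is the height before them, so no
  other height changes when they are removed.
\<close>

lemma potential_remove_followed_by:
  assumes G: "potential G h" "distinct (concat G)"
    and xy: "followed_by G x y" "endpoint_sign x + endpoint_sign y = 0"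
  shows "potential (remove_endpoints {x, y} G) h"
  unfolding potential_def
proof
  fix ws assume "ws \<in> set (remove_endpoints {x, y} G)"
  then obtain j where j: "j < length G" "ws = filter (\<lambda>p. p \<notin> {x, y}) (G ! j)"
    unfolding remove_endpoints_def by (auto simp: in_set_conv_nth)
  have lev: "level h (G ! j)" using G(1) j(1) unfolding potential_def by simp
  from xy(1) obtain i k vs where i: "i < length G" "rotate k (G ! i) = x # y # vs"
    unfolding followed_by_def by auto
  have xi: "x \<in> set (G ! i)" "y \<in> set (G ! i)"
    using i(2) by (metis list.set_intros set_rotate)+
  show "level h ws"
  proof (cases "j = i")
    case True
    have d: "distinct (x # y # vs)"
      using G(2) i by (metis distinct_concat_iff distinct_rotate nth_mem)
    have "level h (x # y # vs)" using lev True i(2) by (metis level_rotate)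
    then have l: "level h vs" using xy(2) unfolding level_def
      by (auto simp: add.assoc)
    obtain k' where "filter (\<lambda>p. p \<notin> {x, y}) (rotate k (G ! i))
        = rotate k' (filter (\<lambda>p. p \<notin> {x, y}) (G ! i))"
      using filter_rotate by blast
    moreover have "filter (\<lambda>p. p \<notin> {x, y}) (x # y # vs) = vs"
      using d by (auto intro!: filter_True)
    ultimately have "vs = rotate k' ws" using i(2) j(2) True by simp
    with l show ?thesis by simp
  next
    case False
    then have "x \<notin> set (G ! j)" "y \<notin> set (G ! j)"
      using xi G(2) i(1) j(1) distinct_concat_same_index by metis+
    then have "ws = G ! j" using j(2) by (auto intro!: filter_True)
    with lev show ?thesis by simp
  qed
qed

lemma potential_remove_adjacent:
  assumes "potential G h" "distinct (concat G)"
    and "adjacent G x y" "endpoint_sign x + endpoint_sign y = 0"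
  shows "potential (remove_endpoints {x, y} G) h"
  using assms potential_remove_followed_by[of G h x y] potential_remove_followed_by[of G h y x]
  unfolding adjacent_def by (auto simp: insert_commute add.commute)

text \<open>
  Each of the two endpoints now has the other one on its other side; all other heights are
  unaffected.
\<close>

lemma potential_exchange:
  assumes G: "potential G h" "distinct (concat G)" and pq: "followed_by G p q"
  shows "potential (exchange p q G)
    (h(p := h p + endpoint_sign q, q := h q - endpoint_sign p))" (is "potential _ ?h")
  unfolding potential_def
proof
  fix ws assume "ws \<in> set (exchange p q G)"
  then obtain j where j: "j < length G" "ws = map (Transposition.transpose p q) (G ! j)"
    unfolding exchange_def by (auto simp: in_set_conv_nth)
  have lev: "level h (G ! j)" using G(1) j(1) unfolding potential_def by simp
  from pq obtain i k vs where i: "i < length G" "rotate k (G ! i) = p # q # vs"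
    unfolding followed_by_def by auto
  have xi: "p \<in> set (G ! i)" "q \<in> set (G ! i)"
    using i(2) by (metis list.set_intros set_rotate)+
  show "level ?h ws"
  proof (cases "j = i")
    case True
    have d: "distinct (p # q # vs)"
      using G(2) i by (metis distinct_concat_iff distinct_rotate nth_mem)
    have "level h (p # q # vs)" using lev True i(2) by (metis level_rotate)
    then obtain c where c: "h p = c" "h q = c + endpoint_sign p"
        "climbs h (c + endpoint_sign p + endpoint_sign q) vs"
        "endpoint_sign p + endpoint_sign q + tot vs = 0"
      unfolding level_def by auto
    have "climbs ?h (c + endpoint_sign p + endpoint_sign q) vs"
      by (rule climbs_cong[OF c(3)]) (use d in auto)
    then have "climbs ?h c (q # p # vs)" using c d by (auto simp: algebra_simps)
    then have l: "level ?h (q # p # vs)" unfolding level_def using c(4) by auto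
    have "rotate k ws = map (Transposition.transpose p q) (p # q # vs)"
      using j(2) True i(2) by (metis rotate_map)
    also have "\<dots> = q # p # vs"
      using d by (auto simp: Transposition.transpose_def intro!: map_idI)
    finally show ?thesis using l by (metis level_rotate)
  next
    case False
    then have n: "p \<notin> set (G ! j)" "q \<notin> set (G ! j)"
      using xi G(2) i(1) j(1) distinct_concat_same_index by metis+
    then have "ws = G ! j" using j(2)
      by (auto simp: Transposition.transpose_def intro!: map_idI)
    moreover have "level ?h (G ! j) = level h (G ! j)"
      using n by (intro level_cong) auto
    ultimately show ?thesis using lev by simp
  qed
qed

definition shell_left :: "chord endpoint \<Rightarrow> chord \<Rightarrow> chord endpoint" where
  "shell_left p c = (if endpoint_sign p > 0 then Ini c else Ter c)"

definition shell_right :: "chord endpoint \<Rightarrow> chord \<Rightarrow> chord endpoint" where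
  "shell_right p c = (if endpoint_sign p > 0 then Ter c else Ini c)"

lemma shell_at_iff:
  "shell_at G p s \<longleftrightarrow> followed_by G (shell_left p s) p \<and> followed_by G p (shell_right p s)"
  by (simp add: shell_at_def shell_left_def shell_right_def)

lemma chord_of_shell_left [simp]: "chord_of (shell_left p c) = c"
  and chord_of_shell_right [simp]: "chord_of (shell_right p c) = c"
  and shell_left_neq_right [simp]: "shell_left p c \<noteq> shell_right p c"
  by (auto simp: shell_left_def shell_right_def)

lemma shell_endpoints: "{shell_left p c, shell_right p c} = {Ini c, Ter c}"
  by (auto simp: shell_left_def shell_right_def)

lemma rotate_unique:
  assumes "distinct ws" "rotate k ws = x # us" "rotate l ws = x # vs"
  shows "us = vs"
proof -
  let ?n = "length ws"
  have n: "?n > 0" using assms(2) by (metis length_rotate length_greater_0_conv list.distinct(1))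
  have "ws ! (k mod ?n) = x" "ws ! (l mod ?n) = x"
    using assms(2,3) n hd_rotate_conv_nth[of ws k] hd_rotate_conv_nth[of ws l] by force+
  then have "k mod ?n = l mod ?n" using assms(1) n
    by (metis mod_less_divisor nth_eq_iff_index_eq)
  then have "rotate k ws = rotate l ws" by (metis rotate_conv_mod)
  with assms(2,3) show ?thesis by simp
qed

lemma rotate_to_front:
  assumes "x \<in> set ws" shows "\<exists>k us. rotate k ws = x # us"
proof -
  obtain as bs where "ws = as @ x # bs" using assms by (meson split_list)
  then show ?thesis by (metis append_Cons rotate_append)
qed

text \<open>
  The two adjacencies of a shell are stated for separate base points; as all endpoints are
  distinct, they hold for a common one.
\<close>

lemma shell_at_rotation:
  assumes H: "distinct (concat H)" and s: "shell_at H p s"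
  obtains i k vs where "i < length H"
    "rotate k (H ! i) = shell_left p s # p # shell_right p s # vs"
proof -
  let ?l = "shell_left p s" and ?r = "shell_right p s"
  from s obtain i k us where i: "i < length H" "rotate k (H ! i) = ?l # p # us"
    unfolding shell_at_iff followed_by_def by auto
  from s obtain j l vs where j: "j < length H" "rotate l (H ! j) = p # ?r # vs"
    unfolding shell_at_iff followed_by_def by auto
  have "p \<in> set (H ! i)" "p \<in> set (H ! j)"
    using i j by (metis list.set_intros set_rotate)+
  then have ij: "i = j" using H i(1) j(1) distinct_concat_same_index by metis
  have d: "distinct (H ! i)" using H i(1) by (metis distinct_concat_iff nth_mem)
  have "rotate (1 + k) (H ! i) = p # us @ [?l]" using i(2) by simp
  then have e: "us @ [?l] = ?r # vs" using rotate_unique[OF d] j(2) ij by blast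
  then obtain us' where "us = ?r # us'"
    by (cases us) (use shell_left_neq_right in auto)
  with i that show ?thesis by blast
qed

lemma shell_at_chord_neq:
  assumes "distinct (concat H)" "shell_at H p s" shows "chord_of p \<noteq> s"
proof -
  obtain i k vs where i: "i < length H"
    "rotate k (H ! i) = shell_left p s # p # shell_right p s # vs"
    using shell_at_rotation[OF assms] .
  then have "distinct (shell_left p s # p # shell_right p s # vs)"
    using assms(1) by (metis distinct_concat_iff distinct_rotate nth_mem)
  then have "p \<notin> {shell_left p s, shell_right p s}" by auto
  then show ?thesis unfolding shell_endpoints by (cases p) auto
qed

text \<open>
  The shell endpoint before \<open>p\<close> takes over the height of \<open>p\<close> and has the sign
  \<open>- chord_sign s * endpoint_sign p\<close>; the shell endpoint after \<open>p\<close> has the opposite sign, so that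
  the heights outside the shell are kept.
\<close>

definition add_shell_heights ::
  "chord endpoint \<Rightarrow> chord \<Rightarrow> (chord endpoint \<Rightarrow> int) \<Rightarrow> chord endpoint \<Rightarrow> int" where
  "add_shell_heights p s h = h(shell_left p s := h p,
     p := h p - chord_sign s * endpoint_sign p,
     shell_right p s := h p - chord_sign s * endpoint_sign p + endpoint_sign p)"

lemma potential_add_shell:
  assumes H: "distinct (concat H)" and s: "shell_at H p s"
    and p: "endpoint_sign p = 1 \<or> endpoint_sign p = -1"
    and K: "potential (delete_chords {s} H) h"
  shows "potential H (add_shell_heights p s h)" (is "potential H ?h")
  unfolding potential_def
proof
  fix ws assume "ws \<in> set H"
  then obtain j where j: "j < length H" "ws = H ! j" by (auto simp: in_set_conv_nth)
  let ?l = "shell_left p s" and ?r = "shell_right p s"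
  obtain i k vs where i: "i < length H" "rotate k (H ! i) = ?l # p # ?r # vs"
    using shell_at_rotation[OF H s] .
  have xi: "p \<in> set (H ! i)" "?l \<in> set (H ! i)" "?r \<in> set (H ! i)"
    using i(2) by (metis list.set_intros set_rotate)+
  have lev: "level h (filter (\<lambda>p. chord_of p \<notin> {s}) (H ! j))"
    using K j(1) unfolding potential_def delete_chords_def by simp
  have ps: "chord_of p \<noteq> s" using shell_at_chord_neq[OF H s] .
  show "level ?h ws"
  proof (cases "j = i")
    case True
    have d: "distinct (?l # p # ?r # vs)"
      using H i by (metis distinct_concat_iff distinct_rotate nth_mem)
    obtain k' where k': "filter (\<lambda>p. chord_of p \<notin> {s}) (rotate k (H ! i))
        = rotate k' (filter (\<lambda>p. chord_of p \<notin> {s}) (H ! i))"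
      using filter_rotate by blast
    have vs: "chord_of x \<noteq> s" if "x \<in> set vs" for x
    proof
      assume "chord_of x = s"
      then have "x \<in> {?l, ?r}" unfolding shell_endpoints by (cases x) auto
      with d that show False by auto
    qed
    have "filter (\<lambda>p. chord_of p \<notin> {s}) (rotate k (H ! i)) = p # vs"
      using i(2) ps vs by (auto intro!: filter_True)
    with lev True k' have "level h (p # vs)" by (metis level_rotate)
    then obtain c where c: "h p = c" "climbs h (c + endpoint_sign p) vs" "endpoint_sign p + tot vs = 0"
      unfolding level_def by auto
    have v: "climbs ?h (c + endpoint_sign p) vs"
      by (rule climbs_cong[OF c(2)]) (use d in \<open>auto simp: add_shell_heights_def\<close>)
    have sl: "endpoint_sign ?l = - chord_sign s * endpoint_sign p"
       and sr: "endpoint_sign ?r = chord_sign s * endpoint_sign p"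
      using p by (auto simp: shell_left_def shell_right_def)
    have "climbs ?h c (?l # p # ?r # vs)"
      using c v d by (simp add: add_shell_heights_def sl sr)
    then have "level ?h (?l # p # ?r # vs)" unfolding level_def using c(3) by (auto simp: sl sr)
    then show ?thesis using i(2) j(2) True by (metis level_rotate)
  next
    case False
    then have n: "p \<notin> set (H ! j)" "?l \<notin> set (H ! j)" "?r \<notin> set (H ! j)"
      using xi H i(1) j(1) distinct_concat_same_index by metis+
    have "chord_of x \<noteq> s" if "x \<in> set (H ! j)" for x
    proof
      assume "chord_of x = s"
      then have "x \<in> {?l, ?r}" unfolding shell_endpoints by (cases x) auto
      with n that show False by auto
    qed
    then have "filter (\<lambda>p. chord_of p \<notin> {s}) (H ! j) = H ! j" by (auto intro!: filter_True)
    moreover have "level ?h (H ! j) = level h (H ! j)"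
      using n by (intro level_cong) (auto simp: add_shell_heights_def)
    ultimately show ?thesis using lev j(2) by simp
  qed
qed

section \<open>Invariance of the indices under the moves\<close>

definition sign_sum :: "diagram \<Rightarrow> nat \<Rightarrow> nat \<Rightarrow> (chord \<Rightarrow> bool) \<Rightarrow> int" where
  "sign_sum G i j \<phi> = (\<Sum>\<gamma>\<in>{\<gamma> \<in> chords_of_type G i j. \<phi> \<gamma>}. chord_sign \<gamma>)"

lemma Lk_diagram_sign_sum: "Lk_diagram G i j = sign_sum G i j (\<lambda>_. True)"
  by (simp add: Lk_diagram_def sign_sum_def)

lemma sign_sum_cong:
  assumes "chords_of_type G i j = chords_of_type H i j"
    and "\<And>\<gamma>. \<gamma> \<in> chords_of_type G i j \<Longrightarrow> \<phi> \<gamma> = \<psi> \<gamma>"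
  shows "sign_sum G i j \<phi> = sign_sum H i j \<psi>"
  unfolding sign_sum_def using assms by (intro sum.cong) auto

lemma length_delete_chords [simp]: "length (delete_chords S G) = length G"
  by (simp add: delete_chords_def)

lemma concat_delete_chords: "concat (delete_chords S G) = filter (\<lambda>p. chord_of p \<notin> S) (concat G)"
  by (simp add: delete_chords_def filter_concat)

lemma chords_of_type_delete:
  "i < length G \<Longrightarrow> j < length G \<Longrightarrow>
    chords_of_type (delete_chords S G) i j = chords_of_type G i j - S"
  by (auto simp: chords_of_type_def delete_chords_def)

lemma gauss_diagram_delete: "gauss_diagram \<mu> G \<Longrightarrow> gauss_diagram \<mu> (delete_chords S G)"
  unfolding gauss_diagram_def concat_delete_chords by auto

lemma delete_chords_Un: "delete_chords (S \<union> T) G = delete_chords T (delete_chords S G)"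
  by (simp add: delete_chords_def conj_commute)

lemma sign_sum_delete_one:
  assumes "i < length G" "j < length G" and "s \<in> chords_of_type G i j \<Longrightarrow> \<not> \<phi> s"
  shows "sign_sum (delete_chords {s} G) i j \<phi> = sign_sum G i j \<phi>"
  unfolding sign_sum_def chords_of_type_delete[OF assms(1,2)] using assms(3)
  by (intro sum.cong) auto

lemma self_chord_type:
  assumes "gauss_diagram \<mu> G" "k < \<mu>" "s \<in> chords_of_type G k k"
    and "i < \<mu>" "j < \<mu>" "s \<in> chords_of_type G i j"
  shows "i = j"
  using assms gauss_diagram_same_index unfolding chords_of_type_def by (metis (mono_tags, lifting) mem_Collect_eq)

lemma followed_by_same_circle:
  assumes "followed_by G p q"
  obtains i where "i < length G" "p \<in> set (G ! i)" "q \<in> set (G ! i)"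
  using assms unfolding followed_by_def by (metis list.set_intros set_rotate)

lemma adjacent_same_circle:
  assumes "adjacent G p q"
  obtains i where "i < length G" "p \<in> set (G ! i)" "q \<in> set (G ! i)"
  using assms followed_by_same_circle unfolding adjacent_def by metis

lemma length_exchange [simp]: "length (exchange p q G) = length G"
  by (simp add: exchange_def)

lemma concat_exchange: "concat (exchange p q G) = map (Transposition.transpose p q) (concat G)"
  by (simp add: exchange_def map_concat)

lemma distinct_exchange: "distinct (concat (exchange p q G)) = distinct (concat G)"
  unfolding concat_exchange distinct_map by (metis inj_onI Transposition.transpose_involutory)

lemma set_exchange_nth:
  assumes "distinct (concat G)" "followed_by G p q" "i < length G"
  shows "set (exchange p q G ! i) = set (G ! i)"
proof -
  obtain k where k: "k < length G" "p \<in> set (G ! k)" "q \<in> set (G ! k)"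
    using followed_by_same_circle[OF assms(2)] .
  have "p \<in> set (G ! i) \<longleftrightarrow> q \<in> set (G ! i)"
    using k assms distinct_concat_same_index by metis
  then have "Transposition.transpose p q ` set (G ! i) = set (G ! i)"
    by (metis Transposition.transpose_image_eq)
  then show ?thesis using assms(3) by (simp add: exchange_def)
qed

lemma chords_of_type_exchange:
  assumes "distinct (concat G)" "followed_by G p q" "i < length G" "j < length G"
  shows "chords_of_type (exchange p q G) i j = chords_of_type G i j"
  using assms by (simp add: chords_of_type_def set_exchange_nth)

lemma followed_by_exchange:
  assumes "followed_by G x y" "x \<notin> {p, q}" "y \<notin> {p, q}"
  shows "followed_by (exchange p q G) x y"
proof -
  from assms(1) obtain i k vs where i: "i < length G" "rotate k (G ! i) = x # y # vs"
    unfolding followed_by_def by auto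
  have "rotate k (exchange p q G ! i) = x # y # map (Transposition.transpose p q) vs"
    using i assms(2,3) by (simp add: exchange_def rotate_map Transposition.transpose_def)
  with i(1) show ?thesis unfolding followed_by_def by auto
qed

lemma potential_followed_by:
  assumes "potential G h" "followed_by G p q"
  shows "h q = h p + endpoint_sign p"
proof -
  from assms(2) obtain i k vs where i: "i < length G" "rotate k (G ! i) = p # q # vs"
    unfolding followed_by_def by auto
  have "level h (p # q # vs)" using i assms(1) unfolding potential_def by (metis level_rotate nth_mem)
  then show ?thesis unfolding level_def by auto
qed

definition balanced :: "diagram \<Rightarrow> bool" where
  "balanced G \<longleftrightarrow> (\<forall>ws\<in>set G. tot ws = 0)"

lemma potential_balanced: "potential G h \<Longrightarrow> balanced G"
  unfolding potential_def balanced_def level_def by blast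

definition index_sum :: "(chord endpoint \<Rightarrow> int) \<Rightarrow> diagram \<Rightarrow> nat \<Rightarrow> nat \<Rightarrow> int \<Rightarrow> int" where
  "index_sum h G i j n = sign_sum G i j (\<lambda>\<gamma>. height_index h \<gamma> = n)"

text \<open>
  The potentials are chosen freely on both sides, which takes account of the shift of the heights
  of one circle against those of the other one.  The exceptions \<open>E\<close> will be \<open>{0}\<close> for Reidemeister
  moves and \<open>{0, 1}\<close> in the presence of shell moves.
\<close>

definition same_data :: "int set \<Rightarrow> diagram \<Rightarrow> diagram \<Rightarrow> bool" where
  "same_data E G H \<longleftrightarrow> (\<exists>h h'. potential G h \<and> potential H h' \<and>
     (\<forall>i<2. \<forall>j<2. \<forall>n. i = j \<and> n \<in> E \<or> index_sum h G i j n = index_sum h' H i j n))"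

lemma tot_sum: "distinct ws \<Longrightarrow> tot ws = (\<Sum>p\<in>set ws. endpoint_sign p)"
  by (simp add: tot_def sum_list_distinct_conv_sum_set)

text \<open>
  On circle \<open>i\<close> a self-chord contributes its two opposite endpoint signs, a chord of type \<open>(i, j)\<close>
  contributes minus its sign and a chord of type \<open>(j, i)\<close> its sign.
\<close>

lemma tot_circle:
  assumes G: "gauss_diagram 2 G" and ij: "{i, j} = {0, 1}"
  shows "tot (G ! i) = Lk_diagram G j i - Lk_diagram G i j"
proof -
  let ?I = "{\<gamma>. Ini \<gamma> \<in> set (G ! i)}" and ?T = "{\<gamma>. Ter \<gamma> \<in> set (G ! i)}"
  have lt: "i < 2" "j < 2" "i \<noteq> j" using ij by (auto simp: doubleton_eq_iff)
  have other: "k = i \<or> k = j" if "k < 2" for k using that ij lt by (auto simp: doubleton_eq_iff)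
  have len: "length G = 2" using G by (simp add: gauss_diagram_def)
  have d: "distinct (G ! i)" using G lt gauss_diagram_distinct_nth by blast
  have set: "set (G ! i) = Ini ` ?I \<union> Ter ` ?T"
  proof (intro set_eqI iffI)
    fix x assume x: "x \<in> set (G ! i)"
    show "x \<in> Ini ` ?I \<union> Ter ` ?T"
    proof (cases x)
      case (Ini \<gamma>)
      with x show ?thesis by blast
    next
      case (Ter \<gamma>)
      with x show ?thesis by blast
    qed
  qed auto
  have fin: "finite ?I" "finite ?T"
    by (rule finite_subset[of _ "chord_of ` set (G ! i)"]; force)+
  have I: "?I = chords_of_type G i i \<union> chords_of_type G i j"
  proof (intro set_eqI iffI)
    fix \<gamma> assume "\<gamma> \<in> ?I"
    then have "Ini \<gamma> \<in> set (concat G)" using len lt in_concat_nth[of "Ini \<gamma>" G] by auto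
    then have "Ter \<gamma> \<in> set (concat G)" using G unfolding gauss_diagram_def by blast
    then obtain k where "k < 2" "Ter \<gamma> \<in> set (G ! k)" using len unfolding in_concat_nth by auto
    with other[of k] \<open>\<gamma> \<in> ?I\<close> show "\<gamma> \<in> chords_of_type G i i \<union> chords_of_type G i j"
      unfolding chords_of_type_def by auto
  qed (auto simp: chords_of_type_def)
  have T: "?T = chords_of_type G i i \<union> chords_of_type G j i"
  proof (intro set_eqI iffI)
    fix \<gamma> assume "\<gamma> \<in> ?T"
    then have "Ter \<gamma> \<in> set (concat G)" using len lt in_concat_nth[of "Ter \<gamma>" G] by auto
    then have "Ini \<gamma> \<in> set (concat G)" using G unfolding gauss_diagram_def by blast
    then obtain k where "k < 2" "Ini \<gamma> \<in> set (G ! k)" using len unfolding in_concat_nth by auto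
    with other[of k] \<open>\<gamma> \<in> ?T\<close> show "\<gamma> \<in> chords_of_type G i i \<union> chords_of_type G j i"
      unfolding chords_of_type_def by auto
  qed (auto simp: chords_of_type_def)
  have disj: "chords_of_type G i i \<inter> chords_of_type G i j = {}"
    "chords_of_type G i i \<inter> chords_of_type G j i = {}"
    using G lt gauss_diagram_same_index unfolding chords_of_type_def by blast+
  have "tot (G ! i) = (\<Sum>p\<in>Ini ` ?I \<union> Ter ` ?T. endpoint_sign p)"
    using tot_sum[OF d] set by simp
  also have "\<dots> = (\<Sum>p\<in>Ini ` ?I. endpoint_sign p) + (\<Sum>p\<in>Ter ` ?T. endpoint_sign p)"
    using fin by (intro sum.union_disjoint) auto
  also have "\<dots> = (\<Sum>\<gamma>\<in>?I. - chord_sign \<gamma>) + (\<Sum>\<gamma>\<in>?T. chord_sign \<gamma>)"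
    by (simp add: sum.reindex inj_on_def)
  also have "\<dots> = - (Lk_diagram G i i + Lk_diagram G i j) + (Lk_diagram G i i + Lk_diagram G j i)"
    unfolding Lk_diagram_def I T
    by (subst (1 2) sum.union_disjoint) (use finite_chords_of_type disj in \<open>auto simp: sum_negf\<close>)
  finally show ?thesis by simp
qed

lemma balanced_iff_Lk:
  assumes "gauss_diagram 2 G"
  shows "balanced G \<longleftrightarrow> Lk_diagram G 0 1 = Lk_diagram G 1 0"
proof -
  have len: "length G = 2" using assms by (simp add: gauss_diagram_def)
  have "balanced G \<longleftrightarrow> tot (G ! 0) = 0 \<and> tot (G ! 1) = 0"
    unfolding balanced_def all_set_conv_all_nth len by (simp add: less_2_cases_iff all_conj_distrib) 
  then show ?thesis using tot_circle[OF assms, of 0 1] tot_circle[OF assms, of 1 0]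
    by (auto simp: insert_commute)
qed

lemma balanced_potential:
  "gauss_diagram 2 G \<Longrightarrow> balanced G \<Longrightarrow> \<exists>h. potential G h"
  using potential_exists[of G] unfolding gauss_diagram_def balanced_def by auto

lemma potential_unique:
  assumes "potential G h" "potential G h'"
  shows "\<exists>d. \<forall>i<length G. \<forall>x\<in>set (G ! i). h' x = h x + d i"
proof -
  have "\<exists>d. \<forall>x\<in>set (G ! i). h' x = h x + d" if i: "i < length G" for i
  proof -
    obtain c c' where "climbs h c (G ! i)" "climbs h' c' (G ! i)"
      using assms nth_mem[OF i] unfolding potential_def level_def by blast
    then have "\<forall>x\<in>set (G ! i). h' x = h x + (c' - c)" using climbs_unique by blast
    then show ?thesis by blast
  qed
  then show ?thesis by metis
qed

lemma potential_shift:
  assumes "potential G h" "distinct (concat G)"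
  shows "\<exists>h'. potential G h' \<and> (\<forall>i<length G. \<forall>x\<in>set (G ! i). h' x = h x + d i)"
proof -
  define h' where "h' = (\<lambda>x. h x + d (SOME i. i < length G \<and> x \<in> set (G ! i)))"
  have h': "h' x = h x + d i" if "i < length G" "x \<in> set (G ! i)" for x i
  proof -
    have "(SOME i. i < length G \<and> x \<in> set (G ! i)) = i"
    proof (rule some_equality)
      fix j assume "j < length G \<and> x \<in> set (G ! j)"
      then show "j = i" by (intro distinct_concat_same_index[OF assms(2) _ that(1) _ that(2)]) auto
    qed (use that in simp)
    then show ?thesis by (simp add: h'_def)
  qed
  have "level h' (G ! i)" if "i < length G" for i
  proof -
    have "level h (G ! i)" using assms(1) that unfolding potential_def by simp
    then obtain c where "climbs h c (G ! i)" "tot (G ! i) = 0" unfolding level_def by auto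
    moreover from this have "climbs h' (c + d i) (G ! i)"
      using h'[OF that] by (intro climbs_shift[of h c _ h' "d i"]) auto
    ultimately show ?thesis unfolding level_def by blast
  qed
  then have "potential G h'" unfolding potential_def all_set_conv_all_nth by blast
  with h' show ?thesis by blast
qed

lemma index_sum_shift:
  assumes "\<And>i x. i < 2 \<Longrightarrow> x \<in> set (G ! i) \<Longrightarrow> h' x = h x + d i" and "i < 2" "j < 2"
  shows "index_sum h' G i j n = index_sum h G i j (n - (d j - d i))"
  unfolding index_sum_def
proof (rule sign_sum_cong)
  fix \<gamma> assume "\<gamma> \<in> chords_of_type G i j"
  then have "height_index h' \<gamma> = height_index h \<gamma> + (d j - d i)"
    using assms unfolding chords_of_type_def height_index_def by auto
  then show "height_index h' \<gamma> = n \<longleftrightarrow> height_index h \<gamma> = n - (d j - d i)" by auto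
qed simp

lemma same_dataI:
  assumes "potential G h" "potential H h'"
    and "\<And>i j n. i < 2 \<Longrightarrow> j < 2 \<Longrightarrow> i = j \<and> n \<in> E \<or> index_sum h G i j n = index_sum h' H i j n"
  shows "same_data E G H"
  unfolding same_data_def using assms by blast

lemma same_data_sym: "same_data E G H \<Longrightarrow> same_data E H G"
  unfolding same_data_def by metis

lemma same_data_mono: "same_data E G H \<Longrightarrow> E \<subseteq> F \<Longrightarrow> same_data F G H"
  unfolding same_data_def by (meson subsetD)

text \<open>
  The two potentials of \<open>H\<close> differ by constants, and these are added to the potential of \<open>K\<close>.
\<close>

lemma same_data_trans:
  assumes GH: "same_data E G H" and HK: "same_data E H K"
    and gauss: "gauss_diagram 2 H" "gauss_diagram 2 K"
  shows "same_data E G K"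
proof -
  from GH obtain g h where 1: "potential G g" "potential H h"
    "\<And>i j n. i < 2 \<Longrightarrow> j < 2 \<Longrightarrow> i = j \<and> n \<in> E \<or> index_sum g G i j n = index_sum h H i j n"
    unfolding same_data_def by blast
  from HK obtain h' k where 2: "potential H h'" "potential K k"
    "\<And>i j n. i < 2 \<Longrightarrow> j < 2 \<Longrightarrow> i = j \<and> n \<in> E \<or> index_sum h' H i j n = index_sum k K i j n"
    unfolding same_data_def by blast
  have len: "length H = 2" "length K = 2" "distinct (concat K)"
    using gauss by (auto simp: gauss_diagram_def)
  obtain d where d: "\<And>i x. i < 2 \<Longrightarrow> x \<in> set (H ! i) \<Longrightarrow> h x = h' x + d i"
    using potential_unique[OF 2(1) 1(2)] len by auto
  obtain k' where k': "potential K k'" "\<And>i x. i < 2 \<Longrightarrow> x \<in> set (K ! i) \<Longrightarrow> k' x = k x + d i"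
    using potential_shift[OF 2(2) len(3), of d] len by auto
  show ?thesis
  proof (rule same_dataI[OF 1(1) k'(1)])
    fix i j :: nat and n assume ij: "i < 2" "j < 2"
    have "index_sum h H i j n = index_sum h' H i j (n - (d j - d i))"
      and "index_sum k' K i j n = index_sum k K i j (n - (d j - d i))"
      using index_sum_shift[OF d ij] index_sum_shift[OF k'(2) ij] by auto
    with 1(3)[OF ij, of n] 2(3)[OF ij, of "n - (d j - d i)"]
    show "i = j \<and> n \<in> E \<or> index_sum g G i j n = index_sum k' K i j n" by auto
  qed
qed

lemma same_data_refl:
  "gauss_diagram 2 G \<Longrightarrow> balanced G \<Longrightarrow> same_data E G G"
  using balanced_potential unfolding same_data_def by blast

text \<open>
  The linking numbers are compared first, since they decide whether there are heights at all.
\<close>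

definition same_invariants :: "int set \<Rightarrow> diagram \<Rightarrow> diagram \<Rightarrow> bool" where
  "same_invariants E G H \<longleftrightarrow>
     (\<forall>i<2. \<forall>j<2. i \<noteq> j \<longrightarrow> Lk_diagram G i j = Lk_diagram H i j) \<and>
     (balanced G \<longrightarrow> same_data E G H)"

lemma same_invariants_balanced:
  assumes "same_invariants E G H" "gauss_diagram 2 G" "gauss_diagram 2 H"
  shows "balanced G \<longleftrightarrow> balanced H"
  using assms balanced_iff_Lk unfolding same_invariants_def by auto

text \<open>
  The deleted chord is a self-chord with adjacent endpoints, so its index is \<open>0\<close>.
\<close>

lemma R1_invariants:
  assumes G: "gauss_diagram 2 G" and "R1 G H"
  shows "same_invariants {0} G H"
proof -
  from assms(2) obtain \<gamma> where a: "adjacent G (Ini \<gamma>) (Ter \<gamma>)" and H: "H = delete_chords {\<gamma>} G"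
    unfolding R1_def by auto
  have len: "length G = 2" and dist: "distinct (concat G)" using G by (auto simp: gauss_diagram_def)
  obtain k where k: "k < 2" "\<gamma> \<in> chords_of_type G k k"
    using adjacent_same_circle[OF a] len unfolding chords_of_type_def by auto
  have self: "i = j" if "i < 2" "j < 2" "\<gamma> \<in> chords_of_type G i j" for i j
    using self_chord_type[OF G k that] .
  have "same_data {0} G H" if "balanced G"
  proof -
    obtain h where h: "potential G h" using balanced_potential[OF G] \<open>balanced G\<close> by blast
    have ind: "height_index h \<gamma> = 0"
      using a potential_followed_by[OF h] unfolding adjacent_def height_index_def by force
    have "potential H h" unfolding H delete_chords_eq_remove endpoints_of_chord
      using potential_remove_adjacent[OF h dist a] by simp
    with h show ?thesis
    proof (rule same_dataI)
      fix i j :: nat and n assume ij: "i < 2" "j < 2"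
      show "i = j \<and> n \<in> {0} \<or> index_sum h G i j n = index_sum h H i j n"
      proof (cases "i = j \<and> n = 0")
        case False
        then have "\<not> height_index h \<gamma> = n" if "\<gamma> \<in> chords_of_type G i j"
          using self[OF ij that] ind by auto
        then show ?thesis unfolding H index_sum_def
          using sign_sum_delete_one[of i G j \<gamma> "\<lambda>\<gamma>. height_index h \<gamma> = n"] ij len by auto
      qed simp
    qed
  qed
  moreover have "Lk_diagram G i j = Lk_diagram H i j" if ij: "i < 2" "j < 2" "i \<noteq> j" for i j
  proof -
    have "\<gamma> \<notin> chords_of_type G i j" using self[OF ij(1,2)] ij(3) by blast
    then show ?thesis
      unfolding Lk_diagram_sign_sum H using sign_sum_delete_one[of i G j \<gamma> "\<lambda>_. True"] ij len by simp
  qed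
  ultimately show ?thesis unfolding same_invariants_def by blast
qed

lemma sign_sum_delete_opposite:
  assumes "i < length G" "j < length G" "a \<noteq> b" "chord_sign a = - chord_sign b"
    and "a \<in> chords_of_type G i j \<longleftrightarrow> b \<in> chords_of_type G i j" "\<phi> a \<longleftrightarrow> \<phi> b"
  shows "sign_sum (delete_chords {a, b} G) i j \<phi> = sign_sum G i j \<phi>"
proof (cases "a \<in> chords_of_type G i j \<and> \<phi> a")
  case True
  let ?S = "{\<gamma> \<in> chords_of_type G i j. \<phi> \<gamma>}"
  have "sum chord_sign ?S = sum chord_sign {a, b} + sum chord_sign (?S - {a, b})"
    using True assms(5,6) finite_chords_of_type[of G i j]
    by (subst sum.subset_diff[of "{a, b}" ?S]) auto
  also have "?S - {a, b} = {\<gamma> \<in> chords_of_type G i j - {a, b}. \<phi> \<gamma>}" by auto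
  finally show ?thesis unfolding sign_sum_def chords_of_type_delete[OF assms(1,2)]
    using assms(3,4) by simp
next
  case False
  then show ?thesis unfolding sign_sum_def chords_of_type_delete[OF assms(1,2)] using assms(5,6)
    by (intro sum.cong) auto
qed

text \<open>
  The initial endpoints of a pair as in R2 have opposite signs, and so have the terminal ones.
\<close>

lemma potential_delete_pair:
  assumes h: "potential G h" and dist: "distinct (concat G)" and s: "chord_sign a = - chord_sign b"
    and I: "adjacent G (Ini a) (Ini b)" and T: "adjacent G (Ter a) (Ter b)"
  shows "potential (delete_chords {a, b} G) h"
proof -
  have 1: "potential (remove_endpoints {Ini a, Ini b} G) h"
    using potential_remove_adjacent[OF h dist I] s by simp
  have "adjacent (remove_endpoints {Ini a, Ini b} G) (Ter a) (Ter b)"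
    using T remove_endpoints_followed_by unfolding adjacent_def by auto
  from potential_remove_adjacent[OF 1 distinct_concat_remove[OF dist] this]
  have 2: "potential (remove_endpoints ({Ini a, Ini b} \<union> {Ter a, Ter b}) G) h"
    unfolding remove_endpoints_Un using s by simp
  have "{p. chord_of p \<in> {a, b}} = {Ini a, Ini b} \<union> {Ter a, Ter b}"
  proof (intro set_eqI iffI)
    show "p \<in> {Ini a, Ini b} \<union> {Ter a, Ter b}" if "p \<in> {p. chord_of p \<in> {a, b}}" for p
      using that by (cases p) auto
  qed auto
  with 2 show ?thesis unfolding delete_chords_eq_remove by simp
qed

text \<open>
  The height steps from \<open>a\<close> to \<open>b\<close> are the same in either order of the adjacent endpoints, and they
  make the two indices equal.
\<close>

lemma R2_invariants:
  assumes G: "gauss_diagram 2 G" and "R2 G H"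
  shows "same_invariants {} G H"
proof -
  from assms(2) obtain a b where s: "chord_sign a = - chord_sign b"
    and I: "adjacent G (Ini a) (Ini b)" and T: "adjacent G (Ter a) (Ter b)"
    and H: "H = delete_chords {a, b} G"
    unfolding R2_def by auto
  have len: "length G = 2" and dist: "distinct (concat G)" using G by (auto simp: gauss_diagram_def)
  obtain k l where kl: "k < 2" "Ini a \<in> set (G ! k)" "Ini b \<in> set (G ! k)"
    "l < 2" "Ter a \<in> set (G ! l)" "Ter b \<in> set (G ! l)"
    using adjacent_same_circle[OF I] adjacent_same_circle[OF T] len by metis
  have "a \<in> chords G" using kl len unfolding chords_def in_concat_nth by auto
  then have ab: "a \<noteq> b" using s chord_sign_in_gauss_diagram[OF G] by fastforce
  have type: "a \<in> chords_of_type G i j \<longleftrightarrow> b \<in> chords_of_type G i j" if "i < 2" "j < 2" for i j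
    using gauss_diagram_same_index[OF G] kl that unfolding chords_of_type_def by blast
  have "same_data {} G H" if "balanced G"
  proof -
    obtain h where h: "potential G h" using balanced_potential[OF G] \<open>balanced G\<close> by blast
    have hI: "h (Ini b) = h (Ini a) - chord_sign a" and hT: "h (Ter b) = h (Ter a) + chord_sign a"
      using I T s potential_followed_by[OF h] unfolding adjacent_def by force+
    have ind: "height_index h a = height_index h b"
      using hI hT s unfolding height_index_def by simp
    have "potential H h" unfolding H by (rule potential_delete_pair[OF h dist s I T])
    with h show ?thesis
    proof (rule same_dataI)
      fix i j :: nat and n assume ij: "i < 2" "j < 2"
      show "i = j \<and> n \<in> {} \<or> index_sum h G i j n = index_sum h H i j n"
        using sign_sum_delete_opposite[of i G j a b "\<lambda>\<gamma>. height_index h \<gamma> = n"] ij len type ind ab s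
        unfolding H index_sum_def by auto
    qed
  qed
  moreover have "Lk_diagram G i j = Lk_diagram H i j" if "i < 2" "j < 2" "i \<noteq> j" for i j
    using sign_sum_delete_opposite[of i G j a b] type that len ab s unfolding Lk_diagram_sign_sum H by auto
  ultimately show ?thesis unfolding same_invariants_def by blast
qed

text \<open>
  Each of the three chords takes part in two of the exchanges, and the two resulting changes of its
  index cancel because the signs are equal.
\<close>

lemma R3_invariants:
  assumes G: "gauss_diagram 2 G" and "R3 G H"
  shows "same_invariants {} G H"
proof -
  from assms(2) obtain a b c where d: "distinct [a, b, c]"
    and s: "chord_sign a = chord_sign b" "chord_sign b = chord_sign c"
    and ab: "followed_by G (Ini a) (Ini b)" and ac: "followed_by G (Ter a) (Ini c)"
    and bc: "followed_by G (Ter b) (Ter c)"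
    and H: "H = exchange (Ini a) (Ini b) (exchange (Ter a) (Ini c) (exchange (Ter b) (Ter c) G))"
    unfolding R3_def by auto
  have len: "length G = 2" and dist: "distinct (concat G)" using G by (auto simp: gauss_diagram_def)
  let ?G1 = "exchange (Ter b) (Ter c) G"
  let ?G2 = "exchange (Ter a) (Ini c) ?G1"
  have d1: "distinct (concat ?G1)" and d2: "distinct (concat ?G2)"
    using dist by (simp_all only: distinct_exchange)
  have ac1: "followed_by ?G1 (Ter a) (Ini c)" using ac d by (intro followed_by_exchange) auto
  have ab1: "followed_by ?G1 (Ini a) (Ini b)" using ab d by (intro followed_by_exchange) auto
  have ab2: "followed_by ?G2 (Ini a) (Ini b)" by (rule followed_by_exchange[OF ab1]) (use d in auto)
  have type: "chords_of_type G i j = chords_of_type H i j" if "i < 2" "j < 2" for i j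
    using chords_of_type_exchange[OF dist bc] chords_of_type_exchange[OF d1 ac1]
      chords_of_type_exchange[OF d2 ab2] that len unfolding H by simp
  have "same_data {} G H" if "balanced G"
  proof -
    obtain h where h: "potential G h" using balanced_potential[OF G] \<open>balanced G\<close> by blast
    define h1 where "h1 = h(Ter b := h (Ter b) + endpoint_sign (Ter c), Ter c := h (Ter c) - endpoint_sign (Ter b))"
    define h2 where "h2 = h1(Ter a := h1 (Ter a) + endpoint_sign (Ini c), Ini c := h1 (Ini c) - endpoint_sign (Ter a))"
    define h3 where "h3 = h2(Ini a := h2 (Ini a) + endpoint_sign (Ini b), Ini b := h2 (Ini b) - endpoint_sign (Ini a))"
    have p1: "potential ?G1 h1" unfolding h1_def by (rule potential_exchange[OF h dist bc])
    have p2: "potential ?G2 h2" unfolding h2_def by (rule potential_exchange[OF p1 d1 ac1])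
    have p3: "potential H h3" unfolding h3_def H by (rule potential_exchange[OF p2 d2 ab2])
    have ind: "height_index h3 \<gamma> = height_index h \<gamma>" for \<gamma>
    proof -
      have neq: "a \<noteq> b" "a \<noteq> c" "b \<noteq> c" using d by auto
      have "height_index h1 \<gamma> = height_index h \<gamma>
          + (if \<gamma> = b then chord_sign c else if \<gamma> = c then - chord_sign b else 0)"
        using neq by (simp add: height_index_def h1_def)
      moreover have "height_index h2 \<gamma> = height_index h1 \<gamma>
          + (if \<gamma> = a then - chord_sign c else if \<gamma> = c then chord_sign a else 0)"
        using neq by (simp add: height_index_def h2_def)
      moreover have "height_index h3 \<gamma> = height_index h2 \<gamma>
          + (if \<gamma> = a then chord_sign b else if \<gamma> = b then - chord_sign a else 0)"
        using neq by (simp add: height_index_def h3_def)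
      ultimately show ?thesis using s neq by auto
    qed
    show ?thesis
    proof (rule same_dataI[OF h p3])
      fix i j :: nat and n assume "i < 2" "j < 2"
      then have "index_sum h G i j n = index_sum h3 H i j n"
        unfolding index_sum_def by (intro sign_sum_cong type) (simp_all add: ind)
      then show "i = j \<and> n \<in> {} \<or> index_sum h G i j n = index_sum h3 H i j n" ..
    qed
  qed
  moreover have "Lk_diagram G i j = Lk_diagram H i j" if "i < 2" "j < 2" "i \<noteq> j" for i j
    using type that unfolding Lk_diagram_def by simp
  ultimately show ?thesis unfolding same_invariants_def by blast
qed

lemma endpoint_sign_map [simp]:
  "chord_sign (f (chord_of p)) = chord_sign (chord_of p) \<Longrightarrow>
    endpoint_sign (map_endpoint f p) = endpoint_sign p"
  by (cases p) auto

text \<open>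
  Heights are transported along the relabelling of the endpoints; the rotations do not affect
  them.
\<close>

lemma isomorphic_invariants:
  assumes G: "gauss_diagram 2 G" and H: "gauss_diagram 2 H" and "isomorphic G H"
  shows "same_invariants {} G H"
proof -
  from assms(3) obtain f k where inj: "inj_on f (chords G)"
    and sgn: "\<And>\<gamma>. \<gamma> \<in> chords G \<Longrightarrow> chord_sign (f \<gamma>) = chord_sign \<gamma>"
    and H_eq: "\<And>i. i < length G \<Longrightarrow> H ! i = rotate (k i) (map (map_endpoint f) (G ! i))"
    unfolding isomorphic_def by auto
  have len: "length G = 2" "length H = 2" using G H by (auto simp: gauss_diagram_def)
  let ?m = "map_endpoint f"
  have inj_m: "inj_on ?m (set (concat G))"
  proof (rule inj_onI)
    fix x y assume "x \<in> set (concat G)" "y \<in> set (concat G)" and eq: "?m x = ?m y"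
    then have "chord_of x \<in> chords G" "chord_of y \<in> chords G"
      using endpoint_in_gauss_diagram[OF G] by blast+
    with eq show "x = y" using inj by (cases x; cases y; auto dest: inj_onD)
  qed
  have in_cat: "x \<in> set (concat G)" if "i < 2" "x \<in> set (G ! i)" for x i
    using that len in_concat_nth by metis
  have set_H: "set (H ! i) = ?m ` set (G ! i)" if "i < 2" for i
    using H_eq that len by simp
  have chord_G: "\<gamma> \<in> chords G" if "i < 2" "\<gamma> \<in> chords_of_type G i j" for \<gamma> i j
    using that in_cat[of i "Ini \<gamma>"] unfolding chords_of_type_def chords_def by auto
  have type_H: "chords_of_type H i j = f ` chords_of_type G i j" if ij: "i < 2" "j < 2" for i j
  proof (intro set_eqI iffI)
    fix \<gamma>' assume "\<gamma>' \<in> chords_of_type H i j"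
    then obtain x y where x: "x \<in> set (G ! i)" "?m x = Ini \<gamma>'" and y: "y \<in> set (G ! j)" "?m y = Ter \<gamma>'"
      using set_H ij unfolding chords_of_type_def by fastforce
    obtain \<gamma> where g1: "x = Ini \<gamma>" "f \<gamma> = \<gamma>'" using x(2) by (cases x rule: endpoint.exhaust) auto
    moreover obtain \<delta> where g2: "y = Ter \<delta>" "f \<delta> = \<gamma>'" using y(2) by (cases y rule: endpoint.exhaust) auto
    ultimately have g: "x = Ini \<gamma>" "f \<gamma> = \<gamma>'" "y = Ter \<delta>" "f \<delta> = \<gamma>'" by blast+
    have "chord_of x \<in> chords G" "chord_of y \<in> chords G"
      using in_cat ij x y endpoint_in_gauss_diagram[OF G] by blast+
    then have "\<gamma> = \<delta>" using g inj by (auto dest: inj_onD)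
    with x y g show "\<gamma>' \<in> f ` chords_of_type G i j" unfolding chords_of_type_def by auto
  next
    fix \<gamma>' assume "\<gamma>' \<in> f ` chords_of_type G i j"
    then show "\<gamma>' \<in> chords_of_type H i j"
      using set_H ij unfolding chords_of_type_def by force
  qed
  have sign_sum_eq: "sign_sum G i j \<phi> = sign_sum H i j \<psi>"
    if ij: "i < 2" "j < 2" and eq: "\<And>\<gamma>. \<gamma> \<in> chords_of_type G i j \<Longrightarrow> \<psi> (f \<gamma>) = \<phi> \<gamma>" for i j \<phi> \<psi>
  proof -
    have "{\<gamma> \<in> chords_of_type H i j. \<psi> \<gamma>} = f ` {\<gamma> \<in> chords_of_type G i j. \<phi> \<gamma>}"
      unfolding type_H[OF ij] using eq by auto
    moreover have "inj_on f {\<gamma> \<in> chords_of_type G i j. \<phi> \<gamma>}"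
      using chord_G[OF ij(1)] by (intro inj_on_subset[OF inj]) auto
    ultimately show ?thesis unfolding sign_sum_def
      using sgn chord_G[OF ij(1)] by (auto simp: sum.reindex intro!: sum.cong)
  qed
  have "same_data {} G H" if "balanced G"
  proof -
    obtain h where h: "potential G h" using balanced_potential[OF G] \<open>balanced G\<close> by blast
    define h' where "h' y = h (inv_into (set (concat G)) ?m y)" for y
    have h'm: "h' (?m x) = h x" if "x \<in> set (concat G)" for x
      unfolding h'_def using inv_into_f_f[OF inj_m that] by simp
    have sgn_m: "endpoint_sign (?m x) = endpoint_sign x" if "x \<in> set (concat G)" for x
      using that sgn endpoint_in_gauss_diagram[OF G] by simp
    have lev: "level h' (map ?m ws)" if "level h ws" "set ws \<subseteq> set (concat G)" for ws
    proof -
      have "tot (map ?m ws) = tot ws \<and> (climbs h c ws \<longrightarrow> climbs h' c (map ?m ws))" for c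
        using that(2) by (induction ws arbitrary: c) (auto simp: h'm sgn_m simp del: set_concat)
      with that(1) show ?thesis unfolding level_def by metis
    qed
    have "level h' (H ! i)" if "i < 2" for i
    proof -
      have "level h (G ! i)" using h that len unfolding potential_def by simp
      moreover have "set (G ! i) \<subseteq> set (concat G)" using in_cat[OF that] by blast
      ultimately show ?thesis using lev H_eq that len by simp
    qed
    then have "potential H h'" unfolding potential_def using len by (metis in_set_conv_nth)
    with h show ?thesis
    proof (rule same_dataI)
      fix i j :: nat and n assume ij: "i < 2" "j < 2"
      have "height_index h' (f \<gamma>) = height_index h \<gamma>" if "\<gamma> \<in> chords_of_type G i j" for \<gamma>
        using that in_cat ij h'm[of "Ini \<gamma>"] h'm[of "Ter \<gamma>"] sgn[OF chord_G[OF ij(1) that]]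
        unfolding chords_of_type_def height_index_def by auto
      then show "i = j \<and> n \<in> {} \<or> index_sum h G i j n = index_sum h' H i j n"
        unfolding index_sum_def using sign_sum_eq[OF ij] by simp
    qed
  qed
  moreover have "Lk_diagram G i j = Lk_diagram H i j" if "i < 2" "j < 2" "i \<noteq> j" for i j
    unfolding Lk_diagram_sign_sum using sign_sum_eq[OF that(1,2)] by simp
  ultimately show ?thesis unfolding same_invariants_def by blast
qed


text \<open>
  The change is the same at both ends of a chord: the height of the surrounded endpoint \<open>p\<close> drops
  by \<open>chord_sign s * endpoint_sign p\<close>, and \<open>endpoint_sign p\<close> is the sign of the chord at its
  terminal endpoint, where the height counts positively, and minus that sign at its initial one.
\<close>

lemma height_index_add_shell:
  assumes "\<gamma> \<noteq> s" and "chord_of p \<noteq> s" and "chord_sign (chord_of p) \<in> {1, -1}"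
  shows "height_index (add_shell_heights p s h) \<gamma>
    = height_index h \<gamma> - (if chord_of p = \<gamma> then chord_sign s * chord_sign \<gamma> else 0)"
  using assms by (cases p) (auto simp: height_index_def add_shell_heights_def shell_left_def shell_right_def)

text \<open>
  If \<open>p\<close> is positive, then \<open>p\<close> is all that lies on the arc from the initial to the terminal endpoint.
  If \<open>p\<close> is negative, then this arc is the rest of the circle, of total sign \<open>- endpoint_sign p\<close>.
\<close>

lemma height_index_shell:
  assumes "chord_of p \<noteq> s" and "endpoint_sign p = 1 \<or> endpoint_sign p = -1"
  shows "height_index (add_shell_heights p s h) s = 1"
proof -
  have "p \<noteq> Ini s" "p \<noteq> Ter s" using assms(1) by auto
  then show ?thesis
    using assms(2) by (auto simp: height_index_def add_shell_heights_def shell_left_def shell_right_def)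
qed

lemma shell_at_self_chord:
  assumes "distinct (concat H)" "shell_at H p s"
  obtains k where "k < length H" "s \<in> chords_of_type H k k" "p \<in> set (H ! k)"
proof -
  obtain i k vs where i: "i < length H"
    "rotate k (H ! i) = shell_left p s # p # shell_right p s # vs"
    using shell_at_rotation[OF assms] .
  have "{shell_left p s, p, shell_right p s} \<subseteq> set (rotate k (H ! i))" unfolding i(2) by auto
  then have "{shell_left p s, shell_right p s} \<subseteq> set (H ! i)" "p \<in> set (H ! i)" by auto
  with i(1) that show thesis unfolding shell_endpoints chords_of_type_def by auto
qed

lemma Lk_delete_shell:
  assumes H: "gauss_diagram 2 H" and s: "shell_at H p s" and ij: "i < 2" "j < 2" "i \<noteq> j"
  shows "Lk_diagram (delete_chords {s} H) i j = Lk_diagram H i j"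
proof -
  have len: "length H = 2" and dist: "distinct (concat H)" using H by (auto simp: gauss_diagram_def)
  obtain k where "k < 2" "s \<in> chords_of_type H k k"
    using shell_at_self_chord[OF dist s] len by metis
  then have "s \<notin> chords_of_type H i j" using self_chord_type[OF H _ _ ij(1,2)] ij(3) by blast
  then show ?thesis unfolding Lk_diagram_sign_sum
    using sign_sum_delete_one[of i H j s "\<lambda>_. True"] ij len by simp
qed

lemma shell_potential:
  assumes H: "gauss_diagram 2 H" and s: "shell_at H p s"
    and K: "potential (delete_chords {s} H) h"
  defines "h' \<equiv> add_shell_heights p s h"
  shows "potential H h'"
    and "\<gamma> \<noteq> s \<Longrightarrow> height_index h' \<gamma>
      = height_index h \<gamma> - (if chord_of p = \<gamma> then chord_sign s * chord_sign \<gamma> else 0)"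
    and "i < 2 \<Longrightarrow> j < 2 \<Longrightarrow> \<not> (i = j \<and> n = 1) \<Longrightarrow>
      index_sum h' H i j n = index_sum h' (delete_chords {s} H) i j n"
proof -
  have len: "length H = 2" and dist: "distinct (concat H)" using H by (auto simp: gauss_diagram_def)
  obtain k where k: "k < 2" "s \<in> chords_of_type H k k" "p \<in> set (H ! k)"
    using shell_at_self_chord[OF dist s] len by metis
  have "p \<in> set (concat H)" using k len in_concat_nth by metis
  then have sp: "endpoint_sign p = 1 \<or> endpoint_sign p = -1"
    and cp: "chord_sign (chord_of p) \<in> {1, -1}"
    using endpoint_sign_in_gauss_diagram[OF H] chord_sign_in_gauss_diagram[OF H]
      endpoint_in_gauss_diagram[OF H] by auto
  have ps: "chord_of p \<noteq> s" using shell_at_chord_neq[OF dist s] .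
  show "potential H h'" unfolding h'_def by (rule potential_add_shell[OF dist s sp K])
  show "height_index h' \<gamma>
      = height_index h \<gamma> - (if chord_of p = \<gamma> then chord_sign s * chord_sign \<gamma> else 0)"
    if "\<gamma> \<noteq> s" unfolding h'_def by (rule height_index_add_shell[OF that ps cp])
  show "index_sum h' H i j n = index_sum h' (delete_chords {s} H) i j n"
    if ij: "i < 2" "j < 2" "\<not> (i = j \<and> n = 1)"
  proof -
    have "height_index h' s = 1" unfolding h'_def by (rule height_index_shell[OF ps sp])
    moreover have "i = j" if "s \<in> chords_of_type H i j"
      using self_chord_type[OF H k(1,2) ij(1,2) that] .
    ultimately have "\<not> height_index h' s = n" if "s \<in> chords_of_type H i j" using that ij(3) by auto
    then show ?thesis unfolding index_sum_def
      using sign_sum_delete_one[of i H j s "\<lambda>\<gamma>. height_index h' \<gamma> = n"] ij len by simp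
  qed
qed

text \<open>
  Both diagrams arise from \<open>K\<close> by inserting a shell around one of the endpoints of \<open>\<gamma>\<close>, and the
  effect on the index of \<open>\<gamma>\<close> is the same.
\<close>

lemma S1_invariants:
  assumes G: "gauss_diagram 2 G" and H: "gauss_diagram 2 H" and "S1 G H"
  shows "same_invariants {1} G H"
proof -
  from assms(3) obtain \<gamma> p q s s' where pq: "{p, q} = {Ini \<gamma>, Ter \<gamma>}"
    and s: "shell_at G p s" and s': "shell_at H q s'" and sgn: "chord_sign s = chord_sign s'"
    and eq: "delete_chords {s} G = delete_chords {s'} H"
    unfolding S1_def by auto
  have len: "length G = 2" "length H = 2" using G H by (auto simp: gauss_diagram_def)
  have chord_pq: "chord_of p = \<gamma>" "chord_of q = \<gamma>" using pq by (auto simp: doubleton_eq_iff)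
  define K where "K = delete_chords {s} G"
  have K: "gauss_diagram 2 K" "K = delete_chords {s'} H"
    unfolding K_def by (rule gauss_diagram_delete[OF G], rule eq)
  have LkK: "Lk_diagram K i j = Lk_diagram G i j" "Lk_diagram K i j = Lk_diagram H i j"
    if "i < 2" "j < 2" "i \<noteq> j" for i j
    using Lk_delete_shell[OF G s that] Lk_delete_shell[OF H s' that] K(2) unfolding K_def by auto
  have "same_data {1} G H" if "balanced G"
  proof -
    have "balanced K" using that LkK(1)[of 0 1] LkK(1)[of 1 0] balanced_iff_Lk[OF G] balanced_iff_Lk[OF K(1)] by simp
    then obtain h where h: "potential K h" using balanced_potential[OF K(1)] by blast
    let ?g = "add_shell_heights p s h" and ?h = "add_shell_heights q s' h"
    note g = shell_potential[OF G s h[unfolded K_def], folded K_def]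
    note h' = shell_potential[OF H s' h[unfolded K(2)], folded K(2)]
    show ?thesis
    proof (rule same_dataI[OF g(1) h'(1)])
      fix i j :: nat and n :: int assume ij: "i < 2" "j < 2"
      have "index_sum ?g K i j n = index_sum ?h K i j n" unfolding index_sum_def
      proof (rule sign_sum_cong)
        fix \<delta> assume d: "\<delta> \<in> chords_of_type K i j"
        then have "\<delta> \<noteq> s" using chords_of_type_delete[of i G j "{s}"] ij len unfolding K_def by auto
        moreover have "\<delta> \<noteq> s'" using d chords_of_type_delete[of i H j "{s'}"] ij len K(2) by auto
        ultimately show "height_index ?g \<delta> = n \<longleftrightarrow> height_index ?h \<delta> = n"
          using g(2) h'(2) chord_pq sgn by auto
      qed simp
      with g(3)[OF ij, of n] h'(3)[OF ij, of n]
      show "i = j \<and> n \<in> {1} \<or> index_sum ?g G i j n = index_sum ?h H i j n"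
        by (cases "i = j \<and> n = 1") simp_all
    qed
  qed
  with LkK show ?thesis unfolding same_invariants_def by metis
qed

lemma shell_at_delete:
  assumes "shell_at H q t" "s \<noteq> t" "chord_of q \<noteq> s"
  shows "shell_at (delete_chords {s} H) q t"
  using assms unfolding shell_at_iff delete_chords_eq_remove
  by (auto intro!: remove_endpoints_followed_by)

text \<open>
  The exchange changes the height of \<open>p\<close> by \<open>endpoint_sign q\<close>, and the shell around \<open>p\<close> changes it
  back; likewise for \<open>q\<close>.
\<close>

lemma S2_invariants:
  assumes G: "gauss_diagram 2 G" and H: "gauss_diagram 2 H" and "S2 G H"
  shows "same_invariants {1} G H"
proof -
  from assms(3) obtain p q s s' where neq: "chord_of p \<noteq> chord_of q" and fol: "followed_by G p q"
    and s: "chord_sign s = endpoint_sign p * endpoint_sign q" "shell_at H p s"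
    and s': "chord_sign s' = - endpoint_sign p * endpoint_sign q" "shell_at H q s'"
    and new: "s \<notin> chords G" "s' \<notin> chords G"
    and eq: "delete_chords {s, s'} H = exchange p q G"
    unfolding S2_def by auto
  have len: "length G = 2" "length H = 2" and dist: "distinct (concat G)"
    using G H by (auto simp: gauss_diagram_def)
  obtain k where k: "k < 2" "p \<in> set (G ! k)" "q \<in> set (G ! k)"
    using followed_by_same_circle[OF fol] len by metis
  then have in_G: "p \<in> set (concat G)" "q \<in> set (concat G)" using len in_concat_nth by metis+
  have sp: "endpoint_sign p = 1 \<or> endpoint_sign p = -1" "endpoint_sign q = 1 \<or> endpoint_sign q = -1"
    using endpoint_sign_in_gauss_diagram[OF G] in_G by blast+
  have ss': "s \<noteq> s'" using s(1) s'(1) sp by auto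
  have qs: "chord_of q \<noteq> s" using in_G(2) new endpoint_in_gauss_diagram[OF G] by auto
  define H1 where "H1 = delete_chords {s} H"
  define K where "K = exchange p q G"
  have H1: "gauss_diagram 2 H1" unfolding H1_def by (rule gauss_diagram_delete[OF H])
  have K: "K = delete_chords {s'} H1"
    unfolding K_def H1_def eq[symmetric] using delete_chords_Un[of "{s}" "{s'}" H] by (simp add: insert_commute)
  have s1: "shell_at H1 q s'" unfolding H1_def by (rule shell_at_delete[OF s'(2) ss' qs])
  have typeK: "chords_of_type K i j = chords_of_type G i j" if "i < 2" "j < 2" for i j
    unfolding K_def using chords_of_type_exchange[OF dist fol] that len by simp
  have LkK: "Lk_diagram G i j = Lk_diagram H i j" if "i < 2" "j < 2" "i \<noteq> j" for i j
    using Lk_delete_shell[OF H s(2) that, folded H1_def] Lk_delete_shell[OF H1 s1 that, folded K]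
      typeK that unfolding Lk_diagram_def by simp
  have "same_data {1} G H" if "balanced G"
  proof -
    obtain g where g: "potential G g" using balanced_potential[OF G \<open>balanced G\<close>] by blast
    define h where "h = g(p := g p + endpoint_sign q, q := g q - endpoint_sign p)"
    have h: "potential K h" unfolding h_def K_def by (rule potential_exchange[OF g dist fol])
    define h1 where "h1 = add_shell_heights q s' h"
    define h2 where "h2 = add_shell_heights p s h1"
    note p1 = shell_potential[OF H1 s1 h[unfolded K], folded K h1_def]
    note p2 = shell_potential[OF H s(2) p1(1)[unfolded H1_def], folded H1_def h2_def]
    show ?thesis
    proof (rule same_dataI[OF g p2(1)])
      fix i j :: nat and n :: int assume ij: "i < 2" "j < 2"
      have ind: "height_index h2 \<gamma> = height_index g \<gamma>" if "\<gamma> \<in> chords G" for \<gamma>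
      proof -
        have "\<gamma> \<noteq> s" "\<gamma> \<noteq> s'" using that new by auto
        then have "height_index h2 \<gamma> = height_index h \<gamma>
            - (if chord_of q = \<gamma> then chord_sign s' * chord_sign \<gamma> else 0)
            - (if chord_of p = \<gamma> then chord_sign s * chord_sign \<gamma> else 0)"
          using p1(2) p2(2) by simp
        also have "\<dots> = height_index g \<gamma>"
          using neq sp unfolding s(1) s'(1) height_index_def h_def
          by (cases p; cases q) auto
        finally show ?thesis .
      qed
      have "index_sum g G i j n = index_sum h2 K i j n" unfolding index_sum_def
      proof (rule sign_sum_cong[OF typeK[OF ij, symmetric]])
        fix \<gamma> assume "\<gamma> \<in> chords_of_type G i j"
        then have "\<gamma> \<in> chords G"
          using ij len in_concat_nth[of "Ini \<gamma>" G] unfolding chords_of_type_def chords_def by auto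
        then show "height_index g \<gamma> = n \<longleftrightarrow> height_index h2 \<gamma> = n" using ind by simp
      qed
      moreover have "index_sum h2 H1 i j n = index_sum h2 K i j n" if "\<not> (i = j \<and> n = 1)"
      proof -
        have "chord_of p \<noteq> s'" using in_G(1) new endpoint_in_gauss_diagram[OF G] by auto
        have "height_index h2 s' = height_index h1 s'"
          using p2(2)[of s'] ss' \<open>chord_of p \<noteq> s'\<close> by auto
        also have "\<dots> = 1" unfolding h1_def
          using height_index_shell sp(2) in_G(2) new endpoint_in_gauss_diagram[OF G] by metis
        finally have i1: "height_index h2 s' = 1" .
        obtain l where l: "l < 2" "s' \<in> chords_of_type H1 l l"
          using shell_at_self_chord[OF _ s1] H1 unfolding gauss_diagram_def by metis
        have "i = j" if "s' \<in> chords_of_type H1 i j"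
          using self_chord_type[OF H1 l ij that] .
        then show ?thesis
          using i1 \<open>\<not> (i = j \<and> n = 1)\<close> sign_sum_delete_one[of i H1 j s' "\<lambda>\<gamma>. height_index h2 \<gamma> = n"] ij H1
          unfolding index_sum_def K gauss_diagram_def by auto
      qed
      ultimately show "i = j \<and> n \<in> {1} \<or> index_sum g G i j n = index_sum h2 H i j n"
        using p2(3)[OF ij, of n] by (cases "i = j \<and> n = 1") simp_all
    qed
  qed
  with LkK show ?thesis unfolding same_invariants_def by metis
qed

lemma same_invariants_mono: "same_invariants E G H \<Longrightarrow> E \<subseteq> F \<Longrightarrow> same_invariants F G H"
  unfolding same_invariants_def using same_data_mono by blast

lemma reidemeister_step_invariants: "reidemeister_step 2 G H \<Longrightarrow> same_invariants {0} G H"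
  unfolding reidemeister_step_def
  using isomorphic_invariants R1_invariants R2_invariants R3_invariants
    same_invariants_mono[of "{}" _ _ "{0}"] by blast

lemma shell_step_invariants: "shell_step 2 G H \<Longrightarrow> same_invariants {1} G H"
  unfolding shell_step_def using S1_invariants S2_invariants by blast

text \<open>
  The invariants are compared along a chain of moves in both directions.  The linking numbers ensure
  that all diagrams in the chain are balanced as soon as one of them is.
\<close>

lemma equivclp_invariants:
  assumes step: "\<And>A B. r A B \<Longrightarrow> gauss_diagram 2 A \<and> gauss_diagram 2 B \<and> same_invariants E A B"
    and "equivclp r G H" and G: "gauss_diagram 2 G"
  shows "gauss_diagram 2 H \<and> same_invariants E G H"
  using assms(2) unfolding equivclp_def
proof (induction rule: rtranclp_induct)
  case base
  show ?case using G same_data_refl[OF G] unfolding same_invariants_def by blast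
next
  case (step A B)
  have AB: "gauss_diagram 2 A" "gauss_diagram 2 B" "same_invariants E A B \<or> same_invariants E B A"
    using step.hyps(2) assms(1) by (auto elim!: symclpE)
  have GA: "same_invariants E G A" using step.IH by blast
  have bal: "balanced A = balanced B" "balanced G = balanced A"
    using AB same_invariants_balanced G GA by blast+
  have "same_invariants E A B"
    using AB(3) bal unfolding same_invariants_def by (metis same_data_sym)
  then have "same_invariants E G B"
    using GA bal same_data_trans[OF _ _ AB(1,2)] unfolding same_invariants_def by metis
  with AB(2) show ?case by blast
qed

lemma reidemeister_invariants:
  assumes "equivclp (reidemeister_step 2) G H" "gauss_diagram 2 G"
  shows "gauss_diagram 2 H" and "same_invariants {0} G H"
proof -
  have "gauss_diagram 2 H \<and> same_invariants {0} G H"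
    using assms by (intro equivclp_invariants[of "reidemeister_step 2"])
      (auto simp: reidemeister_step_invariants, simp_all add: reidemeister_step_def)
  then show "gauss_diagram 2 H" "same_invariants {0} G H" by blast+
qed

abbreviation S_equiv :: "diagram \<Rightarrow> diagram \<Rightarrow> bool" (infix "\<approx>" 50) where
  "G \<approx> H \<equiv> equivclp (\<lambda>A B. reidemeister_step 2 A B \<or> shell_step 2 A B) G H"

lemma S_equiv_invariants:
  assumes "G \<approx> H" "gauss_diagram 2 G"
  shows "gauss_diagram 2 H" and "same_invariants {0, 1} G H"
proof -
  have "gauss_diagram 2 A \<and> gauss_diagram 2 B \<and> same_invariants {0, 1} A B"
    if "reidemeister_step 2 A B \<or> shell_step 2 A B" for A B
    using that same_invariants_mono[of _ A B "{0, 1}"] reidemeister_step_invariants[of A B]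
      shell_step_invariants[of A B] unfolding reidemeister_step_def shell_step_def by blast
  from equivclp_invariants[OF this assms]
  show "gauss_diagram 2 H" "same_invariants {0, 1} G H" by blast+
qed

section \<open>Reading the invariants of a link off a diagram\<close>

lemma arc_word:
  assumes "distinct (concat G)" "i < length G" "rotate k (G ! i) = p # us @ q # vs"
  shows "arc G p q = set us"
proof (intro set_eqI iffI)
  fix x assume "x \<in> arc G p q"
  then obtain i' k' us' vs' where w: "i' < length G" "rotate k' (G ! i') = p # us' @ q # vs'" "x \<in> set us'"
    unfolding arc_def by auto
  have "p \<in> set (G ! i)" "p \<in> set (G ! i')" using assms(3) w(2) by (metis list.set_intros(1) set_rotate)+
  then have "i' = i" using assms(1,2) w(1) distinct_concat_same_index by metis
  moreover have d: "distinct (G ! i)" using assms(1,2) by (metis distinct_concat_iff nth_mem)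
  ultimately have eq: "us' @ q # vs' = us @ q # vs" using rotate_unique[OF d] assms(3) w(2) by metis
  have "distinct (us @ q # vs)" using d assms(3) by (metis distinct.simps(2) distinct_rotate)
  then have "q \<notin> set us" "q \<notin> set us'" using eq by (auto, metis Un_iff disjoint_iff distinct_append list.set_intros(1))
  then have "takeWhile (\<lambda>z. z \<noteq> q) (us @ q # vs) = us" "takeWhile (\<lambda>z. z \<noteq> q) (us' @ q # vs') = us'"
    by (subst takeWhile_append2; auto)+
  then have "us' = us" using eq by simp
  with w(3) show "x \<in> set us" by simp
next
  fix x assume "x \<in> set us"
  then show "x \<in> arc G p q" unfolding arc_def using assms(2,3) by blast
qed

text \<open>
  If \<open>q\<close> comes before \<open>p\<close> in the word, then the arc passes through the base point.  Rotating \<open>p\<close> to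
  the front avoids this case.
\<close>

lemma arc_sum:
  assumes G: "gauss_diagram 2 G" and h: "potential G h" and i: "i < 2"
    and pq: "p \<in> set (G ! i)" "q \<in> set (G ! i)" "p \<noteq> q"
  shows "(\<Sum>x\<in>arc G p q. endpoint_sign x) = h q - h p - endpoint_sign p"
    and "arc G p q \<subseteq> set (G ! i)"
proof -
  have len: "length G = 2" and dist: "distinct (concat G)" using G by (auto simp: gauss_diagram_def)
  obtain k rest where k: "rotate k (G ! i) = p # rest" using rotate_to_front[OF pq(1)] by blast
  have "q \<in> set (p # rest)" using pq(2) k by (metis set_rotate)
  then have "q \<in> set rest" using pq(3) by auto
  then obtain us vs where rest: "rest = us @ q # vs" by (meson split_list)
  have arc: "arc G p q = set us" using arc_word[OF dist _ k[unfolded rest]] i len by simp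
  have "distinct (p # us @ q # vs)" using G i k unfolding rest
    by (metis distinct_rotate gauss_diagram_distinct_nth)
  then have "(\<Sum>x\<in>arc G p q. endpoint_sign x) = tot us" unfolding arc by (simp add: tot_sum)
  moreover have "level h (p # us @ q # vs)"
    using h i len k unfolding rest potential_def by (metis level_rotate nth_mem)
  ultimately show "(\<Sum>x\<in>arc G p q. endpoint_sign x) = h q - h p - endpoint_sign p"
    unfolding level_def by auto
  have "set us \<subseteq> set (p # us @ q # vs)" by auto
  then show "arc G p q \<subseteq> set (G ! i)" unfolding arc using k unfolding rest by (metis set_rotate)
qed

lemma Ind_height_index:
  assumes "gauss_diagram 2 G" "potential G h" "i < 2" "\<gamma> \<in> chords_of_type G i i"
  shows "Ind G \<gamma> = height_index h \<gamma>"
  using arc_sum(1)[OF assms(1-3), of "Ini \<gamma>" "Ter \<gamma>"] assms(4)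
  unfolding Ind_def height_index_def chords_of_type_def by simp

lemma J_diagram_index_sum:
  assumes "gauss_diagram 2 G" "potential G h" "i < 2"
  shows "J_diagram G i n = index_sum h G i i n"
proof -
  have "{\<gamma> \<in> chords_of_type G i i. Ind G \<gamma> = n} = {\<gamma> \<in> chords_of_type G i i. height_index h \<gamma> = n}"
    using Ind_height_index[OF assms] by auto
  then show ?thesis unfolding J_diagram_def index_sum_def sign_sum_def by simp
qed

text \<open>
  The constant by which the index relative to \<open>\<gamma>\<^sub>0\<close> exceeds the height index.
\<close>

definition height_gap :: "(chord endpoint \<Rightarrow> int) \<Rightarrow> diagram \<Rightarrow> chord \<Rightarrow> nat \<Rightarrow> nat \<Rightarrow> int" where
  "height_gap h G \<gamma>\<^sub>0 i j =
     h (endpoint_on G i \<gamma>\<^sub>0) - h (endpoint_on G j \<gamma>\<^sub>0) - endpoint_sign (endpoint_on G j \<gamma>\<^sub>0)"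

lemma endpoint_on_nonself:
  assumes G: "gauss_diagram 2 G" and g0: "\<gamma>\<^sub>0 \<in> nonself_chords G" and ij: "{i, j} = {0, 1}"
  shows "endpoint_on G i \<gamma>\<^sub>0 \<in> set (G ! i)"
    and "{endpoint_on G i \<gamma>\<^sub>0, endpoint_on G j \<gamma>\<^sub>0} = {Ini \<gamma>\<^sub>0, Ter \<gamma>\<^sub>0}"
proof -
  have lt: "i < 2" "j < 2" "i \<noteq> j" using ij by (auto simp: doubleton_eq_iff)
  have len: "length G = 2" using G by (auto simp: gauss_diagram_def)
  obtain k l where kl: "k < 2" "l < 2" "k \<noteq> l" "Ini \<gamma>\<^sub>0 \<in> set (G ! k)" "Ter \<gamma>\<^sub>0 \<in> set (G ! l)"
    using g0 len unfolding nonself_chords_def chords_of_type_def by auto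
  have "(k = i \<and> l = j) \<or> (k = j \<and> l = i)" using kl(1-3) ij by (auto simp: doubleton_eq_iff)
  then have "endpoint_on G i \<gamma>\<^sub>0 \<in> set (G ! i) \<and>
    {endpoint_on G i \<gamma>\<^sub>0, endpoint_on G j \<gamma>\<^sub>0} = {Ini \<gamma>\<^sub>0, Ter \<gamma>\<^sub>0}"
  proof
    assume "k = i \<and> l = j"
    then have "Ini \<gamma>\<^sub>0 \<in> set (G ! i)" "Ini \<gamma>\<^sub>0 \<notin> set (G ! j)"
      using kl gauss_diagram_same_index[OF G, of i j] lt by auto
    then show ?thesis unfolding endpoint_on_def by auto
  next
    assume *: "k = j \<and> l = i"
    then have "Ini \<gamma>\<^sub>0 \<in> set (G ! j)" "Ini \<gamma>\<^sub>0 \<notin> set (G ! i)"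
      using kl gauss_diagram_same_index[OF G, of i j] lt by auto
    with * kl show ?thesis unfolding endpoint_on_def by auto
  qed
  then show "endpoint_on G i \<gamma>\<^sub>0 \<in> set (G ! i)"
    and "{endpoint_on G i \<gamma>\<^sub>0, endpoint_on G j \<gamma>\<^sub>0} = {Ini \<gamma>\<^sub>0, Ter \<gamma>\<^sub>0}" by blast+
qed

text \<open>
  The sums over the arcs \<open>\<alpha>\<close> and \<open>\<beta>\<close> are height differences; the part that belongs to \<open>\<gamma>\<close> is its
  height index.  For \<open>\<gamma> = \<gamma>\<^sub>0\<close> the two parts cancel, in accordance with the value \<open>0\<close>.
\<close>

lemma Ind_rel_height_index:
  assumes G: "gauss_diagram 2 G" and h: "potential G h"
    and g0: "\<gamma>\<^sub>0 \<in> nonself_chords G" and ij: "{i, j} = {0, 1}" and g: "\<gamma> \<in> chords_of_type G i j"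
  shows "Ind_rel G \<gamma>\<^sub>0 i j \<gamma> = height_index h \<gamma> + height_gap h G \<gamma>\<^sub>0 i j"
proof -
  have lt: "i < 2" "j < 2" "i \<noteq> j" using ij by (auto simp: doubleton_eq_iff)
  let ?x = "endpoint_on G i \<gamma>\<^sub>0" and ?y = "endpoint_on G j \<gamma>\<^sub>0"
  have x: "?x \<in> set (G ! i)" and y: "?y \<in> set (G ! j)" and xy: "{?x, ?y} = {Ini \<gamma>\<^sub>0, Ter \<gamma>\<^sub>0}"
    using endpoint_on_nonself[OF G g0 ij] endpoint_on_nonself(1)[OF G g0, of j i] ij
    by (auto simp: insert_commute)
  have gi: "Ini \<gamma> \<in> set (G ! i)" "Ter \<gamma> \<in> set (G ! j)" using g unfolding chords_of_type_def by auto
  show ?thesis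
  proof (cases "\<gamma> = \<gamma>\<^sub>0")
    case True
    then have "?x = Ini \<gamma>" using gi(1) by (simp add: endpoint_on_def)
    moreover from this xy True have "?y = Ter \<gamma>" by (auto simp: doubleton_eq_iff)
    ultimately show ?thesis using True by (simp add: Ind_rel_def height_gap_def height_index_def)
  next
    case False
    have "Ini \<gamma> \<notin> {?x, ?y}" "Ter \<gamma> \<notin> {?x, ?y}" unfolding xy using False by auto
    then have ne: "Ini \<gamma> \<noteq> ?x" "?y \<noteq> Ter \<gamma>" by auto
    note A = arc_sum[OF G h lt(1) gi(1) x ne(1)] and B = arc_sum[OF G h lt(2) y gi(2) ne(2)]
    have "arc G (Ini \<gamma>) ?x \<inter> arc G ?y (Ter \<gamma>) = {}"
      using A(2) B(2) gauss_diagram_same_index[OF G lt(1,2)] lt(3) by blast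
    moreover have "finite (arc G (Ini \<gamma>) ?x)" "finite (arc G ?y (Ter \<gamma>))"
      using A(2) B(2) by (auto intro: finite_subset)
    ultimately show ?thesis using False A(1) B(1)
      by (simp add: Ind_rel_def sum.union_disjoint height_gap_def height_index_def)
  qed
qed

lemma height_gap_swap:
  assumes "gauss_diagram 2 G" "\<gamma>\<^sub>0 \<in> nonself_chords G"
  shows "height_gap h G \<gamma>\<^sub>0 1 0 = - height_gap h G \<gamma>\<^sub>0 0 1"
proof -
  have "{endpoint_on G 0 \<gamma>\<^sub>0, endpoint_on G 1 \<gamma>\<^sub>0} = {Ini \<gamma>\<^sub>0, Ter \<gamma>\<^sub>0}"
    using endpoint_on_nonself(2)[OF assms, of 0 1] by simp
  then show ?thesis unfolding height_gap_def by (auto simp: doubleton_eq_iff)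
qed

lemma J_rel_index_sum:
  assumes "gauss_diagram 2 G" "potential G h" "\<gamma>\<^sub>0 \<in> nonself_chords G" "{i, j} = {0, 1}"
  shows "J_rel G \<gamma>\<^sub>0 i j n = index_sum h G i j (n - height_gap h G \<gamma>\<^sub>0 i j)"
proof -
  have "{\<gamma> \<in> chords_of_type G i j. Ind_rel G \<gamma>\<^sub>0 i j \<gamma> = n}
      = {\<gamma> \<in> chords_of_type G i j. height_index h \<gamma> = n - height_gap h G \<gamma>\<^sub>0 i j}"
    using Ind_rel_height_index[OF assms] by auto
  then show ?thesis unfolding J_rel_def index_sum_def sign_sum_def by simp
qed

lemma lookup_t_pow_times: "Poly_Mapping.lookup (t_pow k * f) n = Poly_Mapping.lookup f (n - k)"
proof -
  have "Poly_Mapping.lookup (Poly_Mapping.single k 1 * f) n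
      = (\<Sum>l. (\<Sum>q. Poly_Mapping.lookup f q when n = l + q) when l = k)"
    unfolding lookup_mult lookup_single by (rule Sum_any.cong) (auto simp: when_def)
  also have "\<dots> = (\<Sum>q. Poly_Mapping.lookup f q when n = k + q)"
    by (rule Sum_any_when_equal)
  also have "\<dots> = (\<Sum>q. Poly_Mapping.lookup f q when q = n - k)"
    by (rule Sum_any.cong) (auto simp: when_def)
  also have "\<dots> = Poly_Mapping.lookup f (n - k)" by simp
  finally show ?thesis by (simp add: t_pow_def)
qed

lemma lookup_F_poly: "Poly_Mapping.lookup (F_poly G \<gamma>\<^sub>0 i j) n = J_rel G \<gamma>\<^sub>0 i j n"
proof -
  let ?g = "\<lambda>n. of_int (J_rel G \<gamma>\<^sub>0 i j n) * t_pow n"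
  let ?A = "insert n (Ind_rel G \<gamma>\<^sub>0 i j ` chords_of_type G i j)"
  have g: "?g m = Poly_Mapping.single m (J_rel G \<gamma>\<^sub>0 i j m)" for m
  proof -
    have "of_int (J_rel G \<gamma>\<^sub>0 i j m) = (Poly_Mapping.single 0 (J_rel G \<gamma>\<^sub>0 i j m) :: laurent)"
      using single_of_int[of "J_rel G \<gamma>\<^sub>0 i j m", where ?'a = int and ?'b = int] by simp
    then show ?thesis by (simp add: t_pow_def mult_single)
  qed
  have fin: "finite ?A" by (simp add: finite_chords_of_type)
  have "J_rel G \<gamma>\<^sub>0 i j m = 0" if "m \<notin> ?A" for m
  proof -
    have "{\<gamma> \<in> chords_of_type G i j. Ind_rel G \<gamma>\<^sub>0 i j \<gamma> = m} = {}" using that by auto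
    then show ?thesis unfolding J_rel_def by (simp only: sum.empty)
  qed
  then have "{m. ?g m \<noteq> 0} \<subseteq> ?A" unfolding g by fastforce
  then have "F_poly G \<gamma>\<^sub>0 i j = sum ?g ?A"
    unfolding F_poly_def by (rule Sum_any.expand_superset[OF fin])
  then have "Poly_Mapping.lookup (F_poly G \<gamma>\<^sub>0 i j) n = (\<Sum>m\<in>?A. J_rel G \<gamma>\<^sub>0 i j m when m = n)"
    by (simp only: lookup_sum g lookup_single)
  also have "\<dots> = (\<Sum>m\<in>?A. if m = n then J_rel G \<gamma>\<^sub>0 i j m else 0)"
    by (simp only: when_def)
  also have "\<dots> = J_rel G \<gamma>\<^sub>0 i j n"
    using fin by (subst sum.delta) auto
  finally show ?thesis .
qed

lemma Lambda_class_0: "Lambda_class 0 f = {f}"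
  by (auto simp: Lambda_class_def t_pow_def)

text \<open>
  For \<open>s = 0\<close> the ring \<open>\<Lambda>\<^sub>s\<close> is the Laurent polynomial ring itself, so the class \<open>[f, g]\<close> is an orbit
  under opposite shifts of the two coefficient functions.
\<close>

lemma Gamma_class_0_eq_iff:
  "Gamma_class 0 f g = Gamma_class 0 f' g' \<longleftrightarrow>
    (\<exists>k. \<forall>n. Poly_Mapping.lookup f' n = Poly_Mapping.lookup f (n - k) \<and>
             Poly_Mapping.lookup g' n = Poly_Mapping.lookup g (n + k))"
    (is "?L \<longleftrightarrow> (\<exists>k. ?R k)")
proof
  have id: "t_pow 0 * f = f" for f by (rule poly_mapping_eqI) (simp add: lookup_t_pow_times)
  assume ?L
  moreover have "({f'}, {g'}) \<in> Gamma_class 0 f' g'"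
    unfolding Gamma_class_def Lambda_class_0 using id by (auto intro!: exI[of _ 0])
  ultimately have "({f'}, {g'}) \<in> Gamma_class 0 f g" by simp
  then obtain k where "f' = t_pow k * f" "g' = t_pow (- k) * g"
    unfolding Gamma_class_def Lambda_class_0 by auto
  then have "?R k" by (simp add: lookup_t_pow_times)
  then show "\<exists>k. ?R k" ..
next
  assume "\<exists>k. ?R k"
  then obtain k where k: "?R k" ..
  have f: "t_pow l * f' = t_pow (k + l) * f" for l
    by (rule poly_mapping_eqI) (simp add: lookup_t_pow_times k diff_diff_eq add.commute)
  have g: "t_pow (- l) * g' = t_pow (- (k + l)) * g" for l
    by (rule poly_mapping_eqI) (simp only: lookup_t_pow_times k, simp add: algebra_simps)
  show ?L unfolding Gamma_class_def Lambda_class_0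
  proof (intro set_eqI iffI)
    fix x assume "x \<in> {({t_pow k * f}, {t_pow (- k) * g}) |k. True}"
    then obtain l where "x = ({t_pow l * f}, {t_pow (- l) * g})" by blast
    then have "x = ({t_pow (l - k) * f'}, {t_pow (- (l - k)) * g'})" unfolding f g by simp
    then show "x \<in> {({t_pow k * f'}, {t_pow (- k) * g'}) |k. True}" by blast
  next
    fix x assume "x \<in> {({t_pow k * f'}, {t_pow (- k) * g'}) |k. True}"
    then obtain l where "x = ({t_pow l * f'}, {t_pow (- l) * g'})" by blast
    then have "x = ({t_pow (k + l) * f}, {t_pow (- (k + l)) * g})" unfolding f g by simp
    then show "x \<in> {({t_pow k * f}, {t_pow (- k) * g}) |k. True}" by blast
  qed
qed

lemma link_members:
  assumes L: "L \<in> virtual_links 2"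
  shows "\<exists>G. G \<in> L" and "G \<in> L \<Longrightarrow> gauss_diagram 2 G"
    and "G \<in> L \<Longrightarrow> H \<in> L \<Longrightarrow> equivclp (reidemeister_step 2) G H"
    and "G \<in> L \<Longrightarrow> gauss_diagram 2 H \<Longrightarrow> equivclp (reidemeister_step 2) G H \<Longrightarrow> H \<in> L"
proof -
  obtain G0 where G0: "gauss_diagram 2 G0" "L = reidemeister_rel 2 `` {G0}"
    using L unfolding virtual_links_def by (auto elim: quotientE)
  have mem: "H \<in> L \<longleftrightarrow> gauss_diagram 2 H \<and> equivclp (reidemeister_step 2) G0 H" for H
    using G0 unfolding reidemeister_rel_def by auto
  show "\<exists>G. G \<in> L" using mem G0(1) equivclp_refl by metis
  show "G \<in> L \<Longrightarrow> gauss_diagram 2 G" using mem by blast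
  show "G \<in> L \<Longrightarrow> H \<in> L \<Longrightarrow> equivclp (reidemeister_step 2) G H"
    unfolding mem by (meson equivclp_sym equivclp_trans)
  show "G \<in> L \<Longrightarrow> gauss_diagram 2 H \<Longrightarrow> equivclp (reidemeister_step 2) G H \<Longrightarrow> H \<in> L"
    unfolding mem by (meson equivclp_trans)
qed

text \<open>
  This makes the arbitrary choice of a diagram in the definitions of the invariants harmless.
\<close>

lemma link_same_invariants:
  assumes "L \<in> virtual_links 2" "G \<in> L" "H \<in> L"
  shows "same_invariants {0} G H"
  using reidemeister_invariants link_members[OF assms(1)] assms(2,3) by blast

lemma Lk_link:
  assumes L: "L \<in> virtual_links 2" and G: "G \<in> L" and ij: "i < 2" "j < 2" "i \<noteq> j"
  shows "Lk L i j = Lk_diagram G i j"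
proof -
  have "\<exists>H\<in>L. Lk L i j = Lk_diagram H i j"
    unfolding Lk_def by (rule someI_ex) (use G in blast)
  then obtain H where "H \<in> L" "Lk L i j = Lk_diagram H i j" by blast
  then show ?thesis using link_same_invariants[OF L G, of H] ij unfolding same_invariants_def by simp
qed

lemma link_balanced:
  assumes "L \<in> virtual_links 2" "linking_difference L = 0" "G \<in> L"
  shows "balanced G"
  using assms(2) link_members(2)[OF assms(1,3)] Lk_link[OF assms(1,3), of 0 1] Lk_link[OF assms(1,3), of 1 0]
  unfolding linking_difference_def by (simp add: balanced_iff_Lk)

lemma J_link:
  assumes L: "L \<in> virtual_links 2" "linking_difference L = 0" and G: "G \<in> L"
    and h: "potential G h" and i: "i < 2" and n: "n \<noteq> 0"
  shows "J L i n = index_sum h G i i n"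
proof -
  have "\<exists>H\<in>L. J L i n = J_diagram H i n"
    unfolding J_def by (rule someI_ex) (use G in blast)
  then obtain H where H: "H \<in> L" "J L i n = J_diagram H i n" by blast
  have "same_data {0} G H"
    using link_same_invariants[OF L(1) G H(1)] link_balanced[OF L G] unfolding same_invariants_def by blast
  then obtain g g' where g: "potential G g" "potential H g'" "index_sum g G i i n = index_sum g' H i i n"
    using i n unfolding same_data_def by blast
  note gauss = link_members(2)[OF L(1)]
  have "J L i n = index_sum g G i i n"
    using H(2) J_diagram_index_sum[OF gauss[OF H(1)] g(2) i] g(3) by simp
  then show ?thesis
    using J_diagram_index_sum[OF gauss[OF G] g(1) i, of n] J_diagram_index_sum[OF gauss[OF G] h i, of n] by simp
qed

text \<open>
  The potential plays the part that the nonself-chord \<open>\<gamma>\<^sub>0\<close> plays in \<open>F_poly\<close>.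
\<close>

definition height_poly :: "(chord endpoint \<Rightarrow> int) \<Rightarrow> diagram \<Rightarrow> nat \<Rightarrow> nat \<Rightarrow> laurent" where
  "height_poly h G i j =
     (\<Sum>\<gamma>\<in>chords_of_type G i j. Poly_Mapping.single (height_index h \<gamma>) (chord_sign \<gamma>))"

lemma lookup_height_poly: "Poly_Mapping.lookup (height_poly h G i j) n = index_sum h G i j n"
proof -
  have "Poly_Mapping.lookup (height_poly h G i j) n
      = (\<Sum>\<gamma>\<in>chords_of_type G i j. if height_index h \<gamma> = n then chord_sign \<gamma> else 0)"
    by (simp add: height_poly_def lookup_sum lookup_single when_def)
  then show ?thesis unfolding index_sum_def sign_sum_def
    using finite_chords_of_type[of G i j] by (simp add: sum.inter_filter)
qed

definition height_class :: "(chord endpoint \<Rightarrow> int) \<Rightarrow> diagram \<Rightarrow> (laurent set \<times> laurent set) set" where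
  "height_class h G = Gamma_class 0 (height_poly h G 0 1) (height_poly h G 1 0)"

lemma height_class_eq_iff:
  "height_class h G = height_class h' G' \<longleftrightarrow>
    (\<exists>k. \<forall>n. index_sum h' G' 0 1 n = index_sum h G 0 1 (n - k) \<and>
             index_sum h' G' 1 0 n = index_sum h G 1 0 (n + k))"
  unfolding height_class_def Gamma_class_0_eq_iff lookup_height_poly ..

text \<open>
  Raising the heights on one circle shifts the indices of the two types in opposite directions.
\<close>

lemma height_class_unique:
  assumes G: "gauss_diagram 2 G" and h: "potential G h" "potential G h'"
  shows "height_class h G = height_class h' G"
proof -
  have len: "length G = 2" using G by (auto simp: gauss_diagram_def)
  obtain d where d: "\<And>i x. i < 2 \<Longrightarrow> x \<in> set (G ! i) \<Longrightarrow> h' x = h x + d i"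
    using potential_unique[OF h] len by auto
  show ?thesis unfolding height_class_eq_iff
    using index_sum_shift[OF d, where i = 0 and j = 1] index_sum_shift[OF d, where i = 1 and j = 0]
    by (intro exI[of _ "d 1 - d 0"]) (auto simp: algebra_simps)
qed

lemma same_data_height_class:
  assumes "same_data E G H" "gauss_diagram 2 G" "gauss_diagram 2 H" "potential G h" "potential H h'"
  shows "height_class h G = height_class h' H"
proof -
  obtain g g' where g: "potential G g" "potential H g'"
    and eq: "\<And>i j n. i < 2 \<Longrightarrow> j < 2 \<Longrightarrow> i = j \<and> n \<in> E \<or> index_sum g G i j n = index_sum g' H i j n"
    using assms(1) unfolding same_data_def by blast
  have "height_class g G = height_class g' H"
    unfolding height_class_eq_iff using eq[of 0 1] eq[of 1 0] by (intro exI[of _ 0]) auto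
  then show ?thesis using height_class_unique assms g by metis
qed

lemma F_class:
  assumes G: "gauss_diagram 2 G" and h: "potential G h" and g0: "\<gamma>\<^sub>0 \<in> nonself_chords G"
  shows "Gamma_class 0 (F_poly G \<gamma>\<^sub>0 0 1) (F_poly G \<gamma>\<^sub>0 1 0) = height_class h G"
proof -
  have "height_class h G = Gamma_class 0 (F_poly G \<gamma>\<^sub>0 0 1) (F_poly G \<gamma>\<^sub>0 1 0)"
    unfolding height_class_def Gamma_class_0_eq_iff lookup_F_poly lookup_height_poly
    using J_rel_index_sum[OF G h g0, of 0 1] J_rel_index_sum[OF G h g0, of 1 0] height_gap_swap[OF G g0, of h]
    by (intro exI[of _ "height_gap h G \<gamma>\<^sub>0 0 1"]) (auto simp: insert_commute)
  then show ?thesis ..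
qed

lemma fresh_label: "finite S \<Longrightarrow> \<exists>l. \<forall>l' \<sigma>. Chord l' \<sigma> \<in> S \<longrightarrow> l' < l"
proof -
  assume "finite S"
  then have "finite (chord_label ` S)" by simp
  then obtain l where "\<forall>x\<in>chord_label ` S. x < l" using finite_nat_set_iff_bounded by blast
  then show ?thesis by (metis chord.sel(1) imageI)
qed

text \<open>
  Without nonself-chords there would be no candidate for the linking class.  A cancelling pair of
  them can always be inserted by R2.
\<close>

lemma link_has_nonself_chord:
  assumes L: "L \<in> virtual_links 2"
  shows "\<exists>G\<in>L. nonself_chords G \<noteq> {}"
proof -
  obtain G where G: "G \<in> L" "gauss_diagram 2 G" using link_members[OF L] by blast
  obtain l where l: "\<And>l' \<sigma>. Chord l' \<sigma> \<in> chords G \<Longrightarrow> l' < l" using fresh_label[OF finite_chords] by blast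
  define a b where "a = Chord l 1" and "b = Chord l (-1)"
  have ab: "a \<notin> chords G" "b \<notin> chords G" "a \<noteq> b" using l unfolding a_def b_def by auto
  obtain X Y where XY: "G = [X, Y]"
    using G(2) unfolding gauss_diagram_def by (auto simp: length_Suc_conv numeral_2_eq_2)
  define H1 where "H1 = [Ini a # X, Ter a # Y]"
  define H where "H = [Ini a # Ini b # X, Ter a # Ter b # Y]"
  have notin: "Ini a \<notin> set (concat G)" "Ter a \<notin> set (concat G)" "Ini b \<notin> set (concat G)" "Ter b \<notin> set (concat G)"
    using ab endpoint_in_gauss_diagram[OF G(2)] by auto
  have H1: "gauss_diagram 2 H1"
    by (rule gauss_diagram_insert_chord[OF _ _ notin(1,2) _ G(2)])
      (auto simp: H1_def XY a_def)
  have "Ini b \<notin> set (concat H1)" "Ter b \<notin> set (concat H1)" using notin ab(3) by (auto simp: H1_def XY)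
  then have H: "gauss_diagram 2 H"
    by (intro gauss_diagram_insert_chord[OF _ _ _ _ _ H1]) (auto simp: H_def H1_def b_def)
  have "chord_of p \<notin> {a, b}" if "p \<in> set (concat G)" for p
    using that ab endpoint_in_gauss_diagram[OF G(2)] by auto
  then have "filter (\<lambda>p. chord_of p \<notin> {a, b}) X = X" "filter (\<lambda>p. chord_of p \<notin> {a, b}) Y = Y"
    unfolding filter_id_conv XY by auto
  then have "delete_chords {a, b} H = G" unfolding delete_chords_def H_def XY by simp
  moreover have "adjacent H (Ini a) (Ini b)" "adjacent H (Ter a) (Ter b)"
    unfolding adjacent_def using followed_by_word[of 0 H "[]"] followed_by_word[of 1 H "[]"]
    by (auto simp: H_def)
  moreover have "chord_sign a = - chord_sign b" by (simp add: a_def b_def)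
  ultimately have "R2 H G" unfolding R2_def by blast
  then have "reidemeister_step 2 H G" unfolding reidemeister_step_def using H G(2) by blast
  then have "equivclp (reidemeister_step 2) G H" by (rule converse_r_into_equivclp)
  then have "H \<in> L" using link_members(4)[OF L G(1) H] by blast
  moreover have "a \<in> nonself_chords H"
  proof -
    have "a \<in> chords_of_type H 0 1" "length H = 2" by (simp_all add: chords_of_type_def H_def)
    then have "\<exists>i<length H. \<exists>j<length H. i \<noteq> j \<and> a \<in> chords_of_type H i j"
      by (intro exI[where x = "0::nat"] conjI exI[where x = "1::nat"]) simp_all
    then show ?thesis unfolding nonself_chords_def by blast
  qed
  ultimately show ?thesis by blast
qed

lemma linking_class_link:
  assumes L: "L \<in> virtual_links 2" "linking_difference L = 0" and G: "G \<in> L" and h: "potential G h"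
  shows "linking_class L = height_class h G"
proof -
  have "\<exists>H\<in>L. \<exists>\<gamma>\<^sub>0\<in>nonself_chords H. linking_class L = Gamma_class 0 (F_poly H \<gamma>\<^sub>0 0 1) (F_poly H \<gamma>\<^sub>0 1 0)"
    unfolding linking_class_def L(2) nat_0
    by (rule someI_ex) (use link_has_nonself_chord[OF L(1)] in blast)
  then obtain H \<gamma>\<^sub>0 where H: "H \<in> L" "\<gamma>\<^sub>0 \<in> nonself_chords H"
    "linking_class L = Gamma_class 0 (F_poly H \<gamma>\<^sub>0 0 1) (F_poly H \<gamma>\<^sub>0 1 0)" by blast
  note gauss = link_members(2)[OF L(1)]
  obtain g where g: "potential H g" using balanced_potential[OF gauss[OF H(1)] link_balanced[OF L H(1)]] by blast
  have "same_data {0} G H"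
    using link_same_invariants[OF L(1) G H(1)] link_balanced[OF L G] unfolding same_invariants_def by blast
  then have "height_class h G = height_class g H"
    using same_data_height_class gauss G H(1) g h by blast
  then show ?thesis using H(3) F_class[OF gauss[OF H(1)] g H(2)] by simp
qed

text \<open>
  The linking classes agree up to a shift \<open>k\<close>, which is absorbed by raising the heights on the second
  circle by \<open>k\<close>.
\<close>

lemma invariants_iff_same_data:
  assumes L: "L \<in> virtual_links 2" "linking_difference L = 0" and G: "G \<in> L"
    and L': "L' \<in> virtual_links 2" "linking_difference L' = 0" and G': "G' \<in> L'"
  shows "(\<forall>n. n \<noteq> 0 \<and> n \<noteq> 1 \<longrightarrow> J L 0 n = J L' 0 n) \<and>
     (\<forall>n. n \<noteq> 0 \<and> n \<noteq> 1 \<longrightarrow> J L 1 n = J L' 1 n) \<and>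
     linking_class L = linking_class L' \<longleftrightarrow> same_data {0, 1} G G'" (is "?I \<longleftrightarrow> _")
proof -
  have gauss: "gauss_diagram 2 G" "gauss_diagram 2 G'"
    using link_members(2) L(1) L'(1) G G' by blast+
  obtain h where h: "potential G h" using balanced_potential[OF gauss(1) link_balanced[OF L G]] by blast
  obtain h' where h': "potential G' h'" using balanced_potential[OF gauss(2) link_balanced[OF L' G']] by blast
  have J: "J L i n = index_sum g G i i n" "J L' i n = index_sum g' G' i i n"
    if "potential G g" "potential G' g'" "i < 2" "n \<noteq> 0" for i n g g'
    using J_link[OF L G that(1,3,4)] J_link[OF L' G' that(2,3,4)] by auto
  have F: "linking_class L = height_class h G" "linking_class L' = height_class h' G'"
    using linking_class_link L L' G G' h h' by blast+
  show ?thesis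
  proof
    assume I: ?I
    then obtain k where k: "\<And>n. index_sum h' G' 0 1 n = index_sum h G 0 1 (n - k)"
      "\<And>n. index_sum h' G' 1 0 n = index_sum h G 1 0 (n + k)"
      unfolding F height_class_eq_iff by blast
    have len: "length G = 2" "distinct (concat G)" using gauss by (auto simp: gauss_diagram_def)
    let ?d = "\<lambda>i. if i = 1 then k else 0"
    obtain g where g: "potential G g" "\<And>i x. i < 2 \<Longrightarrow> x \<in> set (G ! i) \<Longrightarrow> g x = h x + ?d i"
      using potential_shift[OF h len(2), of ?d] len by auto
    show "same_data {0, 1} G G'"
    proof (rule same_dataI[OF g(1) h'])
      fix i j :: nat and n :: int assume ij: "i < 2" "j < 2"
      have sh: "index_sum g G i j n = index_sum h G i j (n - (?d j - ?d i))"
        by (rule index_sum_shift[OF g(2) ij])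
      show "i = j \<and> n \<in> {0, 1} \<or> index_sum g G i j n = index_sum h' G' i j n"
      proof (cases "i = j")
        case True
        then show ?thesis using J[OF g(1) h', of i n] I ij by (auto simp: less_2_cases_iff)
      next
        case False
        then consider "i = 0" "j = 1" | "i = 1" "j = 0" using ij by linarith
        then show ?thesis using sh k by cases auto
      qed
    qed
  next
    assume sd: "same_data {0, 1} G G'"
    then obtain g g' where g: "potential G g" "potential G' g'"
      and eq: "\<And>i j n. i < 2 \<Longrightarrow> j < 2 \<Longrightarrow> i = j \<and> n \<in> {0, 1} \<or> index_sum g G i j n = index_sum g' G' i j n"
      unfolding same_data_def by blast
    have "J L i n = J L' i n" if "i < 2" "n \<noteq> 0" "n \<noteq> 1" for i n
      using J[OF g that(1,2)] eq[OF that(1,1), of n] that(2,3) by auto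
    then show ?I using same_data_height_class[OF sd gauss h h'] F by simp
  qed
qed

lemma S_equivalent_same_data:
  assumes L: "L \<in> virtual_links 2" "linking_difference L = 0" and "S_equivalent 2 L L'"
  shows "\<exists>G\<in>L. \<exists>G'\<in>L'. same_data {0, 1} G G'"
proof -
  obtain G G' where G: "G \<in> L" "G' \<in> L'" "G \<approx> G'"
    using assms(3) unfolding S_equivalent_def by blast
  have "same_invariants {0, 1} G G'"
    using S_equiv_invariants(2)[OF G(3)] link_members(2)[OF L(1) G(1)] by blast
  then show ?thesis using link_balanced[OF L G(1)] G unfolding same_invariants_def by blast
qed

section \<open>Diagrams with shells\<close>

text \<open>
  The list \<open>L p\<close> contains the shells around \<open>p\<close> from the innermost to the outermost one.
\<close>

definition with_shells :: "(chord endpoint \<Rightarrow> chord list) \<Rightarrow> chord endpoint \<Rightarrow> chord endpoint list" where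
  "with_shells L p = map (shell_left p) (rev (L p)) @ p # map (shell_right p) (L p)"

definition shelled :: "(chord endpoint \<Rightarrow> chord list) \<Rightarrow> diagram \<Rightarrow> diagram" where
  "shelled L w = map (\<lambda>ws. concat (map (with_shells L) ws)) w"

definition all_shells :: "(chord endpoint \<Rightarrow> chord list) \<Rightarrow> diagram \<Rightarrow> chord list" where
  "all_shells L w = concat (map L (concat w))"

definition valid_shells :: "(chord endpoint \<Rightarrow> chord list) \<Rightarrow> diagram \<Rightarrow> bool" where
  "valid_shells L w \<longleftrightarrow> distinct (all_shells L w) \<and> set (all_shells L w) \<inter> chords w = {} \<and>
     (\<forall>c\<in>set (all_shells L w). chord_sign c \<in> {1, -1})"

text \<open>
  Shells around the two endpoints of a chord have the same effect on its index, so they are counted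
  together.
\<close>

definition shell_sum :: "(chord endpoint \<Rightarrow> chord list) \<Rightarrow> chord \<Rightarrow> int" where
  "shell_sum L \<gamma> = sum_list (map chord_sign (L (Ini \<gamma>))) + sum_list (map chord_sign (L (Ter \<gamma>)))"

lemma length_shelled [simp]: "length (shelled L w) = length w"
  by (simp add: shelled_def)

lemma concat_shelled: "concat (shelled L w) = concat (map (with_shells L) (concat w))"
  by (induction w) (simp_all add: shelled_def)

lemma mset_with_shells: "mset (with_shells L p) = {#p#} + image_mset Ini (mset (L p)) + image_mset Ter (mset (L p))"
proof -
  have "(shell_left p = Ini \<and> shell_right p = Ter) \<or> (shell_left p = Ter \<and> shell_right p = Ini)"
    by (auto simp: shell_left_def shell_right_def fun_eq_iff)
  then show ?thesis by (auto simp: with_shells_def)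
qed

lemma mset_concat_shelled:
  "mset (concat (shelled L w)) = mset (concat w @ map Ini (all_shells L w) @ map Ter (all_shells L w))"
proof -
  have "mset (concat (map (with_shells L) es)) = mset (es @ map Ini (concat (map L es)) @ map Ter (concat (map L es)))" for es
    by (induction es) (simp_all add: mset_with_shells ac_simps)
  then show ?thesis unfolding concat_shelled all_shells_def .
qed

lemma gauss_diagram_shelled:
  assumes w: "gauss_diagram 2 w" and ok: "valid_shells L w"
  shows "gauss_diagram 2 (shelled L w)"
proof -
  let ?S = "all_shells L w"
  let ?ws = "concat w @ map Ini ?S @ map Ter ?S"
  have d: "distinct (concat (shelled L w)) = distinct ?ws" and s: "set (concat (shelled L w)) = set ?ws"
    using mset_concat_shelled[of L w] by (metis mset_eq_imp_distinct_iff, metis mset_eq_setD)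
  have new: "chord_of p \<notin> set ?S" if "p \<in> set (concat w)" for p
    using that ok endpoint_in_gauss_diagram[OF w] unfolding valid_shells_def by blast
  have "distinct ?ws"
    using w ok new unfolding gauss_diagram_def valid_shells_def
    by (fastforce simp: distinct_map inj_on_def simp del: set_concat)
  moreover have "Ini \<gamma> \<in> set ?ws \<longleftrightarrow> Ter \<gamma> \<in> set ?ws" for \<gamma>
    using w unfolding gauss_diagram_def by (auto simp del: set_concat)
  moreover have "chord_sign \<gamma> \<in> {1, -1}" if "Ini \<gamma> \<in> set ?ws" for \<gamma>
  proof -
    have "Ini \<gamma> \<in> set (concat w) \<or> \<gamma> \<in> set ?S" using that by auto
    then show ?thesis using w ok unfolding gauss_diagram_def valid_shells_def by blast
  qed
  ultimately show ?thesis using w unfolding gauss_diagram_def d s length_shelled by blast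
qed

lemma shelled_cong:
  assumes "\<And>p. p \<in> set (concat w) \<Longrightarrow> L p = L' p" shows "shelled L w = shelled L' w"
proof -
  have "with_shells L p = with_shells L' p" if "ws \<in> set w" "p \<in> set ws" for ws p
  proof -
    have "L p = L' p" by (rule assms) (use that in auto)
    then show ?thesis by (simp add: with_shells_def)
  qed
  then show ?thesis unfolding shelled_def by (intro map_cong arg_cong[where f = concat]) auto
qed

lemma shelled_none:
  assumes "\<And>p. p \<in> set (concat w) \<Longrightarrow> L p = []" shows "shelled L w = w"
proof -
  have "concat (map (with_shells L) ws) = ws" if "ws \<in> set w" for ws
  proof -
    have "map (with_shells L) ws = map (\<lambda>p. [p]) ws"
    proof (rule map_cong[OF refl])
      fix p assume "p \<in> set ws"
      have "L p = []" by (rule assms) (use that \<open>p \<in> set ws\<close> in auto)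
      then show "with_shells L p = [p]" by (simp add: with_shells_def)
    qed
    then have "concat (map (with_shells L) ws) = concat (map (\<lambda>p. [p]) ws)" by (rule arg_cong)
    then show ?thesis by (simp only: concat_map_singleton list.map_ident)
  qed
  then show ?thesis unfolding shelled_def by (simp add: map_idI)
qed

lemma valid_shells_mset_cong:
  assumes "mset (all_shells L w) = mset (all_shells L' w')" "chords w = chords w'"
  shows "valid_shells L w = valid_shells L' w'"
  unfolding valid_shells_def using assms
  by (metis mset_eq_imp_distinct_iff mset_eq_setD)

lemma in_all_shells: "c \<in> set (all_shells L w) \<longleftrightarrow> (\<exists>p\<in>set (concat w). c \<in> set (L p))"
  unfolding all_shells_def by simp

lemma distinct_concat_map_disjoint:
  "distinct (concat (map L es)) \<Longrightarrow> distinct es \<Longrightarrow> x \<in> set es \<Longrightarrow> y \<in> set es \<Longrightarrow> x \<noteq> y \<Longrightarrow>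
     set (L x) \<inter> set (L y) = {}"
  by (induction es) auto

lemma valid_shells_disjoint:
  assumes "gauss_diagram 2 w" "valid_shells L w" "x \<in> set (concat w)"
  shows "distinct (L x)" and "y \<in> set (concat w) \<Longrightarrow> x \<noteq> y \<Longrightarrow> set (L x) \<inter> set (L y) = {}"
    and "c \<in> set (L x) \<Longrightarrow> c \<notin> chords w" and "c \<in> set (L x) \<Longrightarrow> chord_sign c = 1 \<or> chord_sign c = -1"
proof -
  have d: "distinct (concat (map L (concat w)))" using assms(2) unfolding valid_shells_def all_shells_def by blast
  obtain es fs where "concat w = es @ x # fs" using assms(3) by (meson split_list)
  with d show "distinct (L x)" by simp
  show "set (L x) \<inter> set (L y) = {}" if "y \<in> set (concat w)" "x \<noteq> y"
    using distinct_concat_map_disjoint[OF d _ assms(3) that] assms(1) unfolding gauss_diagram_def by blast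
  show "c \<notin> chords w" if "c \<in> set (L x)"
    using assms(2,3) that unfolding valid_shells_def in_all_shells[symmetric] by (meson disjoint_iff in_all_shells)
  show "chord_sign c = 1 \<or> chord_sign c = -1" if "c \<in> set (L x)"
    using assms(2,3) that unfolding valid_shells_def by (metis in_all_shells insertE singletonD)
qed

lemma mset_all_shells_update:
  assumes "gauss_diagram 2 w" "p \<in> set (concat w)"
  shows "mset (all_shells (L(p := cs)) w) + mset (L p) = mset (all_shells L w) + mset cs"
proof -
  have d: "distinct (concat w)" using assms(1) by (simp add: gauss_diagram_def)
  obtain es fs where e: "concat w = es @ p # fs" using assms(2) by (meson split_list)
  then have "p \<notin> set es" "p \<notin> set fs" using d by auto
  then have m: "map (L(p := cs)) es = map L es" "map (L(p := cs)) fs = map L fs" by auto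
  show ?thesis unfolding all_shells_def e map_append list.map m by simp
qed

lemma filter_with_shells:
  "chord_of p \<notin> S \<Longrightarrow> filter (\<lambda>x. chord_of x \<notin> S) (with_shells L p) = with_shells (\<lambda>p. filter (\<lambda>c. c \<notin> S) (L p)) p"
  by (simp add: with_shells_def filter_map comp_def rev_filter)

lemma delete_chords_shelled:
  assumes "\<And>p. p \<in> set (concat w) \<Longrightarrow> chord_of p \<notin> S"
  shows "delete_chords S (shelled L w) = shelled (\<lambda>p. filter (\<lambda>c. c \<notin> S) (L p)) w"
proof -
  have "filter (\<lambda>x. chord_of x \<notin> S) (concat (map (with_shells L) ws)) =
      concat (map (with_shells (\<lambda>p. filter (\<lambda>c. c \<notin> S) (L p))) ws)" if "set ws \<subseteq> set (concat w)" for ws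
    using that assms by (induction ws) (auto simp: filter_with_shells simp del: set_concat)
  then show ?thesis unfolding delete_chords_def shelled_def by fastforce
qed

lemma followed_by_shelled:
  assumes p: "p \<in> set (concat w)" and with_shells: "with_shells L p = us @ x # y # vs"
  shows "followed_by (shelled L w) x y"
proof -
  obtain i where i: "i < length w" "p \<in> set (w ! i)" using p in_concat_nth by metis
  then obtain as bs where w: "w ! i = as @ p # bs" by (meson split_list)
  have "shelled L w ! i = (concat (map (with_shells L) as) @ us) @ x # y # vs @ concat (map (with_shells L) bs)"
    using i w with_shells by (simp add: shelled_def)
  then show ?thesis using i(1) followed_by_word by (metis length_shelled)
qed

lemma shell_at_shelled:
  assumes "p \<in> set (concat w)" "L p = c # cs"
  shows "shell_at (shelled L w) p c"
  unfolding shell_at_iff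
  using followed_by_shelled[OF assms(1), of L "map (shell_left p) (rev cs)"]
    followed_by_shelled[OF assms(1), of L "map (shell_left p) (rev cs) @ [shell_left p c]"]
  by (simp add: with_shells_def assms(2))


section \<open>Only the sum of the signs of the shells matters\<close>

lemma isomorphic_relabel:
  assumes "gauss_diagram 2 G" "inj_on f (chords G)"
    and "\<And>\<gamma>. \<gamma> \<in> chords G \<Longrightarrow> chord_sign (f \<gamma>) = chord_sign \<gamma>"
  shows "isomorphic G (map (map (map_endpoint f)) G)"
  unfolding isomorphic_def
proof (intro conjI exI)
  show "\<forall>i<length G. map (map (map_endpoint f)) G ! i = rotate 0 (map (map_endpoint f) (G ! i))" by simp
qed (use assms in auto)

lemma isomorphic_S_equiv:
  "isomorphic G H \<Longrightarrow> gauss_diagram 2 G \<Longrightarrow> gauss_diagram 2 H \<Longrightarrow> G \<approx> H"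
  by (rule r_into_equivclp) (simp add: reidemeister_step_def)

lemma map_map_of_zip:
  "distinct xs \<Longrightarrow> length xs = length ys \<Longrightarrow> map (\<lambda>x. the (map_of (zip xs ys) x)) xs = ys"
  by (metis (mono_tags, lifting) length_map map_of_zip_nth nth_equalityI nth_map option.sel)

lemma concat_map_eq_lists:
  "map f (concat (map L es)) = concat (map L' es) \<Longrightarrow> (\<And>p. p \<in> set es \<Longrightarrow> length (L p) = length (L' p)) \<Longrightarrow>
    p \<in> set es \<Longrightarrow> map f (L p) = L' p"
  by (induction es) (auto simp: append_eq_append_conv)

lemma chords_shelled:
  assumes "gauss_diagram 2 w" "valid_shells L w"
  shows "chords (shelled L w) = chords w \<union> set (all_shells L w)"
proof -
  have "set (concat (shelled L w)) = set (concat w @ map Ini (all_shells L w) @ map Ter (all_shells L w))"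
    using mset_concat_shelled mset_eq_setD by metis
  then show ?thesis unfolding chords_def by auto
qed

text \<open>
  The shells of \<open>L\<close> and \<open>L'\<close> are matched in the order in which they are listed, and the chords of
  \<open>w\<close> keep their names.
\<close>

lemma shelled_relabel:
  assumes w: "gauss_diagram 2 w" and ok: "valid_shells L w" "valid_shells L' w"
    and eq: "\<And>p. p \<in> set (concat w) \<Longrightarrow> map chord_sign (L p) = map chord_sign (L' p)"
  shows "shelled L w \<approx> shelled L' w"
proof -
  let ?S = "all_shells L w" and ?S' = "all_shells L' w"
  have len: "length (L p) = length (L' p)" if "p \<in> set (concat w)" for p
    using eq[OF that] by (metis length_map)
  have sgnS: "map chord_sign ?S = map chord_sign ?S'"
  proof -
    have "map chord_sign (concat (map L es)) = map chord_sign (concat (map L' es))"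
      if "set es \<subseteq> set (concat w)" for es
      using that by (induction es) (auto simp: eq simp del: set_concat)
    then show ?thesis unfolding all_shells_def by blast
  qed
  then have lenS: "length ?S = length ?S'" by (metis length_map)
  define f where "f c = (if c \<in> chords w then c else the (map_of (zip ?S ?S') c))" for c
  have notin: "c \<notin> chords w" if "c \<in> set ?S" for c using ok(1) that unfolding valid_shells_def by blast
  have fS: "map f ?S = ?S'"
  proof -
    have "map f ?S = map (\<lambda>c. the (map_of (zip ?S ?S') c)) ?S"
      using notin by (simp add: f_def)
    then show ?thesis using map_map_of_zip[OF _ lenS] ok(1) unfolding valid_shells_def by simp
  qed
  have fL: "map f (L p) = L' p" if "p \<in> set (concat w)" for p
    using concat_map_eq_lists[of f L "concat w" L' p] fS len that unfolding all_shells_def by blast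
  have f_fat: "map (map_endpoint f) (with_shells L p) = with_shells L' p" if p: "p \<in> set (concat w)" for p
  proof -
    have "chord_of p \<in> chords w" using p endpoint_in_gauss_diagram[OF w] by blast
    then have "map_endpoint f p = p" by (cases p) (auto simp: f_def)
    moreover have "map_endpoint f (shell_left p c) = shell_left p (f c)"
      "map_endpoint f (shell_right p c) = shell_right p (f c)" for c
      by (auto simp: shell_left_def shell_right_def)
    ultimately show ?thesis unfolding with_shells_def fL[OF p, symmetric]
      by (simp add: rev_map comp_def)
  qed
  have "map (map (map_endpoint f)) (shelled L w) = shelled L' w"
    unfolding shelled_def map_map comp_def map_concat
    using f_fat by (intro map_cong arg_cong[where f = concat]) auto
  moreover have "inj_on f (chords (shelled L w))"
  proof (rule inj_onI)
    have chords: "chords (shelled L w) = chords w \<union> set ?S" by (rule chords_shelled[OF w ok(1)])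
    have inS: "f c \<in> set ?S'" if "c \<in> set ?S" for c using that fS by (metis imageI list.set_map)
    have sep: "c \<notin> chords w" if "c \<in> set ?S'" for c using ok(2) that unfolding valid_shells_def by blast
    have injS: "inj_on f (set ?S)"
      using fS ok unfolding valid_shells_def by (metis distinct_map)
    fix x y assume "x \<in> chords (shelled L w)" "y \<in> chords (shelled L w)" "f x = f y"
    then show "x = y" unfolding chords
      using inS sep inj_onD[OF injS] notin by (metis UnE f_def)
  qed
  moreover have "chord_sign (f \<gamma>) = chord_sign \<gamma>" if "\<gamma> \<in> chords (shelled L w)" for \<gamma>
  proof (cases "\<gamma> \<in> chords w")
    case True
    then show ?thesis by (simp add: f_def)
  next
    case False
    then have "\<gamma> \<in> set ?S" using that chords_shelled[OF w ok(1)] by auto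
    moreover have "map (chord_sign \<circ> f) ?S = map chord_sign ?S"
      using fS sgnS by (metis map_map)
    ultimately show ?thesis by (auto simp: map_eq_conv)
  qed
  ultimately have "isomorphic (shelled L w) (shelled L' w)"
    using isomorphic_relabel[OF gauss_diagram_shelled[OF w ok(1)]] by metis
  then show ?thesis using isomorphic_S_equiv gauss_diagram_shelled w ok by blast
qed

lemma endpoint_pair_in:
  assumes "gauss_diagram 2 w" "{p, q} = {Ini \<gamma>, Ter \<gamma>}" "p \<in> set (concat w)"
  shows "q \<in> set (concat w)"
proof -
  have "chord_of p = chord_of q" using assms(2) by (auto simp: doubleton_eq_iff)
  then show ?thesis using assms(1,3) endpoint_in_gauss_diagram by metis
qed

text \<open>
  This is S1, with the innermost shell kept under its name.
\<close>

lemma shell_change_end: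
  assumes w: "gauss_diagram 2 w" and ok: "valid_shells L w" and pq: "{p, q} = {Ini \<gamma>, Ter \<gamma>}"
    and p: "p \<in> set (concat w)" and L: "L p = c # cs"
  defines "L' \<equiv> L(p := cs, q := c # L q)"
  shows "valid_shells L' w" "shelled L w \<approx> shelled L' w" "shell_sum L' \<delta> = shell_sum L \<delta>"
proof -
  have q: "q \<in> set (concat w)" by (rule endpoint_pair_in[OF w pq p])
  have ne: "p \<noteq> q" using pq by (auto simp: doubleton_eq_iff)
  have "mset (all_shells L' w) + mset (L q) = mset (all_shells (L(p := cs)) w) + mset (c # L q)"
    using mset_all_shells_update[OF w q, of "L(p := cs)" "c # L q"] ne unfolding L'_def by simp
  moreover have "mset (all_shells (L(p := cs)) w) + mset (L p) = mset (all_shells L w) + mset cs"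
    by (rule mset_all_shells_update[OF w p])
  ultimately have "mset (all_shells L' w) = mset (all_shells L w)" unfolding L by (auto simp: ac_simps)
  then show ok': "valid_shells L' w" using ok valid_shells_mset_cong by metis
  have c: "chord_of x \<notin> {c}" if "x \<in> set (concat w)" for x
    using valid_shells_disjoint(3)[OF w ok p, of c] that endpoint_in_gauss_diagram[OF w] unfolding L by auto
  have "delete_chords {c} (shelled L w) = delete_chords {c} (shelled L' w)"
    unfolding delete_chords_shelled[OF c, of w L, simplified] delete_chords_shelled[OF c, of w L', simplified]
    by (rule shelled_cong) (auto simp: L'_def L)
  moreover have "shell_at (shelled L w) p c" by (rule shell_at_shelled[where L = L, OF p L])
  moreover have "shell_at (shelled L' w) q c" by (rule shell_at_shelled[OF q]) (simp add: L'_def)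
  ultimately have "S1 (shelled L w) (shelled L' w)" unfolding S1_def using pq by blast
  then show "shelled L w \<approx> shelled L' w"
    by (intro r_into_equivclp) (simp add: shell_step_def gauss_diagram_shelled[OF w] ok ok')
  show "shell_sum L' \<delta> = shell_sum L \<delta>"
    using pq L ne unfolding shell_sum_def L'_def by (cases "\<delta> = \<gamma>") (auto simp: doubleton_eq_iff)
qed

text \<open>
  Parallel shells of opposite signs have adjacent initial endpoints and adjacent terminal
  endpoints, so R2 applies.
\<close>

lemma shell_cancel:
  assumes w: "gauss_diagram 2 w" and ok: "valid_shells L w"
    and p: "p \<in> set (concat w)" and L: "L p = xs @ a # b # ys" and ab: "chord_sign a \<noteq> chord_sign b"
  defines "L' \<equiv> L(p := xs @ ys)"
  shows "valid_shells L' w" "shelled L w \<approx> shelled L' w" "shell_sum L' \<delta> = shell_sum L \<delta>"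
proof -
  have sgn: "chord_sign a = - chord_sign b"
    using valid_shells_disjoint(4)[OF w ok p, of a] valid_shells_disjoint(4)[OF w ok p, of b] ab unfolding L by auto
  have m: "mset (all_shells L w) = mset (all_shells L' w) + {#a, b#}"
  proof -
    have "(mset (all_shells L' w) + {#a, b#}) + mset (xs @ ys) = mset (all_shells L w) + mset (xs @ ys)"
      using mset_all_shells_update[OF w p, of L "xs @ ys"] unfolding L'_def[symmetric] L by simp
    then show ?thesis by (simp only: add_right_cancel)
  qed
  then have "mset (all_shells L w) = mset (all_shells L' w @ [a, b])" by simp
  then have "distinct (all_shells L w) = distinct (all_shells L' w @ [a, b])"
    "set (all_shells L w) = set (all_shells L' w @ [a, b])"
    by (metis mset_eq_imp_distinct_iff, metis mset_eq_setD)
  then show ok': "valid_shells L' w" using ok unfolding valid_shells_def by auto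
  have c: "chord_of x \<notin> {a, b}" if "x \<in> set (concat w)" for x
    using valid_shells_disjoint(3)[OF w ok p] that endpoint_in_gauss_diagram[OF w] unfolding L by auto
  have "filter (\<lambda>c. c \<notin> {a, b}) (L x) = L' x" if x: "x \<in> set (concat w)" for x
  proof (cases "x = p")
    case True
    have "distinct (xs @ a # b # ys)" using valid_shells_disjoint(1)[OF w ok p] unfolding L .
    then have "filter (\<lambda>c. c \<notin> {a, b}) xs = xs" "filter (\<lambda>c. c \<notin> {a, b}) ys = ys"
      by (auto intro!: filter_True)
    then show ?thesis using True by (simp add: L L'_def)
  next
    case False
    then have "set (L x) \<inter> set (L p) = {}" by (rule valid_shells_disjoint(2)[OF w ok x p])
    then show ?thesis using False by (auto simp: L L'_def intro!: filter_True)
  qed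
  then have del: "delete_chords {a, b} (shelled L w) = shelled L' w"
    unfolding delete_chords_shelled[OF c, of w L, simplified] by (intro shelled_cong) simp
  have l: "followed_by (shelled L w) (shell_left p b) (shell_left p a)"
    by (rule followed_by_shelled[OF p, of L "map (shell_left p) (rev ys)"]) (simp add: with_shells_def L)
  have r: "followed_by (shelled L w) (shell_right p a) (shell_right p b)"
    by (rule followed_by_shelled[OF p, of L "map (shell_left p) (rev (L p)) @ p # map (shell_right p) xs"])
      (simp add: with_shells_def L)
  have "adjacent (shelled L w) (Ini a) (Ini b)" "adjacent (shelled L w) (Ter a) (Ter b)"
    using l r unfolding adjacent_def shell_left_def shell_right_def by (auto split: if_splits)
  then have "R2 (shelled L w) (shelled L' w)" unfolding R2_def using sgn del by metis
  then show "shelled L w \<approx> shelled L' w"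
    by (intro r_into_equivclp) (simp add: reidemeister_step_def gauss_diagram_shelled[OF w] ok ok')
  show "shell_sum L' \<delta> = shell_sum L \<delta>"
    using sgn by (auto simp: shell_sum_def L'_def L)
qed

text \<open>
  Every use of S1 reduces the number of shells on the wrong side.
\<close>

lemma shells_move_to_side:
  assumes w: "gauss_diagram 2 w" and ok: "valid_shells L w"
    and e: "\<And>\<gamma>. e \<gamma> = Ini \<gamma> \<or> e \<gamma> = Ter \<gamma>"
  shows "\<exists>L'. valid_shells L' w \<and> shelled L w \<approx> shelled L' w \<and> (\<forall>\<gamma>. shell_sum L' \<gamma> = shell_sum L \<gamma>) \<and>
    (\<forall>p\<in>set (concat w). p \<noteq> e (chord_of p) \<longrightarrow> L' p = [])"
  using ok
proof (induction "\<Sum>p\<in>{p \<in> set (concat w). p \<noteq> e (chord_of p)}. length (L p)" arbitrary: L rule: less_induct)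
  case less
  show ?case
  proof (cases "\<exists>p\<in>set (concat w). p \<noteq> e (chord_of p) \<and> L p \<noteq> []")
    case False
    then show ?thesis using less.prems by (intro exI[of _ L]) auto
  next
    case True
    then obtain p c cs where p: "p \<in> set (concat w)" "p \<noteq> e (chord_of p)" "L p = c # cs"
      by (metis list.exhaust)
    let ?q = "e (chord_of p)" and ?L = "L(p := cs, e (chord_of p) := c # L (e (chord_of p)))"
    have pq: "{p, ?q} = {Ini (chord_of p), Ter (chord_of p)}"
      using p(2) e[of "chord_of p"] by (cases p) auto
    have q: "chord_of ?q = chord_of p" using e[of "chord_of p"] by auto
    note step = shell_change_end[OF w less.prems pq p(1,3)]
    have "(\<Sum>p\<in>{p \<in> set (concat w). p \<noteq> e (chord_of p)}. length (?L p))
        < (\<Sum>p\<in>{p \<in> set (concat w). p \<noteq> e (chord_of p)}. length (L p))"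
    proof (rule sum_strict_mono_ex1)
      show "\<forall>x\<in>{p \<in> set (concat w). p \<noteq> e (chord_of p)}. length (?L x) \<le> length (L x)"
        using p(3) q by auto
      show "\<exists>x\<in>{p \<in> set (concat w). p \<noteq> e (chord_of p)}. length (?L x) < length (L x)"
        using p by (intro bexI[of _ p]) auto
    qed simp
    from less.hyps[OF this step(1)] obtain L' where "valid_shells L' w" "shelled ?L w \<approx> shelled L' w"
      "\<forall>\<gamma>. shell_sum L' \<gamma> = shell_sum ?L \<gamma>" "\<forall>p\<in>set (concat w). p \<noteq> e (chord_of p) \<longrightarrow> L' p = []"
      by blast
    with step(2,3) show ?thesis by (intro exI[of _ L']) (auto intro: equivclp_trans)
  qed
qed

lemma not_constant_adjacent:
  assumes "\<nexists>\<sigma>. map f xs = replicate (length xs) \<sigma>"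
  shows "\<exists>us a b vs. xs = us @ a # b # vs \<and> f a \<noteq> f b"
  using assms
proof (induction xs)
  case (Cons x xs)
  show ?case
  proof (cases "\<exists>\<sigma>. map f xs = replicate (length xs) \<sigma>")
    case True
    then obtain \<sigma> where s: "map f xs = replicate (length xs) \<sigma>" by blast
    show ?thesis
    proof (cases xs)
      case Nil
      with Cons.prems show ?thesis by auto
    next
      case (Cons y ys)
      then have "f y = \<sigma>" using s by simp
      moreover have "f x \<noteq> \<sigma>" using Cons.prems s by auto
      ultimately show ?thesis using Cons by (intro exI[of _ "[]"]) auto
    qed
  next
    case False
    then obtain us a b vs where "xs = us @ a # b # vs" "f a \<noteq> f b" using Cons.IH by blast
    then show ?thesis by (intro exI[of _ "x # us"]) auto
  qed
qed simp

text \<open>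
  As long as the shells around some endpoint have different signs, there are two neighbouring
  ones that cancel.
\<close>

lemma shells_normalize:
  assumes w: "gauss_diagram 2 w" and ok: "valid_shells L w"
  shows "\<exists>L'. valid_shells L' w \<and> shelled L w \<approx> shelled L' w \<and> (\<forall>\<gamma>. shell_sum L' \<gamma> = shell_sum L \<gamma>) \<and>
    (\<forall>p\<in>set (concat w). L p = [] \<longrightarrow> L' p = []) \<and>
    (\<forall>p\<in>set (concat w). \<exists>\<sigma>. map chord_sign (L' p) = replicate (length (L' p)) \<sigma>)"
  using ok
proof (induction "\<Sum>p\<in>set (concat w). length (L p)" arbitrary: L rule: less_induct)
  case less
  show ?case
  proof (cases "\<forall>p\<in>set (concat w). \<exists>\<sigma>. map chord_sign (L p) = replicate (length (L p)) \<sigma>")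
    case True
    then show ?thesis using less.prems by (intro exI[of _ L]) auto
  next
    case False
    then obtain p where p: "p \<in> set (concat w)" "\<nexists>\<sigma>. map chord_sign (L p) = replicate (length (L p)) \<sigma>" by blast
    obtain us a b vs where L: "L p = us @ a # b # vs" "chord_sign a \<noteq> chord_sign b"
      using not_constant_adjacent[OF p(2)] by blast
    let ?L = "L(p := us @ vs)"
    note step = shell_cancel[OF w less.prems p(1) L]
    have "(\<Sum>p\<in>set (concat w). length (?L p)) < (\<Sum>p\<in>set (concat w). length (L p))"
    proof (rule sum_strict_mono_ex1)
      show "\<forall>x\<in>set (concat w). length (?L x) \<le> length (L x)" using L by auto
      show "\<exists>x\<in>set (concat w). length (?L x) < length (L x)" using p L by (intro bexI[of _ p]) auto
    qed simp
    from less.hyps[OF this step(1)] obtain L' where "valid_shells L' w" "shelled ?L w \<approx> shelled L' w"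
      "\<forall>\<gamma>. shell_sum L' \<gamma> = shell_sum ?L \<gamma>" "\<forall>p\<in>set (concat w). ?L p = [] \<longrightarrow> L' p = []"
      "\<forall>p\<in>set (concat w). \<exists>\<sigma>. map chord_sign (L' p) = replicate (length (L' p)) \<sigma>"
      by blast
    moreover from this have "L' q = []" if "q \<in> set (concat w)" "L q = []" for q
      using that L(1) by (cases "q = p") auto
    ultimately show ?thesis using step(2,3) by (intro exI[of _ L']) (auto intro: equivclp_trans)
  qed
qed

text \<open>
  All shells are collected at the initial endpoints and cancelled there until those around any
  one endpoint have a common sign.  What remains is determined by the sums.
\<close>

lemma shelled_S_equiv:
  assumes w: "gauss_diagram 2 w" and ok: "valid_shells L w" "valid_shells L' w"
    and eq: "\<And>\<gamma>. \<gamma> \<in> chords w \<Longrightarrow> shell_sum L \<gamma> = shell_sum L' \<gamma>"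
  shows "shelled L w \<approx> shelled L' w"
proof -
  have "\<exists>M. valid_shells M w \<and> shelled L w \<approx> shelled M w \<and> (\<forall>\<gamma>. shell_sum M \<gamma> = shell_sum L \<gamma>) \<and>
    (\<forall>p\<in>set (concat w). p \<noteq> Ini (chord_of p) \<longrightarrow> M p = []) \<and>
    (\<forall>p\<in>set (concat w). \<exists>\<sigma>. map chord_sign (M p) = replicate (length (M p)) \<sigma>)"
    if L: "valid_shells L w" for L
  proof -
    obtain L1 where 1: "valid_shells L1 w" "shelled L w \<approx> shelled L1 w" "\<forall>\<gamma>. shell_sum L1 \<gamma> = shell_sum L \<gamma>"
      "\<forall>p\<in>set (concat w). p \<noteq> Ini (chord_of p) \<longrightarrow> L1 p = []"
      using shells_move_to_side[OF w L, of Ini] by blast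
    obtain M where 2: "valid_shells M w" "shelled L1 w \<approx> shelled M w" "\<forall>\<gamma>. shell_sum M \<gamma> = shell_sum L1 \<gamma>"
      "\<forall>p\<in>set (concat w). L1 p = [] \<longrightarrow> M p = []"
      "\<forall>p\<in>set (concat w). \<exists>\<sigma>. map chord_sign (M p) = replicate (length (M p)) \<sigma>"
      using shells_normalize[OF w 1(1)] by blast
    have "shelled L w \<approx> shelled M w" using 1(2) 2(2) by (rule equivclp_trans)
    with 1 2 show ?thesis by (intro exI[of _ M]) simp
  qed
  note normal = this
  obtain M where M: "valid_shells M w" "shelled L w \<approx> shelled M w" "\<forall>\<gamma>. shell_sum M \<gamma> = shell_sum L \<gamma>"
      "\<forall>p\<in>set (concat w). p \<noteq> Ini (chord_of p) \<longrightarrow> M p = []"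
      "\<forall>p\<in>set (concat w). \<exists>\<sigma>. map chord_sign (M p) = replicate (length (M p)) \<sigma>"
    using normal[OF ok(1)] by blast
  obtain M' where M': "valid_shells M' w" "shelled L' w \<approx> shelled M' w" "\<forall>\<gamma>. shell_sum M' \<gamma> = shell_sum L' \<gamma>"
      "\<forall>p\<in>set (concat w). p \<noteq> Ini (chord_of p) \<longrightarrow> M' p = []"
      "\<forall>p\<in>set (concat w). \<exists>\<sigma>. map chord_sign (M' p) = replicate (length (M' p)) \<sigma>"
    using normal[OF ok(2)] by blast
  have "map chord_sign (M p) = map chord_sign (M' p)" if p: "p \<in> set (concat w)" for p
  proof (cases p)
    case (Ter \<gamma>)
    then show ?thesis using M(4) M'(4) p by auto
  next
    case (Ini \<gamma>)
    have \<gamma>: "\<gamma> \<in> chords w" using p Ini endpoint_in_gauss_diagram[OF w] by auto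
    have "Ter \<gamma> \<in> set (concat w)" using \<gamma> endpoint_in_gauss_diagram[OF w] by auto
    then have "M (Ter \<gamma>) = []" "M' (Ter \<gamma>) = []" using M(4) M'(4) by auto
    then have sums: "sum_list (map chord_sign (M p)) = sum_list (map chord_sign (M' p))"
    proof -
      have "shell_sum M \<gamma> = shell_sum M' \<gamma>" using M(3) M'(3) eq[OF \<gamma>] by simp
      then show ?thesis using \<open>M (Ter \<gamma>) = []\<close> \<open>M' (Ter \<gamma>) = []\<close> Ini unfolding shell_sum_def by simp
    qed
    obtain \<sigma> \<tau> where st: "map chord_sign (M p) = replicate (length (M p)) \<sigma>"
      "map chord_sign (M' p) = replicate (length (M' p)) \<tau>" using M(5) M'(5) p by blast
    have "\<sigma> = 1 \<or> \<sigma> = -1" if "M p \<noteq> []"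
      using valid_shells_disjoint(4)[OF w M(1) p, of "hd (M p)"] st(1) that by (cases "M p") auto
    moreover have "\<tau> = 1 \<or> \<tau> = -1" if "M' p \<noteq> []"
      using valid_shells_disjoint(4)[OF w M'(1) p, of "hd (M' p)"] st(2) that by (cases "M' p") auto
    moreover have prod: "int (length (M p)) * \<sigma> = int (length (M' p)) * \<tau>"
      using sums unfolding st by (simp add: sum_list_replicate)
    ultimately have "M p = [] \<and> M' p = [] \<or> length (M p) = length (M' p) \<and> \<sigma> = \<tau>"
    proof (cases "M p = [] \<or> M' p = []")
      case True
      with prod \<open>M p \<noteq> [] \<Longrightarrow> \<sigma> = 1 \<or> \<sigma> = -1\<close> \<open>M' p \<noteq> [] \<Longrightarrow> \<tau> = 1 \<or> \<tau> = -1\<close>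
      show ?thesis by (cases "M p = []"; cases "M' p = []") simp_all
    next
      case False
      then have "\<sigma> = 1 \<or> \<sigma> = -1" "\<tau> = 1 \<or> \<tau> = -1" "length (M p) > 0" "length (M' p) > 0"
        using \<open>M p \<noteq> [] \<Longrightarrow> \<sigma> = 1 \<or> \<sigma> = -1\<close> \<open>M' p \<noteq> [] \<Longrightarrow> \<tau> = 1 \<or> \<tau> = -1\<close> by simp_all
      with prod show ?thesis by (elim disjE) simp_all
    qed
    then show ?thesis using st by (elim disjE conjE) simp_all
  qed
  then have "shelled M w \<approx> shelled M' w" by (rule shelled_relabel[OF w M(1) M'(1)])
  then show ?thesis using M(2) M'(2) by (meson equivclp_sym equivclp_trans)
qed

lemma fresh_chord_list:
  assumes "finite S"
  shows "\<exists>cs. length cs = n \<and> distinct cs \<and> set cs \<inter> S = {} \<and> (\<forall>c\<in>set cs. chord_sign c = \<sigma>)"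
proof -
  obtain l where l: "\<And>l' \<sigma>. Chord l' \<sigma> \<in> S \<Longrightarrow> l' < l" using fresh_label[OF assms] by blast
  let ?cs = "map (\<lambda>k. Chord (l + k) \<sigma>) [0..<n]"
  have "distinct ?cs" by (simp add: distinct_map inj_on_def)
  moreover have "set ?cs \<inter> S = {}" using l by fastforce
  ultimately show ?thesis by (intro exI[of _ ?cs]) auto
qed

text \<open>
  The function \<open>e\<close> selects the endpoint that carries the shells of a chord, which leaves the other
  endpoint bare.
\<close>

lemma shells_exist:
  assumes w: "gauss_diagram 2 w" and S: "finite S"
    and e: "\<And>\<gamma>. e \<gamma> = Ini \<gamma> \<or> e \<gamma> = Ter \<gamma>"
  shows "\<exists>L. valid_shells L w \<and> (\<forall>\<gamma>\<in>chords w. shell_sum L \<gamma> = s \<gamma>) \<and>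
    (\<forall>p. p \<noteq> e (chord_of p) \<or> p \<notin> set (concat w) \<or> s (chord_of p) = 0 \<longrightarrow> L p = []) \<and>
    (\<forall>p. set (L p) \<inter> S = {})"
proof -
  define m where "m p = (if p = e (chord_of p) then s (chord_of p) else 0)" for p
  let ?S = "S \<union> chords w"
  have "\<exists>L. distinct (concat (map L es)) \<and> (\<forall>p. set (L p) \<inter> ?S = {}) \<and>
      (\<forall>p\<in>set es. length (L p) = nat \<bar>m p\<bar> \<and> (\<forall>c\<in>set (L p). chord_sign c = sgn (m p))) \<and>
      (\<forall>p. p \<notin> set es \<longrightarrow> L p = [])" if "distinct es" for es
    using that
  proof (induction es)
    case Nil
    then show ?case by (intro exI[of _ "\<lambda>_. []"]) auto
  next
    case (Cons p es)
    then obtain L where L: "distinct (concat (map L es))" "\<forall>p. set (L p) \<inter> ?S = {}"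
      "\<forall>p\<in>set es. length (L p) = nat \<bar>m p\<bar> \<and> (\<forall>c\<in>set (L p). chord_sign c = sgn (m p))"
      "\<forall>p. p \<notin> set es \<longrightarrow> L p = []" by auto
    obtain cs where cs: "length cs = nat \<bar>m p\<bar>" "distinct cs" "set cs \<inter> (?S \<union> set (concat (map L es))) = {}"
      "\<forall>c\<in>set cs. chord_sign c = sgn (m p)"
      using fresh_chord_list[of "?S \<union> set (concat (map L es))" "nat \<bar>m p\<bar>" "sgn (m p)"] S finite_chords by auto
    have "map (L(p := cs)) es = map L es" using Cons.prems by auto
    then have e: "concat (map (L(p := cs)) (p # es)) = cs @ concat (map L es)"
      by (simp only: list.map concat.simps fun_upd_same)
    have "distinct (cs @ concat (map L es))" using L(1) cs(2,3) by auto
    then have "distinct (concat (map (L(p := cs)) (p # es)))" unfolding e .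
    moreover have "\<forall>r. set ((L(p := cs)) r) \<inter> ?S = {}" using L(2) cs(3) by auto
    moreover have "\<forall>r\<in>set (p # es). length ((L(p := cs)) r) = nat \<bar>m r\<bar> \<and>
        (\<forall>c\<in>set ((L(p := cs)) r). chord_sign c = sgn (m r))"
      using L(3) cs(1,4) Cons.prems by auto
    moreover have "\<forall>r. r \<notin> set (p # es) \<longrightarrow> (L(p := cs)) r = []" using L(4) by auto
    ultimately show ?case by blast
  qed
  from this[of "concat w"] have "\<exists>L. distinct (concat (map L (concat w))) \<and> (\<forall>p. set (L p) \<inter> ?S = {}) \<and>
      (\<forall>p\<in>set (concat w). length (L p) = nat \<bar>m p\<bar> \<and> (\<forall>c\<in>set (L p). chord_sign c = sgn (m p))) \<and>
      (\<forall>p. p \<notin> set (concat w) \<longrightarrow> L p = [])" using w unfolding gauss_diagram_def by blast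
  then obtain L where L: "distinct (all_shells L w)" "\<And>p. set (L p) \<inter> ?S = {}"
      "\<And>p. p \<in> set (concat w) \<Longrightarrow> length (L p) = nat \<bar>m p\<bar>"
      "\<And>p c. p \<in> set (concat w) \<Longrightarrow> c \<in> set (L p) \<Longrightarrow> chord_sign c = sgn (m p)"
      "\<And>p. p \<notin> set (concat w) \<Longrightarrow> L p = []" unfolding all_shells_def by metis
  have ok: "valid_shells L w" unfolding valid_shells_def
  proof (intro conjI ballI L(1))
    show "set (all_shells L w) \<inter> chords w = {}"
    proof (intro equals0I)
      fix c assume "c \<in> set (all_shells L w) \<inter> chords w"
      then obtain p where "c \<in> set (L p)" "c \<in> chords w" using in_all_shells by blast
      with L(2)[of p] show False by blast
    qed
    fix c assume "c \<in> set (all_shells L w)"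
    then obtain p where p: "p \<in> set (concat w)" "c \<in> set (L p)" using in_all_shells by metis
    then have "L p \<noteq> []" by auto
    then have "m p \<noteq> 0" using L(3)[OF p(1)] by auto
    then show "chord_sign c \<in> {1, -1}" using L(4)[OF p] by (auto simp: sgn_if)
  qed
  have sum: "sum_list (map chord_sign (L p)) = m p" if "p \<in> set (concat w)" for p
  proof -
    have "map chord_sign (L p) = replicate (nat \<bar>m p\<bar>) (sgn (m p))"
      using L(3,4)[OF that] by (intro replicate_eqI) auto
    then have "sum_list (map chord_sign (L p)) = of_nat (nat \<bar>m p\<bar>) * sgn (m p)"
      by (simp only: sum_list_replicate)
    also have "of_nat (nat \<bar>m p\<bar>) = \<bar>m p\<bar>" by (rule nat_0_le) (rule abs_ge_zero)
    also have "\<bar>m p\<bar> * sgn (m p) = m p" by (rule abs_mult_sgn)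
    finally show ?thesis .
  qed
  have "shell_sum L \<gamma> = s \<gamma>" if "\<gamma> \<in> chords w" for \<gamma>
  proof -
    have "Ini \<gamma> \<in> set (concat w)" "Ter \<gamma> \<in> set (concat w)"
      using that endpoint_in_gauss_diagram[OF w] by auto
    then have "shell_sum L \<gamma> = m (Ini \<gamma>) + m (Ter \<gamma>)" by (simp only: shell_sum_def sum)
    moreover have "m (Ini \<gamma>) + m (Ter \<gamma>) = s \<gamma>"
    proof (cases "e \<gamma> = Ini \<gamma>")
      case False
      then have "e \<gamma> = Ter \<gamma>" using e by blast
      then show ?thesis by (simp add: m_def)
    qed (simp add: m_def)
    ultimately show ?thesis by simp
  qed
  moreover have "L p = []" if "p \<noteq> e (chord_of p) \<or> p \<notin> set (concat w) \<or> s (chord_of p) = 0" for p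
  proof (cases "p \<in> set (concat w)")
    case True
    then have "m p = 0" using that unfolding m_def by presburger
    then show ?thesis using L(3)[OF True] by simp
  next
    case False
    then show ?thesis by (rule L(5))
  qed
  moreover have "set (L p) \<inter> S = {}" for p using L(2)[of p] by blast
  ultimately show ?thesis using ok by blast
qed

section \<open>Rearranging endpoints\<close>

text \<open>
  The diagram \<open>G\<close> is \<open>w\<close> with shells, and \<open>\<iota>\<close> gives the indices in \<open>G\<close> of the chords of \<open>w\<close>.  They
  are stated in terms of the heights in \<open>w\<close>, with the effect of the shells as a correction.
\<close>

definition realizes :: "diagram \<Rightarrow> (chord endpoint \<Rightarrow> int) \<Rightarrow> (chord \<Rightarrow> int) \<Rightarrow> diagram \<Rightarrow> bool" where
  "realizes w h \<iota> G \<longleftrightarrow> gauss_diagram 2 w \<and> potential w h \<and>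
     (\<exists>L. valid_shells L w \<and> G = shelled L w \<and>
       (\<forall>\<gamma>\<in>chords w. \<iota> \<gamma> = height_index h \<gamma> - chord_sign \<gamma> * shell_sum L \<gamma>))"

lemma realizesI:
  "gauss_diagram 2 w \<Longrightarrow> potential w h \<Longrightarrow> valid_shells L w \<Longrightarrow>
    (\<And>\<gamma>. \<gamma> \<in> chords w \<Longrightarrow> \<iota> \<gamma> = height_index h \<gamma> - chord_sign \<gamma> * shell_sum L \<gamma>) \<Longrightarrow>
    realizes w h \<iota> (shelled L w)"
  unfolding realizes_def by blast

lemma realizes_gauss: "realizes w h \<iota> G \<Longrightarrow> gauss_diagram 2 G"
  unfolding realizes_def using gauss_diagram_shelled by blast

lemma realizes_unique:
  assumes "realizes w h \<iota> G" "realizes w h \<iota> G'"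
  shows "G \<approx> G'"
proof -
  obtain L L' where L: "gauss_diagram 2 w" "valid_shells L w" "G = shelled L w" "valid_shells L' w" "G' = shelled L' w"
    "\<forall>\<gamma>\<in>chords w. \<iota> \<gamma> = height_index h \<gamma> - chord_sign \<gamma> * shell_sum L \<gamma>"
    "\<forall>\<gamma>\<in>chords w. \<iota> \<gamma> = height_index h \<gamma> - chord_sign \<gamma> * shell_sum L' \<gamma>"
    using assms unfolding realizes_def by blast
  have "shell_sum L \<gamma> = shell_sum L' \<gamma>" if "\<gamma> \<in> chords w" for \<gamma>
  proof -
    have "chord_sign \<gamma> * shell_sum L \<gamma> = chord_sign \<gamma> * shell_sum L' \<gamma>" using L(6,7) that by fastforce
    then show ?thesis using chord_sign_in_gauss_diagram[OF L(1) that] by auto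
  qed
  then show ?thesis using shelled_S_equiv L(1-5) by blast
qed

text \<open>
  The difference between the index in \<open>w\<close> and the prescribed one tells how many shells are needed.
\<close>

lemma realizing_shells:
  assumes w: "gauss_diagram 2 w" and S: "finite S"
    and e: "\<And>\<gamma>. e \<gamma> = Ini \<gamma> \<or> e \<gamma> = Ter \<gamma>"
  shows "\<exists>L. valid_shells L w \<and> (\<forall>\<gamma>\<in>chords w. \<iota> \<gamma> = height_index h \<gamma> - chord_sign \<gamma> * shell_sum L \<gamma>) \<and>
    (\<forall>p. p \<noteq> e (chord_of p) \<or> p \<notin> set (concat w) \<or> height_index h (chord_of p) = \<iota> (chord_of p) \<longrightarrow> L p = []) \<and>
    (\<forall>p. set (L p) \<inter> S = {})"
proof -
  let ?s = "\<lambda>\<gamma>. chord_sign \<gamma> * (height_index h \<gamma> - \<iota> \<gamma>)"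
  obtain L where L: "valid_shells L w" "\<forall>\<gamma>\<in>chords w. shell_sum L \<gamma> = ?s \<gamma>"
    "\<forall>p. p \<noteq> e (chord_of p) \<or> p \<notin> set (concat w) \<or> ?s (chord_of p) = 0 \<longrightarrow> L p = []"
    "\<forall>p. set (L p) \<inter> S = {}"
    using shells_exist[OF w S e, of ?s] by blast
  have "\<iota> \<gamma> = height_index h \<gamma> - chord_sign \<gamma> * shell_sum L \<gamma>" if "\<gamma> \<in> chords w" for \<gamma>
    using L(2) that chord_sign_in_gauss_diagram[OF w that] by auto
  with L show ?thesis by (intro exI[of _ L]) auto
qed

lemma realizes_exists:
  assumes "gauss_diagram 2 w" "potential w h"
  shows "\<exists>G. realizes w h \<iota> G"
proof -
  obtain L where "valid_shells L w" "\<forall>\<gamma>\<in>chords w. \<iota> \<gamma> = height_index h \<gamma> - chord_sign \<gamma> * shell_sum L \<gamma>"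
    using realizing_shells[OF assms(1) finite.emptyI, of Ini \<iota> h] by blast
  then show ?thesis using assms unfolding realizes_def by blast
qed

lemma realizes_change_heights:
  assumes "realizes w h \<iota> G" "potential w h'"
    and "\<And>\<gamma>. \<gamma> \<in> chords w \<Longrightarrow> height_index h' \<gamma> = height_index h \<gamma>"
  shows "realizes w h' \<iota> G"
  using assms unfolding realizes_def by metis

lemma exchange_word:
  assumes "distinct (concat G)" "i < length G" "G ! i = us @ p # q # vs"
  shows "exchange p q G = G[i := us @ q # p # vs]"
proof (rule nth_equalityI)
  show "length (exchange p q G) = length (G[i := us @ q # p # vs])" by simp
  fix k assume k: "k < length (exchange p q G)"
  show "exchange p q G ! k = G[i := us @ q # p # vs] ! k"
  proof (cases "k = i")
    case True
    have "distinct (us @ p # q # vs)" using assms by (metis distinct_concat_iff nth_mem)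
    then have "map (Transposition.transpose p q) us = us" "map (Transposition.transpose p q) vs = vs"
      by (auto simp: Transposition.transpose_def intro!: map_idI)
    then show ?thesis using True assms(2,3) by (simp add: exchange_def)
  next
    case False
    have "p \<in> set (G ! i)" "q \<in> set (G ! i)" using assms(3) by auto
    then have "p \<notin> set (G ! k)" "q \<notin> set (G ! k)"
      using distinct_concat_same_index[OF assms(1) assms(2), of k] k False by auto
    then have "map (Transposition.transpose p q) (G ! k) = G ! k"
      by (auto simp: Transposition.transpose_def intro!: map_idI)
    then show ?thesis using False k by (simp add: exchange_def)
  qed
qed

lemma mset_concat_update:
  "i < length w \<Longrightarrow> mset xs = mset (w ! i) \<Longrightarrow> mset (concat (w[i := xs])) = mset (concat w)"
  by (induction w arbitrary: i) (auto split: nat.splits)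

lemma gauss_diagram_update:
  assumes "gauss_diagram \<mu> w" "i < length w" "mset xs = mset (w ! i)"
  shows "gauss_diagram \<mu> (w[i := xs])" "chords (w[i := xs]) = chords w"
    "set (concat (w[i := xs])) = set (concat w)"
proof -
  have m: "mset (concat (w[i := xs])) = mset (concat w)" by (rule mset_concat_update[OF assms(2,3)])
  then show "gauss_diagram \<mu> (w[i := xs])"
    using assms(1) gauss_diagram_mset_cong[OF _ m, of \<mu>] by simp
  show s: "set (concat (w[i := xs])) = set (concat w)" using m by (rule mset_eq_setD)
  show "chords (w[i := xs]) = chords w" unfolding chords_def s ..
qed

lemma mset_all_shells: "mset (all_shells L w) = (\<Sum>p\<in>#mset (concat w). mset (L p))"
proof -
  have "mset (concat (map L es)) = (\<Sum>p\<in>#mset es. mset (L p))" for es by (induction es) auto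
  then show ?thesis unfolding all_shells_def .
qed

lemma valid_shells_update:
  assumes "gauss_diagram 2 w" "i < length w" "mset xs = mset (w ! i)"
  shows "valid_shells L (w[i := xs]) = valid_shells L w"
  using valid_shells_mset_cong[of L "w[i := xs]" L w] gauss_diagram_update(2)[OF assms] mset_concat_update[OF assms(2,3)]
  unfolding mset_all_shells by simp

lemma shelled_update: "shelled L (w[i := xs]) = (shelled L w)[i := concat (map (with_shells L) xs)]"
  by (simp add: shelled_def map_update)

text \<open>
  All shells are first moved to the other ends of the two chords; then S2 applies.  The two new
  shells are recorded in the shell sums, not in the underlying diagram.
\<close>

lemma realizes_swap:
  assumes r: "realizes w h \<iota> G" and i: "i < length w" and wi: "w ! i = us @ p # q # vs"
    and pq: "chord_of p \<noteq> chord_of q"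
  shows "\<exists>G'. realizes (w[i := us @ q # p # vs])
      (h(p := h p + endpoint_sign q, q := h q - endpoint_sign p)) \<iota> G' \<and> G \<approx> G'"
proof -
  let ?w = "w[i := us @ q # p # vs]" and ?h = "h(p := h p + endpoint_sign q, q := h q - endpoint_sign p)"
  have w: "gauss_diagram 2 w" and h: "potential w h" using r unfolding realizes_def by auto
  have dist: "distinct (concat w)" using w by (simp add: gauss_diagram_def)
  have m: "mset (us @ q # p # vs) = mset (w ! i)" unfolding wi by simp
  note upd = gauss_diagram_update[OF w i m]
  have p: "p \<in> set (concat w)" and q: "q \<in> set (concat w)" using i wi in_concat_nth[of _ w] by auto
  have ne: "p \<noteq> q" using pq by auto
  \<comment> \<open>The end of each chord at which its shells are put, away from \<open>p\<close> and \<open>q\<close>.\<close>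
  define e where "e \<gamma> = (if p = Ini \<gamma> \<or> q = Ini \<gamma> then Ter \<gamma> else Ini \<gamma>)" for \<gamma>
  have e: "e \<gamma> = Ini \<gamma> \<or> e \<gamma> = Ter \<gamma>" for \<gamma> by (simp add: e_def)
  obtain L where L: "valid_shells L w"
    "\<forall>\<gamma>\<in>chords w. \<iota> \<gamma> = height_index h \<gamma> - chord_sign \<gamma> * shell_sum L \<gamma>"
    "\<forall>p. p \<noteq> e (chord_of p) \<longrightarrow> L p = []"
    using realizing_shells[OF w finite.emptyI e, of \<iota> h] by blast
  have "p \<noteq> e (chord_of p)" "q \<noteq> e (chord_of q)"
    unfolding e_def using pq by (cases p; cases q; simp)+
  then have Lpq: "L p = []" "L q = []" using L(3) by blast+
  define G0 where "G0 = shelled L w"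
  have G0: "realizes w h \<iota> G0" unfolding G0_def using w h L by (intro realizesI) auto
  have sgn: "endpoint_sign p = 1 \<or> endpoint_sign p = -1" "endpoint_sign q = 1 \<or> endpoint_sign q = -1"
    using endpoint_sign_in_gauss_diagram[OF w] p q by auto
  let ?S = "chords w \<union> set (all_shells L w)"
  have fin: "finite ?S" using finite_chords by auto
  have "\<exists>c. c \<notin> ?S \<and> chord_sign c = \<sigma>" for \<sigma>
    using fresh_chord_list[OF fin, of 1 \<sigma>] by (auto simp: length_Suc_conv)
  then obtain s s' where s: "s \<notin> ?S" "chord_sign s = endpoint_sign p * endpoint_sign q"
    and s': "s' \<notin> ?S" "chord_sign s' = - endpoint_sign p * endpoint_sign q" by metis
  have ss': "s \<noteq> s'" using s(2) s'(2) sgn by auto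
  define L1 where "L1 = L(p := [s], q := [s'])"
  have "mset (all_shells L1 w) + mset (L q) = mset (all_shells (L(p := [s])) w) + mset [s']"
    using mset_all_shells_update[OF w q, of "L(p := [s])" "[s']"] ne unfolding L1_def by simp
  moreover have "mset (all_shells (L(p := [s])) w) + mset (L p) = mset (all_shells L w) + mset [s]"
    by (rule mset_all_shells_update[OF w p])
  ultimately have "mset (all_shells L1 w) = mset (s' # s # all_shells L w)" unfolding Lpq by simp
  then have "distinct (all_shells L1 w) = distinct (s' # s # all_shells L w)"
    "set (all_shells L1 w) = set (s' # s # all_shells L w)"
    by (metis mset_eq_imp_distinct_iff, metis mset_eq_setD)
  then have "valid_shells L1 w" using L(1) s s' ss' sgn unfolding valid_shells_def by auto
  then have ok1: "valid_shells L1 ?w" using valid_shells_update[OF w i m] by simp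
  define G1 where "G1 = shelled L1 ?w"
  have ex_w: "exchange p q w = ?w" by (rule exchange_word[OF dist i wi])
  have fol_w: "followed_by w p q" by (rule followed_by_word[OF i wi])
  have h1: "potential ?w ?h" using potential_exchange[OF h dist fol_w] unfolding ex_w .
  have G1: "realizes ?w ?h \<iota> G1" unfolding G1_def
  proof (rule realizesI[OF upd(1) h1 ok1])
    fix \<gamma> assume "\<gamma> \<in> chords ?w"
    then have "\<iota> \<gamma> = height_index h \<gamma> - chord_sign \<gamma> * shell_sum L \<gamma>" using L(2) upd(2) by auto
    also have "\<dots> = height_index ?h \<gamma> - chord_sign \<gamma> * shell_sum L1 \<gamma>"
      using pq sgn Lpq unfolding height_index_def shell_sum_def L1_def
      by (cases p; cases q) (auto simp: s(2) s'(2))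
    finally show "\<iota> \<gamma> = height_index ?h \<gamma> - chord_sign \<gamma> * shell_sum L1 \<gamma>" .
  qed
  have G0i: "G0 ! i = concat (map (with_shells L) us) @ p # q # concat (map (with_shells L) vs)"
    using i wi Lpq by (simp add: G0_def shelled_def with_shells_def)
  have dist0: "distinct (concat G0)" using realizes_gauss[OF G0] by (simp add: gauss_diagram_def)
  have "exchange p q G0 = G0[i := concat (map (with_shells L) us) @ q # p # concat (map (with_shells L) vs)]"
    by (rule exchange_word[OF dist0 _ G0i]) (simp add: G0_def i)
  also have "\<dots> = shelled L ?w" unfolding shelled_update G0_def using Lpq by (simp add: with_shells_def)
  also have "\<dots> = delete_chords {s, s'} G1"
  proof -
    have "chord_of x \<notin> {s, s'}" if "x \<in> set (concat ?w)" for x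
      using that endpoint_in_gauss_diagram[OF w] s s' unfolding upd(3) by auto
    then have "delete_chords {s, s'} G1 = shelled (\<lambda>p. filter (\<lambda>c. c \<notin> {s, s'}) (L1 p)) ?w"
      unfolding G1_def by (rule delete_chords_shelled)
    also have "\<dots> = shelled L ?w"
    proof (rule shelled_cong)
      fix x assume "x \<in> set (concat ?w)"
      then have "set (L x) \<subseteq> set (all_shells L w)" unfolding upd(3) using in_all_shells by blast
      then show "filter (\<lambda>c. c \<notin> {s, s'}) (L1 x) = L x"
        using s s' Lpq unfolding L1_def by (auto intro!: filter_True)
    qed
    finally show ?thesis ..
  qed
  finally have "delete_chords {s, s'} G1 = exchange p q G0" ..
  moreover have "followed_by G0 p q" by (rule followed_by_word[OF _ G0i]) (simp add: G0_def i)
  moreover have "shell_at G1 p s" unfolding G1_def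
    by (rule shell_at_shelled[of _ _ _ _ "[]"]) (use p ne in \<open>simp_all only: upd(3) L1_def\<close>, simp)
  moreover have "shell_at G1 q s'" unfolding G1_def
    by (rule shell_at_shelled[of _ _ _ _ "[]"]) (use q in \<open>simp_all only: upd(3) L1_def\<close>, simp)
  moreover have "s \<notin> chords G0" "s' \<notin> chords G0"
    unfolding G0_def chords_shelled[OF w L(1)] using s s' by auto
  ultimately have "S2 G0 G1" unfolding S2_def using pq s(2) s'(2) by blast
  then have "G0 \<approx> G1"
    using realizes_gauss[OF G0] realizes_gauss[OF G1] by (intro r_into_equivclp) (simp add: shell_step_def)
  then have "G \<approx> G1" using realizes_unique[OF r G0] by (meson equivclp_trans)
  with G1 show ?thesis by blast
qed

lemma isomorphic_rotate_circle:
  "gauss_diagram 2 G \<Longrightarrow> i < length G \<Longrightarrow> isomorphic G (G[i := rotate k (G ! i)])"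
  unfolding isomorphic_def
proof (intro conjI exI)
  show "\<forall>j<length G. G[i := rotate k (G ! i)] ! j = rotate (if j = i then k else 0) (map (map_endpoint id) (G ! j))"
    by (auto simp: endpoint.map_id0 nth_list_update)
qed auto

lemma concat_map_rotate: "\<exists>k'. concat (map f (rotate k xs)) = rotate k' (concat (map f xs))"
proof -
  let ?t = "take (k mod length xs) xs" and ?d = "drop (k mod length xs) xs"
  have "concat (map f (rotate k xs)) = concat (map f ?d) @ concat (map f ?t)" by (simp add: rotate_drop_take)
  also have "\<dots> = rotate (length (concat (map f ?t))) (concat (map f ?t) @ concat (map f ?d))"
    by (simp only: rotate_append)
  also have "concat (map f ?t) @ concat (map f ?d) = concat (map f xs)"
    by (metis append_take_drop_id concat_append map_append)
  finally show ?thesis by blast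
qed

lemma realizes_rotate:
  assumes r: "realizes w h \<iota> G" and i: "i < length w"
  shows "\<exists>G'. realizes (w[i := rotate k (w ! i)]) h \<iota> G' \<and> G \<approx> G'"
proof -
  let ?w = "w[i := rotate k (w ! i)]"
  have w: "gauss_diagram 2 w" and h: "potential w h" using r unfolding realizes_def by auto
  have m: "mset (rotate k (w ! i)) = mset (w ! i)"
    by (simp add: rotate_drop_take) (metis append_take_drop_id mset_append add.commute)
  note upd = gauss_diagram_update[OF w i m]
  obtain L where L: "valid_shells L w" "G = shelled L w"
    "\<forall>\<gamma>\<in>chords w. \<iota> \<gamma> = height_index h \<gamma> - chord_sign \<gamma> * shell_sum L \<gamma>"
    using r unfolding realizes_def by blast
  have ok: "valid_shells L ?w" using L(1) valid_shells_update[OF w i m] by simp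
  have "level h ws" if "ws \<in> set ?w" for ws
  proof -
    have "ws = rotate k (w ! i) \<or> ws \<in> set w" using that set_update_subset_insert by fastforce
    then show ?thesis using h i unfolding potential_def by auto
  qed
  then have "potential ?w h" unfolding potential_def by blast
  then have "realizes ?w h \<iota> (shelled L ?w)" using upd L(3) ok by (intro realizesI) auto
  moreover obtain k' where "concat (map (with_shells L) (rotate k (w ! i))) = rotate k' (concat (map (with_shells L) (w ! i)))"
    using concat_map_rotate by blast
  then have "shelled L ?w = G[i := rotate k' (G ! i)]"
    unfolding shelled_update L(2) using i by (simp add: shelled_def)
  then have "isomorphic G (shelled L ?w)"
    using isomorphic_rotate_circle[OF realizes_gauss[OF r], of i] i L(2) by simp
  ultimately show ?thesis using isomorphic_S_equiv realizes_gauss r by blast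
qed

lemma realizes_move_right:
  assumes "realizes w h \<iota> G" "i < length w" "w ! i = us @ p # xs @ vs"
    and "\<And>x. x \<in> set xs \<Longrightarrow> chord_of x \<noteq> chord_of p"
  shows "\<exists>h' G'. realizes (w[i := us @ xs @ p # vs]) h' \<iota> G' \<and> G \<approx> G' \<and>
    h' p = h p + tot xs \<and> (\<forall>x\<in>set xs. h' x = h x - endpoint_sign p) \<and>
    (\<forall>x. x \<notin> insert p (set xs) \<longrightarrow> h' x = h x)"
  using assms
proof (induction xs arbitrary: w us h G)
  case Nil
  then have "w[i := us @ [] @ p # vs] = w" by (metis append_Nil list_update_id)
  with Nil(1) show ?case by (intro exI[of _ h] exI[of _ G]) simp
next
  case (Cons q xs)
  have px: "chord_of p \<noteq> chord_of q" using Cons.prems(4)[of q] by auto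
  obtain G1 where G1: "realizes (w[i := us @ q # p # xs @ vs])
      (h(p := h p + endpoint_sign q, q := h q - endpoint_sign p)) \<iota> G1" "G \<approx> G1"
    using realizes_swap[OF Cons.prems(1,2) _ px, of us "xs @ vs"] Cons.prems(3) by auto
  let ?w = "w[i := us @ q # p # xs @ vs]"
  have wi: "?w ! i = (us @ [q]) @ p # xs @ vs" using Cons.prems(2) by simp
  obtain h' G' where *: "realizes (?w[i := (us @ [q]) @ xs @ p # vs]) h' \<iota> G'" "G1 \<approx> G'"
    "h' p = (h(p := h p + endpoint_sign q, q := h q - endpoint_sign p)) p + tot xs"
    "\<forall>x\<in>set xs. h' x = (h(p := h p + endpoint_sign q, q := h q - endpoint_sign p)) x - endpoint_sign p"
    "\<forall>x. x \<notin> insert p (set xs) \<longrightarrow> h' x = (h(p := h p + endpoint_sign q, q := h q - endpoint_sign p)) x"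
    using Cons.IH[OF G1(1) _ wi] Cons.prems(2,4) by auto
  have "distinct (w ! i)" using Cons.prems(1,2) gauss_diagram_distinct_nth
    unfolding realizes_def gauss_diagram_def by (metis distinct_concat_iff nth_mem)
  then have d: "q \<notin> set xs" "p \<notin> set xs" "p \<noteq> q" unfolding Cons.prems(3) by auto
  have "?w[i := (us @ [q]) @ xs @ p # vs] = w[i := us @ (q # xs) @ p # vs]" by simp
  moreover have "G \<approx> G'" using G1(2) *(2) by (rule equivclp_trans)
  moreover have "h' p = h p + tot (q # xs)" using *(3) d by simp
  moreover have "\<forall>x\<in>set (q # xs). h' x = h x - endpoint_sign p" using *(4,5) d by auto
  moreover have "\<forall>x. x \<notin> insert p (set (q # xs)) \<longrightarrow> h' x = h x" using *(5) by auto
  ultimately show ?case using *(1) by (intro exI[of _ h'] exI[of _ G']) simp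
qed

lemma rotate_back: "\<exists>m. rotate m (rotate k xs) = xs"
  using rotate_append[of "drop (k mod length xs) xs" "take (k mod length xs) xs"]
  by (metis append_take_drop_id rotate_drop_take)

text \<open>
  The endpoint \<open>p\<close> is moved once around its circle.  It passes every other endpoint, which lowers
  their heights by its sign, and its own height changes by the sum of the other signs, which is
  minus its own sign.  The assumption says that \<open>p\<close> does not meet the other end of its chord.
\<close>

lemma realizes_shift_unit:
  assumes r: "realizes w h \<iota> G" and i: "i < length w" and p: "p \<in> set (w ! i)"
    and single: "\<And>x. x \<in> set (w ! i) \<Longrightarrow> chord_of x = chord_of p \<Longrightarrow> x = p"
  shows "\<exists>G'. realizes w (\<lambda>x. if x \<in> set (w ! i) then h x - endpoint_sign p else h x) \<iota> G' \<and> G \<approx> G'"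
proof -
  have w: "gauss_diagram 2 w" and h: "potential w h" using r unfolding realizes_def by auto
  obtain k xs where k: "rotate k (w ! i) = p # xs" using rotate_to_front[OF p] by blast
  have dist: "distinct (p # xs)" using w i k
    by (metis distinct_concat_iff distinct_rotate gauss_diagram_def nth_mem)
  have set: "set (w ! i) = set (p # xs)" using k by (metis set_rotate)
  obtain G1 where G1: "realizes (w[i := p # xs]) h \<iota> G1" "G \<approx> G1"
    using realizes_rotate[OF r i, of k] k by auto
  let ?w = "w[i := p # xs]"
  have "chord_of x \<noteq> chord_of p" if "x \<in> set xs" for x
    using single[of x] that dist set by auto
  then obtain h' G2 where 2: "realizes (?w[i := [] @ xs @ p # []]) h' \<iota> G2" "G1 \<approx> G2"
    "h' p = h p + tot xs" "\<forall>x\<in>set xs. h' x = h x - endpoint_sign p"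
    "\<forall>x. x \<notin> insert p (set xs) \<longrightarrow> h' x = h x"
    using realizes_move_right[OF G1(1), of i "[]" p xs "[]"] i by auto
  have "rotate (1 + k) (w ! i) = xs @ [p]" using k by simp
  then obtain m where m: "rotate m (xs @ [p]) = w ! i" using rotate_back[of "1 + k" "w ! i"] by metis
  have w2: "?w[i := [] @ xs @ p # []] = w[i := xs @ [p]]" by simp
  obtain G3 where 3: "realizes w h' \<iota> G3" "G2 \<approx> G3"
    using realizes_rotate[OF 2(1)[unfolded w2], of i m] i m by auto
  have "tot (p # xs) = 0" using h i k unfolding potential_def level_def by (metis nth_mem tot_rotate)
  then have "h' p = h p - endpoint_sign p" using 2(3) by simp
  then have "h' = (\<lambda>x. if x \<in> set (w ! i) then h x - endpoint_sign p else h x)"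
    using 2(4,5) unfolding set by (intro ext) auto
  moreover have "G \<approx> G3" using G1(2) 2(2) 3(2) by (meson equivclp_trans)
  ultimately show ?thesis using 3(1) by blast
qed

text \<open>
  Raising the heights on the first circle is enough: raising them on both circles changes no
  index.
\<close>

definition shift_circle :: "diagram \<Rightarrow> int \<Rightarrow> (chord endpoint \<Rightarrow> int) \<Rightarrow> chord endpoint \<Rightarrow> int" where
  "shift_circle w k h x = (if x \<in> set (w ! 0) then h x + k else h x)"

lemma shift_circle_add: "shift_circle w k (shift_circle w l h) = shift_circle w (k + l) h"
  by (auto simp: shift_circle_def)

lemma potential_shift_circle:
  assumes w: "gauss_diagram 2 w" and h: "potential w h"
  shows "potential w (shift_circle w k h)"
proof -
  have len: "length w = 2" and d: "distinct (concat w)" using w by (auto simp: gauss_diagram_def)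
  obtain h' where h': "potential w h'" "\<And>i x. i < 2 \<Longrightarrow> x \<in> set (w ! i) \<Longrightarrow> h' x = h x + (if i = 0 then k else 0)"
    using potential_shift[OF h d, of "\<lambda>i. if i = 0 then k else 0"] len by auto
  have eq: "shift_circle w k h x = h' x" if "i < 2" "x \<in> set (w ! i)" for i x
    using that h'(2)[OF that] gauss_diagram_same_index[OF w, of 0 i x] by (auto simp: shift_circle_def)
  show ?thesis unfolding potential_def all_set_conv_all_nth len
  proof (intro allI impI)
    fix i :: nat assume "i < 2"
    then have "level h' (w ! i)" using h'(1) len unfolding potential_def by auto
    then show "level (shift_circle w k h) (w ! i)" using level_cong[of "w ! i" "shift_circle w k h" h'] eq[OF \<open>i < 2\<close>] by blast
  qed
qed

text \<open>
  A nonself-chord provides an endpoint \<open>p\<close> that can be moved around the first circle, which shifts the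
  heights by one.  For the opposite direction, the shift is applied to a realization of the
  shifted heights.
\<close>

lemma realizes_shift:
  assumes r: "realizes w h \<iota> G" and c: "c \<in> chords_of_type w 0 1 \<union> chords_of_type w 1 0"
  shows "\<exists>G'. realizes w (shift_circle w k h) \<iota> G' \<and> G \<approx> G'"
proof -
  have w: "gauss_diagram 2 w" and h: "potential w h" using r unfolding realizes_def by auto
  have len: "length w = 2" using w by (auto simp: gauss_diagram_def)
  obtain p q where pq: "p \<in> set (w ! 0)" "q \<in> set (w ! 1)" "{p, q} = {Ini c, Ter c}"
    using c unfolding chords_of_type_def by blast
  have single: "x = p" if "x \<in> set (w ! 0)" "chord_of x = chord_of p" for x
  proof -
    have "chord_of p = c" using pq(3) by (auto simp: doubleton_eq_iff)
    then have "x \<in> {p, q}" using that(2) unfolding pq(3) by (cases x) auto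
    then show ?thesis using pq(2) that(1) gauss_diagram_same_index[OF w, of 0 1 x] by auto
  qed
  have "p \<in> set (concat w)" using pq(1) len in_concat_nth[of p w] by auto
  then have sp: "endpoint_sign p = 1 \<or> endpoint_sign p = -1" by (rule endpoint_sign_in_gauss_diagram[OF w])
  have down: "\<exists>G'. realizes w (shift_circle w (- endpoint_sign p) h) \<iota> G' \<and> G \<approx> G'"
    if "realizes w h \<iota> G" for h G
  proof -
    have "shift_circle w (- endpoint_sign p) h = (\<lambda>x. if x \<in> set (w ! 0) then h x - endpoint_sign p else h x)"
      by (auto simp: shift_circle_def)
    moreover have "\<exists>G'. realizes w (\<lambda>x. if x \<in> set (w ! 0) then h x - endpoint_sign p else h x) \<iota> G' \<and> G \<approx> G'"
      by (rule realizes_shift_unit[OF that _ pq(1)]) (use len in simp, rule single)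
    ultimately show ?thesis by simp
  qed
  have up: "\<exists>G'. realizes w (shift_circle w (endpoint_sign p) h) \<iota> G' \<and> G \<approx> G'"
    if "realizes w h \<iota> G" for h G
  proof -
    have "potential w h" using that unfolding realizes_def by blast
    then obtain G1 where G1: "realizes w (shift_circle w (endpoint_sign p) h) \<iota> G1"
      using realizes_exists[OF w potential_shift_circle[OF w]] by blast
    obtain G2 where "realizes w (shift_circle w (- endpoint_sign p) (shift_circle w (endpoint_sign p) h)) \<iota> G2" "G1 \<approx> G2"
      using down[OF G1] by blast
    moreover have "shift_circle w 0 h = h" by (auto simp: shift_circle_def)
    ultimately have "realizes w h \<iota> G2" by (simp add: shift_circle_add)
    from realizes_unique[OF that this] \<open>G1 \<approx> G2\<close> have "G \<approx> G1" by (meson equivclp_sym equivclp_trans)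
    with G1 show ?thesis by blast
  qed
  have unit: "\<exists>G'. realizes w (shift_circle w \<sigma> h) \<iota> G' \<and> G \<approx> G'"
    if "realizes w h \<iota> G" "\<sigma> = 1 \<or> \<sigma> = -1" for h G \<sigma>
  proof -
    have "\<sigma> = endpoint_sign p \<or> \<sigma> = - endpoint_sign p" using that(2) sp by auto
    then show ?thesis
    proof
      assume "\<sigma> = endpoint_sign p"
      then show ?thesis using up[OF that(1)] by simp
    next
      assume "\<sigma> = - endpoint_sign p"
      then show ?thesis using down[OF that(1)] by simp
    qed
  qed
  have many: "\<exists>G'. realizes w (shift_circle w (int n * \<sigma>) h) \<iota> G' \<and> G \<approx> G'" if sg: "\<sigma> = 1 \<or> \<sigma> = -1" for n \<sigma>
  proof (induction n)
    case 0
    have "shift_circle w 0 h = h" by (auto simp: shift_circle_def)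
    then show ?case using r by auto
  next
    case (Suc n)
    then obtain G1 where 1: "realizes w (shift_circle w (int n * \<sigma>) h) \<iota> G1" "G \<approx> G1" by blast
    obtain G2 where "realizes w (shift_circle w \<sigma> (shift_circle w (int n * \<sigma>) h)) \<iota> G2" "G1 \<approx> G2"
      using unit[OF 1(1) sg] by blast
    moreover have "shift_circle w \<sigma> (shift_circle w (int n * \<sigma>) h) = shift_circle w (int (Suc n) * \<sigma>) h"
      unfolding shift_circle_add by (simp add: algebra_simps)
    moreover from 1(2) \<open>G1 \<approx> G2\<close> have "G \<approx> G2" by (rule equivclp_trans)
    ultimately show ?case by auto
  qed
  show ?thesis
  proof (cases "k \<ge> 0")
    case True
    then show ?thesis using many[of 1 "nat k"] by simp
  next
    case False
    then show ?thesis using many[of "-1" "nat (- k)"] by simp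
  qed
qed

text \<open>
  The two potentials differ by a constant on each circle.  If there is a nonself-chord, then
  the first one can be shifted to the second one; otherwise all indices are
  differences of heights on one circle, and the constants do not matter.
\<close>

lemma realizes_same_indices:
  assumes r: "realizes w h \<iota> G" and r': "realizes w h' \<iota> G'"
  shows "G \<approx> G'"
proof -
  have w: "gauss_diagram 2 w" and h: "potential w h" "potential w h'" using r r' unfolding realizes_def by auto
  have len: "length w = 2" using w by (auto simp: gauss_diagram_def)
  obtain d where d: "\<And>i x. i < 2 \<Longrightarrow> x \<in> set (w ! i) \<Longrightarrow> h' x = h x + d i"
    using potential_unique[OF h] len by auto
  have ends: "\<exists>i<2. \<exists>j<2. Ini \<gamma> \<in> set (w ! i) \<and> Ter \<gamma> \<in> set (w ! j)" if "\<gamma> \<in> chords w" for \<gamma>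
  proof -
    have "Ini \<gamma> \<in> set (concat w)" "Ter \<gamma> \<in> set (concat w)"
      using that endpoint_in_gauss_diagram[OF w] by auto
    then show ?thesis unfolding in_concat_nth len by blast
  qed
  show ?thesis
  proof (cases "\<exists>c. c \<in> chords_of_type w 0 1 \<union> chords_of_type w 1 0")
    case True
    then obtain G1 where G1: "realizes w (shift_circle w (d 0 - d 1) h) \<iota> G1" "G \<approx> G1"
      using realizes_shift[OF r] by blast
    have sh: "h' x = shift_circle w (d 0 - d 1) h x + d 1" if "i < 2" "x \<in> set (w ! i)" for i x
    proof (cases "i = 0")
      case True
      then show ?thesis using d[OF that] that by (simp add: shift_circle_def)
    next
      case False
      then have "i = 1" "x \<notin> set (w ! 0)" using that gauss_diagram_same_index[OF w, of 0 i x] by auto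
      then show ?thesis using d[OF that] by (simp add: shift_circle_def)
    qed
    have "realizes w h' \<iota> G1"
      by (rule realizes_change_heights[OF G1(1) h(2)])
        (use ends sh in \<open>fastforce simp: height_index_def\<close>)
    from realizes_unique[OF this r'] G1(2) show ?thesis by (meson equivclp_trans)
  next
    case False
    have "realizes w h' \<iota> G"
    proof (rule realizes_change_heights[OF r h(2)])
      fix \<gamma> assume "\<gamma> \<in> chords w"
      then obtain i j where ij: "i < 2" "j < 2" "Ini \<gamma> \<in> set (w ! i)" "Ter \<gamma> \<in> set (w ! j)" using ends by blast
      then have "i = j" using False unfolding chords_of_type_def by (auto simp: less_2_cases_iff)
      then show "height_index h' \<gamma> = height_index h \<gamma>"
        using d[OF ij(1,3)] d[OF ij(2,4)] by (simp add: height_index_def)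
    qed
    from realizes_unique[OF this r'] show ?thesis .
  qed
qed

text \<open>
  The word \<open>w\<close> can be turned into \<open>w'\<close> whatever indices are prescribed; the heights adapt.
\<close>

definition rearranges :: "diagram \<Rightarrow> diagram \<Rightarrow> bool" where
  "rearranges w w' \<longleftrightarrow> (\<forall>h \<iota> G. realizes w h \<iota> G \<longrightarrow> (\<exists>h' G'. realizes w' h' \<iota> G' \<and> G \<approx> G'))"

lemma rearranges_refl: "rearranges w w"
  unfolding rearranges_def by (blast intro: equivclp_refl)

lemma rearranges_trans: "rearranges u v \<Longrightarrow> rearranges v w \<Longrightarrow> rearranges u w"
  unfolding rearranges_def by (blast intro: equivclp_trans)

lemma rearranges_rotate: "i < length w \<Longrightarrow> rearranges w (w[i := rotate k (w ! i)])"
  unfolding rearranges_def using realizes_rotate by blast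

lemma rearranges_past:
  assumes i: "i < length w" and wi: "w ! i = us @ p # xs @ vs"
    and "\<And>x. x \<in> set xs \<Longrightarrow> chord_of x \<noteq> chord_of p"
  shows "rearranges w (w[i := us @ xs @ p # vs])"
  unfolding rearranges_def
proof (intro allI impI)
  fix h \<iota> G assume "realizes w h \<iota> G"
  from realizes_move_right[OF this i wi assms(3)]
  show "\<exists>h' G'. realizes (w[i := us @ xs @ p # vs]) h' \<iota> G' \<and> G \<approx> G'" by blast
qed

text \<open>
  Two endpoints of the same chord may not be exchanged directly; one of them is moved around the
  whole circle instead.
\<close>

lemma rearranges_swap:
  assumes i: "i < length w"
  shows "rearranges (w[i := us @ p # q # vs]) (w[i := us @ q # p # vs])"
proof (cases "gauss_diagram 2 (w[i := us @ p # q # vs])")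
  case False
  then show ?thesis unfolding rearranges_def realizes_def by blast
next
  case True
  let ?w = "\<lambda>ws. w[i := ws]"
  have d: "distinct (us @ p # q # vs)" using True i
    unfolding gauss_diagram_def by (metis distinct_concat_iff length_list_update nth_list_update_eq nth_mem)
  show ?thesis
  proof (cases "chord_of p = chord_of q")
    case False
    then show ?thesis using rearranges_past[of i "?w (us @ p # q # vs)" us p "[q]" vs] i by auto
  next
    case same: True
    have other: "chord_of x \<noteq> chord_of q" if "x \<in> set (vs @ us)" for x
    proof
      have x: "x \<noteq> p" "x \<noteq> q" "p \<noteq> q" using that d by auto
      assume "chord_of x = chord_of q"
      with x same show False by (cases x; cases p; cases q) auto
    qed
    have "rearranges (?w (us @ p # q # vs)) (?w (q # vs @ us @ [p]))"
      using rearranges_rotate[of i "?w (us @ p # q # vs)" "length (us @ [p])"]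
        rotate_append[of "us @ [p]" "q # vs"] i by simp
    moreover have "rearranges (?w (q # vs @ us @ [p])) (?w ((vs @ us) @ q # [p]))"
      using rearranges_past[of i "?w (q # vs @ us @ [p])" "[]" q "vs @ us" "[p]"] i other by simp
    moreover have "rearranges (?w ((vs @ us) @ q # [p])) (?w (us @ q # p # vs))"
      using rearranges_rotate[of i "?w ((vs @ us) @ q # [p])" "length vs"]
        rotate_append[of vs "us @ [q, p]"] i by simp
    ultimately show ?thesis using rearranges_trans by blast
  qed
qed

lemma rearranges_to_front:
  "i < length w \<Longrightarrow> rearranges (w[i := us @ xs @ p # vs]) (w[i := us @ p # xs @ vs])"
proof (induction xs arbitrary: us vs rule: rev_induct)
  case Nil
  then show ?case by (simp add: rearranges_refl)
next
  case (snoc x xs)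
  have "rearranges (w[i := us @ (xs @ [x]) @ p # vs]) (w[i := us @ xs @ p # x # vs])"
    using rearranges_swap[OF snoc.prems, of "us @ xs" x p vs] by simp
  moreover have "rearranges (w[i := us @ xs @ p # x # vs]) (w[i := us @ p # xs @ x # vs])"
    by (rule snoc.IH[OF snoc.prems])
  ultimately show ?case using rearranges_trans by fastforce
qed

lemma rearranges_permute:
  "i < length w \<Longrightarrow> mset xs = mset ys \<Longrightarrow> rearranges (w[i := us @ xs]) (w[i := us @ ys])"
proof (induction ys arbitrary: us xs)
  case Nil
  then show ?case by (simp add: rearranges_refl)
next
  case (Cons y ys)
  have "y \<in> set xs" using Cons.prems(2) by (metis list.set_intros(1) mset_eq_setD)
  then obtain as bs where xs: "xs = as @ y # bs" by (meson split_list)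
  have "rearranges (w[i := us @ xs]) (w[i := us @ y # as @ bs])"
    unfolding xs by (rule rearranges_to_front[OF Cons.prems(1)])
  moreover have "rearranges (w[i := (us @ [y]) @ as @ bs]) (w[i := (us @ [y]) @ ys])"
    using Cons.prems unfolding xs by (intro Cons.IH) auto
  ultimately show ?case using rearranges_trans by fastforce
qed


section \<open>Sets of chords with prescribed placement and index\<close>

fun circle_of :: "(chord \<Rightarrow> nat \<times> nat) \<Rightarrow> chord endpoint \<Rightarrow> nat" where
  "circle_of \<tau> (Ini \<gamma>) = fst (\<tau> \<gamma>)"
| "circle_of \<tau> (Ter \<gamma>) = snd (\<tau> \<gamma>)"

definition proper :: "chord set \<Rightarrow> (chord \<Rightarrow> nat \<times> nat) \<Rightarrow> bool" where
  "proper A \<tau> \<longleftrightarrow> finite A \<and> (\<forall>\<gamma>\<in>A. chord_sign \<gamma> \<in> {1, -1} \<and> fst (\<tau> \<gamma>) < 2 \<and> snd (\<tau> \<gamma>) < 2)"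

definition arrangement :: "chord set \<Rightarrow> (chord \<Rightarrow> nat \<times> nat) \<Rightarrow> diagram \<Rightarrow> bool" where
  "arrangement A \<tau> w \<longleftrightarrow> length w = 2 \<and>
     (\<forall>i<2. distinct (w ! i) \<and> set (w ! i) = {p. chord_of p \<in> A \<and> circle_of \<tau> p = i})"

text \<open>
  The order of the endpoints is left open, as it does not matter by \<open>realizes_same_indices\<close>
  and \<open>rearranges\<close>.
\<close>

definition realization :: "chord set \<Rightarrow> (chord \<Rightarrow> nat \<times> nat) \<Rightarrow> (chord \<Rightarrow> int) \<Rightarrow> diagram \<Rightarrow> bool" where
  "realization A \<tau> \<iota> G \<longleftrightarrow> proper A \<tau> \<and> (\<exists>w h. arrangement A \<tau> w \<and> realizes w h \<iota> G)"

text \<open>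
  By the uniqueness of realizations it does not matter whether this is required of some or of all
  realizations.  That there are some makes the relation transitive.
\<close>

definition equivalent :: "(chord \<Rightarrow> nat \<times> nat) \<Rightarrow> (chord \<Rightarrow> int) \<Rightarrow> chord set \<Rightarrow> chord set \<Rightarrow> bool" where
  "equivalent \<tau> \<iota> A B \<longleftrightarrow> (\<exists>G G'. realization A \<tau> \<iota> G \<and> realization B \<tau> \<iota> G' \<and> G \<approx> G')"

lemma distinct_concat_nth:
  "(\<And>i. i < length w \<Longrightarrow> distinct (w ! i)) \<Longrightarrow>
   (\<And>i j. i < length w \<Longrightarrow> j < length w \<Longrightarrow> i \<noteq> j \<Longrightarrow> set (w ! i) \<inter> set (w ! j) = {}) \<Longrightarrow> distinct (concat w)"
proof (induction w)
  case (Cons a w)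
  have "distinct (concat w)"
  proof (rule Cons.IH)
    show "distinct (w ! i)" if "i < length w" for i using Cons.prems(1)[of "Suc i"] that by simp
    show "set (w ! i) \<inter> set (w ! j) = {}" if "i < length w" "j < length w" "i \<noteq> j" for i j
      using Cons.prems(2)[of "Suc i" "Suc j"] that by simp
  qed
  moreover have "set a \<inter> set (concat w) = {}"
  proof -
    have "set a \<inter> set (w ! i) = {}" if "i < length w" for i using Cons.prems(2)[of 0 "Suc i"] that by simp
    then show ?thesis unfolding set_concat by (metis (no_types, lifting) UN_E disjoint_iff in_set_conv_nth)
  qed
  moreover have "distinct a" using Cons.prems(1)[of 0] by simp
  ultimately show ?case by simp
qed simp

lemma arrangement_in_concat:
  assumes "proper A \<tau>" "arrangement A \<tau> w"
  shows "p \<in> set (concat w) \<longleftrightarrow> chord_of p \<in> A"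
proof -
  have "circle_of \<tau> p < 2" if "chord_of p \<in> A"
    using assms(1) that unfolding proper_def by (cases p) auto
  then show ?thesis using assms(2) unfolding arrangement_def in_concat_nth by auto
qed

lemma arrangement_gauss:
  assumes A: "proper A \<tau>" and w: "arrangement A \<tau> w"
  shows "gauss_diagram 2 w" and "chords w = A"
proof -
  have "distinct (concat w)"
    by (rule distinct_concat_nth) (use w in \<open>auto simp: arrangement_def\<close>)
  then show "gauss_diagram 2 w"
    using A w arrangement_in_concat[OF A w] unfolding gauss_diagram_def
    by (auto simp: arrangement_def proper_def simp del: set_concat)
  show "chords w = A" using arrangement_in_concat[OF A w] unfolding chords_def by auto
qed

lemma arrangement_rearranges:
  assumes "arrangement A \<tau> w" "arrangement A \<tau> w'"
  shows "rearranges w w'"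
proof -
  obtain X Y X' Y' where w: "w = [X, Y]" "w' = [X', Y']"
    using assms unfolding arrangement_def by (auto simp: length_Suc_conv numeral_2_eq_2)
  have "mset (w ! i) = mset (w' ! i)" if "i < 2" for i
    using assms that unfolding arrangement_def by (simp add: set_eq_iff_mset_eq_distinct[symmetric])
  from this[of 0] this[of 1] have m: "mset X = mset X'" "mset Y = mset Y'" unfolding w by auto
  have "rearranges [X, Y] [X', Y]" using rearranges_permute[of 0 "[X, Y]" X X' "[]"] m by simp
  moreover have "rearranges [X', Y] [X', Y']" using rearranges_permute[of 1 "[X', Y]" Y Y' "[]"] m by simp
  ultimately show ?thesis unfolding w by (rule rearranges_trans)
qed

text \<open>
  One underlying diagram is rearranged into the other one; the heights obtained in this way are
  compared by \<open>realizes_same_indices\<close>.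
\<close>

lemma realization_unique:
  assumes "realization A \<tau> \<iota> G" "realization A \<tau> \<iota> G'"
  shows "G \<approx> G'"
proof -
  obtain w h w' h' where w: "arrangement A \<tau> w" "realizes w h \<iota> G"
    and w': "arrangement A \<tau> w'" "realizes w' h' \<iota> G'"
    using assms unfolding realization_def by blast
  obtain h1 G1 where G1: "realizes w' h1 \<iota> G1" "G \<approx> G1"
    using arrangement_rearranges[OF w(1) w'(1)] w(2) unfolding rearranges_def by blast
  show ?thesis using G1(2) realizes_same_indices[OF G1(1) w'(2)] by (rule equivclp_trans)
qed

lemma equivalent_trans:
  assumes "equivalent \<tau> \<iota> A B" "equivalent \<tau> \<iota> B C" shows "equivalent \<tau> \<iota> A C"
proof -
  obtain G1 G2 G3 G4 where "realization A \<tau> \<iota> G1" "realization B \<tau> \<iota> G2" "G1 \<approx> G2"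
    "realization B \<tau> \<iota> G3" "realization C \<tau> \<iota> G4" "G3 \<approx> G4"
    using assms unfolding equivalent_def by blast
  moreover from this have "G2 \<approx> G3" by (intro realization_unique)
  ultimately have "G1 \<approx> G4" by (meson equivclp_trans)
  with \<open>realization A \<tau> \<iota> G1\<close> \<open>realization C \<tau> \<iota> G4\<close> show ?thesis unfolding equivalent_def by blast
qed

lemma equivalent_sym: "equivalent \<tau> \<iota> A B \<Longrightarrow> equivalent \<tau> \<iota> B A"
  unfolding equivalent_def by (meson equivclp_sym)

lemma equivalent_real_diagram: "equivalent \<tau> \<iota> A B \<Longrightarrow> \<exists>G. realization A \<tau> \<iota> G"
  unfolding equivalent_def by blast

lemma equivalent_refl: "realization A \<tau> \<iota> G \<Longrightarrow> equivalent \<tau> \<iota> A A"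
  unfolding equivalent_def by (blast intro: equivclp_refl)

lemma realization_cong:
  assumes "realization A \<tau> \<iota> G" and eq: "\<And>\<gamma>. \<gamma> \<in> A \<Longrightarrow> \<tau>' \<gamma> = \<tau> \<gamma> \<and> \<iota>' \<gamma> = \<iota> \<gamma>"
  shows "realization A \<tau>' \<iota>' G"
proof -
  obtain w h where w: "proper A \<tau>" "arrangement A \<tau> w" "realizes w h \<iota> G"
    using assms(1) unfolding realization_def by blast
  have "proper A \<tau>'" using w(1) eq unfolding proper_def by auto
  moreover have "circle_of \<tau>' p = circle_of \<tau> p" if "chord_of p \<in> A" for p
    using eq[OF that] by (cases p) auto
  then have "arrangement A \<tau>' w" using w(2) unfolding arrangement_def by auto
  moreover have "realizes w h \<iota>' G"
    using w(3) eq arrangement_gauss(2)[OF w(1,2)] unfolding realizes_def by simp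
  ultimately show ?thesis unfolding realization_def by blast
qed

lemma equivalent_cong:
  assumes "equivalent \<tau> \<iota> A B" "\<And>\<gamma>. \<gamma> \<in> A \<union> B \<Longrightarrow> \<tau>' \<gamma> = \<tau> \<gamma> \<and> \<iota>' \<gamma> = \<iota> \<gamma>"
  shows "equivalent \<tau>' \<iota>' A B"
  using assms realization_cong[of A \<tau> \<iota> _ \<tau>' \<iota>'] realization_cong[of B \<tau> \<iota> _ \<tau>' \<iota>']
  unfolding equivalent_def by blast

text \<open>Shells adjust the indices as required, and a balanced diagram has heights.\<close>

lemma realization_exists:
  assumes "proper A \<tau>" "arrangement A \<tau> w" "balanced w"
  shows "\<exists>G. realization A \<tau> \<iota> G"
proof -
  obtain h where "potential w h"
    using balanced_potential[OF arrangement_gauss(1)[OF assms(1,2)] assms(3)] by blast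
  then obtain G where "realizes w h \<iota> G"
    using realizes_exists[OF arrangement_gauss(1)[OF assms(1,2)]] by blast
  then show ?thesis using assms unfolding realization_def by blast
qed

lemma realization_arrangement:
  assumes "realization A \<tau> \<iota> G"
  obtains w where "proper A \<tau>" "arrangement A \<tau> w" "balanced w"
  using assms potential_balanced unfolding realization_def realizes_def by blast

lemma potential_base:
  assumes "gauss_diagram 2 w" "balanced w"
  obtains h where "potential w h" "\<And>i. i < 2 \<Longrightarrow> climbs h 0 (w ! i)"
  using potential_exists[of w] assms unfolding gauss_diagram_def balanced_def by auto


text \<open>
  The chords in \<open>S\<close> get no shells, so deleting them commutes with the insertion of the shells of the
  other chords.
\<close>

lemma realize_bare:
  assumes w: "gauss_diagram 2 w" and h: "potential w h" "potential (delete_chords S w) h"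
    and S: "S \<subseteq> chords w" "\<And>\<gamma>. \<gamma> \<in> S \<Longrightarrow> height_index h \<gamma> = \<iota> \<gamma>"
  obtains L where "realizes w h \<iota> (shelled L w)"
    and "realizes (delete_chords S w) h \<iota> (delete_chords S (shelled L w))"
    and "\<And>p. chord_of p \<in> S \<Longrightarrow> L p = []"
proof -
  let ?w = "delete_chords S w"
  obtain L where L: "valid_shells L w" "\<forall>\<gamma>\<in>chords w. \<iota> \<gamma> = height_index h \<gamma> - chord_sign \<gamma> * shell_sum L \<gamma>"
    "\<forall>p. p \<noteq> Ini (chord_of p) \<or> p \<notin> set (concat w) \<or> height_index h (chord_of p) = \<iota> (chord_of p) \<longrightarrow> L p = []"
    using realizing_shells[OF w finite.emptyI, of Ini \<iota> h] by blast
  have bare: "L p = []" if "chord_of p \<in> S" for p using L(3) S(2)[OF that] by blast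
  have chords_w: "chords ?w = chords w - S"
    unfolding chords_def concat_delete_chords by auto
  have "concat (map L (filter (\<lambda>p. chord_of p \<notin> S) es)) = concat (map L es)" for es
    using bare by (induction es) auto
  then have "all_shells L ?w = all_shells L w" unfolding all_shells_def concat_delete_chords .
  then have ok: "valid_shells L ?w" using L(1) unfolding valid_shells_def chords_w by auto
  have with_shells: "filter (\<lambda>x. chord_of x \<notin> S) (with_shells L p) = (if chord_of p \<in> S then [] else with_shells L p)"
    if p: "p \<in> set (concat w)" for p
  proof (cases "chord_of p \<in> S")
    case True
    then show ?thesis using bare by (simp add: with_shells_def)
  next
    case False
    have "filter (\<lambda>c. c \<notin> S) (L p) = L p"
      using valid_shells_disjoint(3)[OF w L(1) p] S(1) by (intro filter_True) blast
    then show ?thesis using filter_with_shells[OF False, of L] False by (simp add: with_shells_def)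
  qed
  have "filter (\<lambda>x. chord_of x \<notin> S) (concat (map (with_shells L) ws)) =
      concat (map (with_shells L) (filter (\<lambda>x. chord_of x \<notin> S) ws))" if "set ws \<subseteq> set (concat w)" for ws
    using that by (induction ws) (auto simp: with_shells simp del: set_concat)
  then have "delete_chords S (shelled L w) = shelled L ?w"
    unfolding delete_chords_def shelled_def by fastforce
  moreover have "realizes ?w h \<iota> (shelled L ?w)"
    using L(2) ok h(2) gauss_diagram_delete[OF w] unfolding chords_w[symmetric]
    by (intro realizesI) (auto simp: chords_w)
  moreover have "realizes w h \<iota> (shelled L w)" using L w h by (intro realizesI) auto
  ultimately show ?thesis using that bare by metis
qed

lemma followed_by_bare:
  assumes "i < length w" "w ! i = us @ x # y # vs" "L x = []" "L y = []"
  shows "followed_by (shelled L w) x y"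
proof -
  have "shelled L w ! i = concat (map (with_shells L) us) @ x # y # concat (map (with_shells L) vs)"
    using assms by (simp add: shelled_def with_shells_def)
  then show ?thesis using assms(1) followed_by_word by (metis length_shelled)
qed

lemma arrangement_delete:
  assumes "proper A \<tau>" "arrangement A \<tau> w" "B \<subseteq> A"
  shows "arrangement B \<tau> (delete_chords (A - B) w)"
  using assms(2,3) unfolding arrangement_def delete_chords_def by auto

lemma proper_subset: "proper A \<tau> \<Longrightarrow> B \<subseteq> A \<Longrightarrow> proper B \<tau>"
  unfolding proper_def using finite_subset by blast

lemma balanced_nth: "length w = 2 \<Longrightarrow> balanced w \<longleftrightarrow> tot (w ! 0) = 0 \<and> tot (w ! 1) = 0"
  unfolding balanced_def all_set_conv_all_nth by (simp add: less_2_cases_iff all_conj_distrib)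

lemma insert_self_chord_word:
  assumes A: "proper A \<tau>" "arrangement A \<tau> w" "balanced w"
    and d: "d \<notin> A" "\<tau> d = (i, i)" "i < 2" "chord_sign d \<in> {1, -1}"
  shows "proper (insert d A) \<tau>"
    and "arrangement (insert d A) \<tau> (w[i := Ini d # Ter d # w ! i])" (is "arrangement _ _ ?w")
    and "balanced (w[i := Ini d # Ter d # w ! i])"
proof -
  have len: "length w = 2" using A(2) by (simp add: arrangement_def)
  show "proper (insert d A) \<tau>" using A(1) d unfolding proper_def by auto
  have notin: "Ini d \<notin> set (w ! i)" "Ter d \<notin> set (w ! i)" using A(2) d unfolding arrangement_def by auto
  have "distinct (?w ! j)" if "j < 2" for j
  proof -
    have "distinct (w ! j)" using A(2) that unfolding arrangement_def by blast
    then show ?thesis using notin len that by (cases "j = i") auto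
  qed
  moreover have "set (?w ! j) = {p. chord_of p \<in> insert d A \<and> circle_of \<tau> p = j}" if "j < 2" for j
  proof -
    have s: "set (w ! j) = {p. chord_of p \<in> A \<and> circle_of \<tau> p = j}" using A(2) that unfolding arrangement_def by blast
    show ?thesis
    proof (intro set_eqI)
      fix p show "p \<in> set (?w ! j) \<longleftrightarrow> p \<in> {p. chord_of p \<in> insert d A \<and> circle_of \<tau> p = j}"
        using s d len that by (cases p) (auto simp: nth_list_update)
    qed
  qed
  ultimately show "arrangement (insert d A) \<tau> ?w"
    using len unfolding arrangement_def by simp
  show "balanced ?w" using A(3) len d(3) unfolding balanced_nth[OF len]
    by (auto simp: balanced_nth nth_list_update less_2_cases_iff)
qed

text \<open>A self-chord of index \<open>0\<close> may be isolated by a rearrangement, and then deleted by R1.\<close>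

lemma equivalent_insert_index_0:
  assumes r: "realization A \<tau> \<iota> G"
    and d: "d \<notin> A" "\<tau> d = (i, i)" "i < 2" "chord_sign d \<in> {1, -1}" "\<iota> d = 0"
  shows "equivalent \<tau> \<iota> (insert d A) A"
proof -
  obtain w where w: "proper A \<tau>" "arrangement A \<tau> w" "balanced w" using realization_arrangement[OF r] .
  let ?w = "w[i := Ini d # Ter d # w ! i]"
  note ins = insert_self_chord_word[OF w d(1-4)]
  have len: "length w = 2" "i < length ?w" "?w ! i = [] @ Ini d # Ter d # w ! i"
    using w(2) d(3) by (simp_all add: arrangement_def)
  have gauss: "gauss_diagram 2 ?w" "chords ?w = insert d A" using arrangement_gauss[OF ins(1,2)] by auto
  have dist: "distinct (concat ?w)" using gauss by (simp add: gauss_diagram_def)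
  obtain h where h: "potential ?w h" using balanced_potential[OF gauss(1) ins(3)] by blast
  have fol: "followed_by ?w (Ini d) (Ter d)" using followed_by_word len(2,3) by blast
  have "potential (delete_chords {d} ?w) h"
    unfolding delete_chords_eq_remove endpoints_of_chord
    by (rule potential_remove_followed_by[OF h dist fol]) simp
  moreover have "height_index h d = \<iota> d"
    using potential_followed_by[OF h fol] d(5) by (simp add: height_index_def)
  ultimately obtain L where L: "realizes ?w h \<iota> (shelled L ?w)"
    "realizes (delete_chords {d} ?w) h \<iota> (delete_chords {d} (shelled L ?w))"
    "\<And>p. chord_of p \<in> {d} \<Longrightarrow> L p = []"
    using realize_bare[OF gauss(1) h, of "{d}" \<iota>] gauss(2) by auto
  have "followed_by (shelled L ?w) (Ini d) (Ter d)"
    by (rule followed_by_bare[OF len(2,3)]) (simp_all add: L(3))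
  then have "R1 (shelled L ?w) (delete_chords {d} (shelled L ?w))"
    unfolding R1_def adjacent_def by blast
  then have "shelled L ?w \<approx> delete_chords {d} (shelled L ?w)"
    using realizes_gauss L(1,2) by (intro r_into_equivclp) (simp add: reidemeister_step_def)
  moreover have "arrangement A \<tau> (delete_chords {d} ?w)"
    using arrangement_delete[OF ins(1,2) subset_insertI] d(1) by (simp add: insert_Diff_if)
  ultimately show ?thesis unfolding equivalent_def realization_def using ins w(1) L(1,2) by blast
qed

lemma realization_insert_self_chord:
  assumes r: "realization A \<tau> \<iota> G"
    and d: "d \<notin> A" "\<tau> d = (i, i)" "i < 2" "chord_sign d \<in> {1, -1}"
  shows "\<exists>G. realization (insert d A) \<tau> \<iota> G"
proof -
  obtain w where w: "proper A \<tau>" "arrangement A \<tau> w" "balanced w" using realization_arrangement[OF r] .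
  show ?thesis using realization_exists[OF insert_self_chord_word[OF w d]] .
qed

text \<open>
  A self-chord of index \<open>1\<close> may be rearranged into a shell around a positive endpoint of another
  chord.  As a shell it is no longer recorded as a chord.
\<close>

lemma equivalent_insert_shell:
  assumes r: "realization A \<tau> \<iota> G" and d: "d \<in> A" "snd (\<tau> d) = i" "chord_sign d = 1"
    and c: "c \<notin> A" "\<tau> c = (i, i)" "i < 2" "chord_sign c \<in> {1, -1}" "\<iota> c = 1"
  shows "equivalent \<tau> \<iota> (insert c A) A"
proof -
  obtain w where w: "proper A \<tau>" "arrangement A \<tau> w" "balanced w" using realization_arrangement[OF r] .
  have gauss: "gauss_diagram 2 w" "chords w = A" using arrangement_gauss[OF w(1,2)] by auto
  obtain h where h: "potential w h" using balanced_potential[OF gauss(1) w(3)] by blast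
  have len: "length w = 2" "i < length w" using w(2) c(3) by (simp_all add: arrangement_def)
  have set_w: "set (w ! j) = {p. chord_of p \<in> A \<and> circle_of \<tau> p = j}" if "j < 2" for j
    using w(2) that unfolding arrangement_def by blast
  have "Ter d \<in> set (w ! i)" using set_w[OF c(3)] d by simp
  then obtain us vs where wi: "w ! i = us @ Ter d # vs" by (meson split_list)
  let ?w = "w[i := us @ Ini c # Ter d # Ter c # vs]"
  have notin: "Ini c \<notin> set (w ! i)" "Ter c \<notin> set (w ! i)" using set_w[OF c(3)] c(1) by auto
  have proper_c: "proper (insert c A) \<tau>" using w(1) c unfolding proper_def by auto
  have arr: "arrangement (insert c A) \<tau> ?w" unfolding arrangement_def
  proof (intro conjI allI impI)
    show "length ?w = 2" using len by simp
    fix j :: nat assume j: "j < 2"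
    have "distinct (w ! j)" using w(2) j unfolding arrangement_def by blast
    then show "distinct (?w ! j)"
      using notin len j unfolding wi by (cases "j = i") (auto simp: wi)
    show "set (?w ! j) = {p. chord_of p \<in> insert c A \<and> circle_of \<tau> p = j}"
    proof (intro set_eqI)
      fix p
      have "p \<in> set (?w ! j) \<longleftrightarrow> p \<in> set (w ! j) \<or> (j = i \<and> p \<in> {Ini c, Ter c})"
        using len j wi by (auto simp: nth_list_update)
      then show "p \<in> set (?w ! j) \<longleftrightarrow> p \<in> {p. chord_of p \<in> insert c A \<and> circle_of \<tau> p = j}"
        using set_w[OF j] c by (cases p) auto
    qed
  qed
  have gauss': "gauss_diagram 2 ?w" "chords ?w = insert c A" using arrangement_gauss[OF proper_c arr] by auto
  have dist: "distinct (concat ?w)" using gauss' by (simp add: gauss_diagram_def)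
  have wi': "?w ! i = us @ Ini c # Ter d # Ter c # vs" using len by simp
  have "followed_by ?w (Ini c) (Ter d)" "followed_by ?w (Ter d) (Ter c)"
    using followed_by_word[of i ?w us] followed_by_word[of i ?w "us @ [Ini c]"] len wi' by auto
  then have shell: "shell_at ?w (Ter d) c" using d(3) by (simp add: shell_at_def)
  have del: "delete_chords {c} ?w = w"
  proof (rule nth_equalityI)
    fix j assume "j < length (delete_chords {c} ?w)"
    then have j: "j < 2" using len by simp
    have f: "filter (\<lambda>p. chord_of p \<notin> {c}) (w ! j) = w ! j" using set_w[OF j] c(1) by (intro filter_True) auto
    show "delete_chords {c} ?w ! j = w ! j"
    proof (cases "j = i")
      case True
      have "filter (\<lambda>p. chord_of p \<notin> {c}) (us @ Ini c # Ter d # Ter c # vs)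
          = filter (\<lambda>p. chord_of p \<notin> {c}) (us @ Ter d # vs)" by simp
      with f show ?thesis using True len by (simp add: delete_chords_def wi)
    next
      case False
      with f show ?thesis using j len by (simp add: delete_chords_def)
    qed
  qed simp
  define h' where "h' = add_shell_heights (Ter d) c h"
  have cd: "chord_of (Ter d) \<noteq> c" using d(1) c(1) by auto
  have h': "potential ?w h'" unfolding h'_def
    by (rule potential_add_shell[OF dist shell]) (use d(3) h del in auto)
  have hc: "height_index h' c = 1" unfolding h'_def by (rule height_index_shell[OF cd]) (use d(3) in auto)
  have hg: "height_index h' \<gamma> = height_index h \<gamma> - (if \<gamma> = d then chord_sign c else 0)" if "\<gamma> \<noteq> c" for \<gamma>
    using height_index_add_shell[OF that cd, of h] d(3) unfolding h'_def by auto
  obtain L where L: "valid_shells L ?w" "\<forall>\<gamma>\<in>chords ?w. \<iota> \<gamma> = height_index h' \<gamma> - chord_sign \<gamma> * shell_sum L \<gamma>"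
    "\<forall>p. p \<noteq> Ini (chord_of p) \<or> p \<notin> set (concat ?w) \<or> height_index h' (chord_of p) = \<iota> (chord_of p) \<longrightarrow> L p = []"
    using realizing_shells[OF gauss'(1) finite.emptyI, of Ini \<iota> h'] by blast
  have Lc: "L (Ini c) = []" "L (Ter c) = []" "L (Ter d) = []" using L(3) hc c(5) by auto
  \<comment> \<open>Around the bare endpoint \<open>Ter d\<close> the chord \<open>c\<close> looks like a shell, so both readings give the same diagram.\<close>
  define L' where "L' = L(Ter d := [c])"
  have eq: "shelled L' w = shelled L ?w"
  proof -
    have fat': "with_shells L' x = with_shells L x" if "x \<noteq> Ter d" for x using that by (simp add: with_shells_def L'_def)
    have fat_c: "with_shells L (Ini c) = [Ini c]" "with_shells L (Ter c) = [Ter c]" "with_shells L (Ter d) = [Ter d]"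
      using Lc by (simp_all add: with_shells_def)
    have fat_d: "with_shells L' (Ter d) = [Ini c, Ter d, Ter c]"
      using d(3) by (simp add: with_shells_def L'_def shell_left_def shell_right_def)
    have "distinct (w ! i)" using w(2) c(3) unfolding arrangement_def by blast
    then have fat_uv: "map (with_shells L') us = map (with_shells L) us" "map (with_shells L') vs = map (with_shells L) vs"
      unfolding wi by (auto intro!: fat')
    have i: "concat (map (with_shells L') (w ! i)) = concat (map (with_shells L) (?w ! i))"
      unfolding wi' unfolding wi
      by (simp only: fat_c fat_d fat_uv map_append list.map concat_append concat.simps append_Cons append_Nil)
    show ?thesis
    proof (rule nth_equalityI)
      fix j assume "j < length (shelled L' w)"
      then have j: "j < 2" using len by simp
      show "shelled L' w ! j = shelled L ?w ! j"
      proof (cases "j = i")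
        case True
        then show ?thesis using i len j by (simp add: shelled_def)
      next
        case False
        have "Ter d \<notin> set (w ! j)" using set_w[OF j] d(2) False by auto
        then have e: "map (with_shells L') (w ! j) = map (with_shells L) (w ! j)" by (auto intro!: fat')
        have "shelled L' w ! j = concat (map (with_shells L') (w ! j))" using len j by (simp add: shelled_def)
        also have "\<dots> = shelled L ?w ! j" unfolding e using False len j by (simp add: shelled_def)
        finally show ?thesis .
      qed
    qed simp
  qed
  have in_w: "p \<in> set (concat w) \<longleftrightarrow> chord_of p \<in> A" for p by (rule arrangement_in_concat[OF w(1,2)])
  have m: "mset (all_shells L ?w) = mset (all_shells L w)"
  proof -
    have "concat (map L (filter (\<lambda>p. chord_of p \<notin> {c}) es)) = concat (map L es)" for es
    proof (induction es)
      case (Cons x es)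
      have "L x = []" if "chord_of x = c" using Lc that by (cases x) auto
      with Cons show ?case by auto
    qed simp
    then have "all_shells L (delete_chords {c} ?w) = all_shells L ?w"
      unfolding all_shells_def concat_delete_chords .
    then show ?thesis unfolding del by simp
  qed
  have "mset (all_shells L' w) = mset (c # all_shells L w)"
    using mset_all_shells_update[OF gauss(1), of "Ter d" L "[c]"] in_w d(1) Lc unfolding L'_def by simp
  then have ms: "mset (all_shells L' w) = mset (c # all_shells L ?w)" using m by simp
  have "distinct (all_shells L' w) = distinct (c # all_shells L ?w)"
    "set (all_shells L' w) = set (c # all_shells L ?w)"
    using ms by (metis mset_eq_imp_distinct_iff, metis mset_eq_setD)
  then have ok': "valid_shells L' w" using L(1) c(1,4) unfolding valid_shells_def gauss(2) gauss'(2) by auto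
  have "realizes w h \<iota> (shelled L' w)"
  proof (rule realizesI[OF gauss(1) h ok'])
    fix \<gamma> assume g: "\<gamma> \<in> chords w"
    then have gc: "\<gamma> \<noteq> c" using c(1) gauss(2) by auto
    have "\<iota> \<gamma> = height_index h' \<gamma> - chord_sign \<gamma> * shell_sum L \<gamma>" using L(2) g gauss(2) gauss'(2) by auto
    moreover have "shell_sum L' \<gamma> = shell_sum L \<gamma> + (if \<gamma> = d then chord_sign c else 0)"
      using Lc(3) by (auto simp: shell_sum_def L'_def)
    ultimately show "\<iota> \<gamma> = height_index h \<gamma> - chord_sign \<gamma> * shell_sum L' \<gamma>"
      using hg[OF gc] d(3) by auto
  qed
  then have "realization A \<tau> \<iota> (shelled L ?w)"
    unfolding realization_def eq using w(1,2) by blast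
  moreover have "realizes ?w h' \<iota> (shelled L ?w)"
    using L(2) by (intro realizesI[OF gauss'(1) h' L(1)]) blast
  then have "realization (insert c A) \<tau> \<iota> (shelled L ?w)"
    unfolding realization_def using proper_c arr by blast
  ultimately show ?thesis unfolding equivalent_def by (blast intro: equivclp_refl)
qed

lemma equivalent_insert_index_1:
  assumes r: "realization A \<tau> \<iota> G"
    and c: "c \<notin> A" "\<tau> c = (i, i)" "i < 2" "chord_sign c \<in> {1, -1}" "\<iota> c = 1"
  shows "equivalent \<tau> \<iota> (insert c A) A"
proof -
  have "finite (insert c A)" using r unfolding realization_def proper_def by auto
  then obtain ds where ds: "length ds = 1" "set ds \<inter> insert c A = {}" "\<forall>c\<in>set ds. chord_sign c = 1"
    using fresh_chord_list by metis
  then obtain d where "ds = [d]" by (auto simp: length_Suc_conv)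
  then have d: "d \<notin> insert c A" "chord_sign d = 1" using ds by auto
  \<comment> \<open>An auxiliary chord of index \<open>0\<close> supplies a positive endpoint to be surrounded.\<close>
  let ?t = "\<tau>(d := (i, i))" and ?i = "\<iota>(d := 0)"
  have rA: "realization A ?t ?i G" by (rule realization_cong[OF r]) (use d in auto)
  obtain G1 where G1: "realization (insert c A) ?t ?i G1"
    using realization_insert_self_chord[OF rA c(1) _ c(3,4)] c(2) d by auto
  have 1: "equivalent ?t ?i (insert d (insert c A)) (insert c A)"
    by (rule equivalent_insert_index_0[OF G1]) (use d c(3) in auto)
  have 2: "equivalent ?t ?i (insert d A) A"
    by (rule equivalent_insert_index_0[OF rA]) (use d c(3) in auto)
  then obtain G2 where G2: "realization (insert d A) ?t ?i G2" using equivalent_real_diagram by blast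
  have 3: "equivalent ?t ?i (insert c (insert d A)) (insert d A)"
    by (rule equivalent_insert_shell[OF G2, of d i]) (use d c in auto)
  have "equivalent ?t ?i (insert c A) A"
    using equivalent_trans[OF equivalent_sym[OF 1]] equivalent_trans[OF 3 2] by (metis insert_commute)
  then show ?thesis by (rule equivalent_cong) (use d in auto)
qed

lemma equivalent_insert_index_0_list:
  assumes r: "realization A \<tau> \<iota> G" and "distinct ds" "set ds \<inter> A = {}"
    and "\<And>d. d \<in> set ds \<Longrightarrow> \<tau> d = (i, i) \<and> chord_sign d \<in> {1, -1} \<and> \<iota> d = 0" and i: "i < 2"
  shows "equivalent \<tau> \<iota> (set ds \<union> A) A"
  using assms(2-4)
proof (induction ds)
  case Nil
  then show ?case using equivalent_refl[OF r] by simp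
next
  case (Cons d ds)
  then have IH: "equivalent \<tau> \<iota> (set ds \<union> A) A" by auto
  then obtain G1 where "realization (set ds \<union> A) \<tau> \<iota> G1" using equivalent_real_diagram by blast
  then have "equivalent \<tau> \<iota> (insert d (set ds \<union> A)) (set ds \<union> A)"
    by (rule equivalent_insert_index_0[where i = i]) (use Cons.prems i in auto)
  with IH show ?case using equivalent_trans by fastforce
qed


text \<open>
  The initial endpoints of the helper chords \<open>ds\<close> precede the terminal endpoints of \<open>a\<close> and \<open>b\<close>, and
  their terminal endpoints come last.  So \<open>ds\<close> adjusts the height of \<open>Ter a\<close> above \<open>Ini a\<close>.
\<close>

lemma pair_word:
  fixes ds :: "chord list"
  assumes A: "proper A \<tau>" "arrangement A \<tau> w" "balanced w"
    and ab: "a \<noteq> b" "a \<notin> A" "b \<notin> A" "\<tau> a = (i, j)" "\<tau> b = (i, j)" "i < 2" "j < 2"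
      "chord_sign b = - chord_sign a" "chord_sign a \<in> {1, -1}"
    and ds: "distinct ds" "set ds \<inter> insert a (insert b A) = {}"
      "\<And>d. d \<in> set ds \<Longrightarrow> \<tau> d = (j, j) \<and> chord_sign d \<in> {1, -1}"
  defines "circle \<equiv> \<lambda>l. (if l = i then [Ini a, Ini b] else []) @
      (if l = j then map Ini ds @ [Ter a, Ter b] else []) @ w ! l @ (if l = j then map Ter ds else [])"
  shows "proper (insert a (insert b (set ds \<union> A))) \<tau>"
    and "arrangement (insert a (insert b (set ds \<union> A))) \<tau> [circle 0, circle 1]"
    and "balanced [circle 0, circle 1]"
proof -
  let ?B = "insert a (insert b (set ds \<union> A))"
  show "proper ?B \<tau>" using A(1) ab ds unfolding proper_def by auto
  have nth: "[circle 0, circle 1] ! l = circle l" if "l < 2" for l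
    using that by (auto simp: less_2_cases_iff)
  have w: "distinct (w ! l)" "set (w ! l) = {p. chord_of p \<in> A \<and> circle_of \<tau> p = l}" if "l < 2" for l
    using A(2) that unfolding arrangement_def by blast+
  have new: "a \<notin> set ds" "b \<notin> set ds" "\<And>d. d \<in> set ds \<Longrightarrow> d \<notin> A" using ds(2) by auto
  have "distinct (circle l)" if "l < 2" for l
    using w[OF that] ab(1-3) new ds(1) unfolding circle_def
    by (auto simp: distinct_map inj_on_def)
  moreover have "set (circle l) = {p. chord_of p \<in> ?B \<and> circle_of \<tau> p = l}" if "l < 2" for l
  proof (intro set_eqI)
    fix p
    show "p \<in> set (circle l) \<longleftrightarrow> p \<in> {p. chord_of p \<in> ?B \<and> circle_of \<tau> p = l}"
    proof (cases p)
      case (Ini \<gamma>)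
      then show ?thesis using w(2)[OF that] ab(4,5) ds(3)[of \<gamma>] unfolding circle_def by auto
    next
      case (Ter \<gamma>)
      then show ?thesis using w(2)[OF that] ab(4,5) ds(3)[of \<gamma>] unfolding circle_def by auto
    qed
  qed
  ultimately show "arrangement ?B \<tau> [circle 0, circle 1]"
    unfolding arrangement_def using nth by simp
  have len: "length w = 2" using A(2) by (simp add: arrangement_def)
  have "tot (map Ini ds) + tot (map Ter ds) = 0" by (induction ds) auto
  then have "tot (circle l) = tot (w ! l)" for l unfolding circle_def using ab(8) by auto
  then show "balanced [circle 0, circle 1]"
    using A(3) unfolding balanced_nth[OF len] by (simp add: balanced_def)
qed

text \<open>
  Two chords of opposite signs that agree in placement and index cancel.  If \<open>ds\<close> puts \<open>a\<close> at
  the right height, then both chords have their index without shells, and R2 applies.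
\<close>

lemma equivalent_insert_pair_bare:
  fixes ds :: "chord list"
  assumes A: "realization A \<tau> \<iota> G"
    and ab: "a \<noteq> b" "a \<notin> A" "b \<notin> A" "\<tau> a = (i, j)" "\<tau> b = (i, j)" "i < 2" "j < 2"
      "chord_sign b = - chord_sign a" "chord_sign a \<in> {1, -1}" "\<iota> b = \<iota> a"
    and ds: "distinct ds" "set ds \<inter> insert a (insert b A) = {}"
      "\<And>d. d \<in> set ds \<Longrightarrow> \<tau> d = (j, j) \<and> chord_sign d \<in> {1, -1}"
      "tot (map Ini ds) = \<iota> a - chord_sign a"
  shows "equivalent \<tau> \<iota> (insert a (insert b (set ds \<union> A))) (set ds \<union> A)"
proof -
  let ?B = "insert a (insert b (set ds \<union> A))"
  obtain w where w: "proper A \<tau>" "arrangement A \<tau> w" "balanced w" using realization_arrangement[OF A] .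
  define circle where "circle l = (if l = i then [Ini a, Ini b] else []) @
      (if l = j then map Ini ds @ [Ter a, Ter b] else []) @ w ! l @ (if l = j then map Ter ds else [])" for l
  define v where "v = [circle 0, circle 1]"
  note pw = pair_word[OF w ab(1-9) ds(1-3), folded circle_def, folded v_def]
  have nth: "v ! l = circle l" if "l < 2" for l
    using that by (auto simp: less_2_cases_iff v_def)
  have len: "length v = 2" by (simp add: v_def)
  have gauss: "gauss_diagram 2 v" "chords v = ?B" using arrangement_gauss[OF pw(1,2)] by auto
  have dist: "distinct (concat v)" using gauss by (simp add: gauss_diagram_def)
  obtain h where h: "potential v h" "\<And>l. l < 2 \<Longrightarrow> climbs h 0 (v ! l)"
    using potential_base[OF gauss(1) pw(3)] by blast
  have hi: "h (Ini a) = 0" "h (Ini b) = - chord_sign a"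
    using h(2)[OF ab(6)] unfolding nth[OF ab(6)] circle_def by auto
  have "climbs h 0 (circle j)" using h(2)[OF ab(7)] unfolding nth[OF ab(7)] .
  then have ht: "h (Ter a) = \<iota> a - chord_sign a" "h (Ter b) = \<iota> a"
    unfolding circle_def using ds(4) ab(8) by (auto split: if_splits)
  have ind: "height_index h c = \<iota> c" if "c \<in> {a, b}" for c
    using that hi ht ab(8,10) by (auto simp: height_index_def)
  have pos: "v ! i = [] @ Ini a # Ini b # drop 2 (v ! i)"
    unfolding nth[OF ab(6)] circle_def by (simp add: numeral_2_eq_2)
  have pos': "v ! j = ((if j = i then [Ini a, Ini b] else []) @ map Ini ds) @ Ter a # Ter b # (w ! j @ map Ter ds)"
    unfolding nth[OF ab(7)] circle_def by simp
  have ilen: "i < length v" "j < length v" using ab(6,7) len by auto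
  have adj: "adjacent v (Ini a) (Ini b)" "adjacent v (Ter a) (Ter b)"
    unfolding adjacent_def using followed_by_word[OF ilen(1) pos] followed_by_word[OF ilen(2) pos'] by blast+
  have "potential (delete_chords {a, b} v) h"
    by (rule potential_delete_pair[OF h(1) dist _ adj]) (simp add: ab(8))
  then obtain L where L: "realizes v h \<iota> (shelled L v)"
    "realizes (delete_chords {a, b} v) h \<iota> (delete_chords {a, b} (shelled L v))"
    "\<And>p. chord_of p \<in> {a, b} \<Longrightarrow> L p = []"
    using realize_bare[OF gauss(1) h(1), of "{a, b}" \<iota>] gauss(2) ind by blast
  have "followed_by (shelled L v) (Ini a) (Ini b)" "followed_by (shelled L v) (Ter a) (Ter b)"
    using followed_by_bare[OF ilen(1) pos] followed_by_bare[OF ilen(2) pos'] L(3) by auto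
  moreover have sign_ab: "chord_sign a = - chord_sign b" using ab(8) by simp
  ultimately have "R2 (shelled L v) (delete_chords {a, b} (shelled L v))"
    unfolding R2_def adjacent_def using sign_ab by blast
  then have "shelled L v \<approx> delete_chords {a, b} (shelled L v)"
    using realizes_gauss L(1,2) by (intro r_into_equivclp) (simp add: reidemeister_step_def)
  moreover have "?B - (set ds \<union> A) = {a, b}" using ds(2) ab(2,3) by auto
  then have "arrangement (set ds \<union> A) \<tau> (delete_chords {a, b} v)"
    using arrangement_delete[OF pw(1,2), of "set ds \<union> A"] by auto
  moreover have "proper (set ds \<union> A) \<tau>" using pw(1) proper_subset by blast
  ultimately show ?thesis unfolding equivalent_def realization_def using pw L(1,2) by blast
qed

lemma realization_insert_pair:
  assumes A: "realization A \<tau> \<iota> G"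
    and ab: "a \<noteq> b" "a \<notin> A" "b \<notin> A" "\<tau> a = (i, j)" "\<tau> b = (i, j)" "i < 2" "j < 2"
      "chord_sign b = - chord_sign a" "chord_sign a \<in> {1, -1}"
  shows "\<exists>G. realization (insert a (insert b A)) \<tau> \<iota> G"
proof -
  obtain w where w: "proper A \<tau>" "arrangement A \<tau> w" "balanced w" using realization_arrangement[OF A] .
  have none: "distinct ([] :: chord list)" "set ([] :: chord list) \<inter> insert a (insert b A) = {}"
    "\<And>d. d \<in> set ([] :: chord list) \<Longrightarrow> \<tau> d = (j, j) \<and> chord_sign d \<in> {1, -1}" by auto
  show ?thesis
    by (rule realization_exists[OF pair_word[OF w ab none, unfolded list.set Un_empty_left]])
qed

lemma equivalent_insert_pair:
  assumes A: "realization A \<tau> \<iota> G"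
    and ab: "a \<noteq> b" "a \<notin> A" "b \<notin> A" "\<tau> a = (i, j)" "\<tau> b = (i, j)" "i < 2" "j < 2"
      "chord_sign b = - chord_sign a" "chord_sign a \<in> {1, -1}" "\<iota> b = \<iota> a"
  shows "equivalent \<tau> \<iota> (insert a (insert b A)) A"
proof -
  let ?k = "chord_sign a - \<iota> a"
  let ?s = "if ?k \<ge> 0 then 1 else (-1 :: int)"
  have "finite (insert a (insert b A))" using A unfolding realization_def proper_def by auto
  then obtain ds where ds: "length ds = nat \<bar>?k\<bar>" "distinct ds" "set ds \<inter> insert a (insert b A) = {}"
    "\<forall>d\<in>set ds. chord_sign d = ?s"
    using fresh_chord_list by meson
  \<comment> \<open>The helper chords lift the terminal endpoint of \<open>a\<close> to the height that its index requires.\<close>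
  have "tot (map Ini ds) = - (int (length ds) * ?s)" using ds(4) by (induction ds) (auto simp: algebra_simps)
  then have tot: "tot (map Ini ds) = \<iota> a - chord_sign a" unfolding ds(1) by auto
  define t where "t c = (if c \<in> set ds then (j, j) else \<tau> c)" for c
  define k where "k c = (if c \<in> set ds then 0 else \<iota> c)" for c
  have old: "t c = \<tau> c \<and> k c = \<iota> c" if "c \<in> insert a (insert b A)" for c
    using that ds(3) unfolding t_def k_def by auto
  have rA: "realization A t k G" by (rule realization_cong[OF A]) (use old in auto)
  have tk: "t a = (i, j)" "t b = (i, j)" "k a = \<iota> a" "k b = \<iota> a" using old ab by auto
  obtain G1 where G1: "realization (insert a (insert b A)) t k G1"
    using realization_insert_pair[OF rA ab(1-3) tk(1,2) ab(6-9)] by blast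
  have dsp: "t d = (j, j) \<and> chord_sign d \<in> {1, -1}" "k d = 0" if "d \<in> set ds" for d
    using that ds(4) unfolding t_def k_def by auto
  have 1: "equivalent t k (insert a (insert b (set ds \<union> A))) (set ds \<union> A)"
    by (rule equivalent_insert_pair_bare[OF rA ab(1-3) tk(1,2) ab(6-9) _ ds(2,3) dsp(1)]) (use tk tot in auto)
  have 2: "equivalent t k (set ds \<union> A) A"
    by (rule equivalent_insert_index_0_list[OF rA ds(2) _ _ ab(7)]) (use ds(3) dsp in auto)
  have 3: "equivalent t k (set ds \<union> insert a (insert b A)) (insert a (insert b A))"
    by (rule equivalent_insert_index_0_list[OF G1 ds(2) _ _ ab(7)]) (use ds(3) dsp in auto)
  have "set ds \<union> insert a (insert b A) = insert a (insert b (set ds \<union> A))" by auto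
  then have "equivalent t k (insert a (insert b A)) A" using equivalent_trans[OF equivalent_sym[OF 3]] equivalent_trans[OF 1 2] by simp
  then show ?thesis by (rule equivalent_cong) (use old in auto)
qed

section \<open>The classification\<close>

definition data_sum :: "chord set \<Rightarrow> (chord \<Rightarrow> nat \<times> nat) \<Rightarrow> (chord \<Rightarrow> int) \<Rightarrow> nat \<Rightarrow> nat \<Rightarrow> int \<Rightarrow> int" where
  "data_sum A \<tau> \<iota> i j n = (\<Sum>\<gamma>\<in>{\<gamma> \<in> A. \<tau> \<gamma> = (i, j) \<and> \<iota> \<gamma> = n}. chord_sign \<gamma>)"

lemma data_sum_Un:
  assumes "finite A" "finite B" "A \<inter> B = {}"
  shows "data_sum (A \<union> B) \<tau> \<iota> i j n = data_sum A \<tau> \<iota> i j n + data_sum B \<tau> \<iota> i j n"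
proof -
  have "{\<gamma> \<in> A \<union> B. \<tau> \<gamma> = (i, j) \<and> \<iota> \<gamma> = n}
      = {\<gamma> \<in> A. \<tau> \<gamma> = (i, j) \<and> \<iota> \<gamma> = n} \<union> {\<gamma> \<in> B. \<tau> \<gamma> = (i, j) \<and> \<iota> \<gamma> = n}" by auto
  then show ?thesis unfolding data_sum_def using assms by (subst sum.union_disjoint[symmetric]) auto
qed

text \<open>
  Chords without any net contribution to the data are removed: those of index \<open>0\<close> and \<open>1\<close> among
  the self-chords one by one, all others in cancelling pairs.
\<close>

lemma equivalent_remove_zero_data:
  assumes r: "realization A \<tau> \<iota> G" and N: "proper N \<tau>" "N \<inter> A = {}"
    and zero: "\<And>i j n. i < 2 \<Longrightarrow> j < 2 \<Longrightarrow> i = j \<and> n \<in> {0, 1} \<or> data_sum N \<tau> \<iota> i j n = 0"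
  shows "equivalent \<tau> \<iota> (N \<union> A) A"
  using N zero
proof (induction "card N" arbitrary: N rule: less_induct)
  case less
  have fin: "finite N" using less.prems(1) by (simp add: proper_def)
  have step: "equivalent \<tau> \<iota> (N \<union> A) A"
    if M: "M \<subseteq> N" "M \<noteq> N"
      and data: "\<And>i j n. i < 2 \<Longrightarrow> j < 2 \<Longrightarrow> \<not> (i = j \<and> n \<in> {0, 1}) \<Longrightarrow> data_sum (N - M) \<tau> \<iota> i j n = 0"
      and ins: "\<And>G. realization (M \<union> A) \<tau> \<iota> G \<Longrightarrow> equivalent \<tau> \<iota> (N \<union> A) (M \<union> A)" for M
  proof -
    have "equivalent \<tau> \<iota> (M \<union> A) A"
    proof (rule less.hyps)
      show "card M < card N" using M fin by (intro psubset_card_mono) auto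
      show "proper M \<tau>" using proper_subset[OF less.prems(1) M(1)] .
      show "M \<inter> A = {}" using less.prems(2) M(1) by auto
      fix i j :: nat and n :: int assume ij: "i < 2" "j < 2"
      have "N = (N - M) \<union> M" using M(1) by auto
      then have "data_sum N \<tau> \<iota> i j n = data_sum (N - M) \<tau> \<iota> i j n + data_sum M \<tau> \<iota> i j n"
        using data_sum_Un[of "N - M" M \<tau> \<iota> i j n] fin M(1) finite_subset by auto
      with less.prems(3)[OF ij, of n] data[OF ij, of n]
      show "i = j \<and> n \<in> {0, 1} \<or> data_sum M \<tau> \<iota> i j n = 0" by linarith
    qed
    moreover from this obtain G where "realization (M \<union> A) \<tau> \<iota> G" using equivalent_real_diagram by blast
    ultimately show ?thesis using ins equivalent_trans by blast
  qed
  show ?case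
  proof (cases "N = {}")
    case True
    then show ?thesis using equivalent_refl[OF r] by simp
  next
    case False
    then obtain c where c: "c \<in> N" by blast
    obtain i j where t: "\<tau> c = (i, j)" by (cases "\<tau> c")
    have ij: "i < 2" "j < 2" and s: "chord_sign c \<in> {1, -1}" using less.prems(1) c t unfolding proper_def by force+
    have cA: "c \<notin> A" using c less.prems(2) by auto
    show ?thesis
    proof (cases "i = j \<and> \<iota> c \<in> {0, 1}")
      case True
      show ?thesis
      proof (rule step[of "N - {c}"])
        fix i' j' :: nat and n :: int assume "\<not> (i' = j' \<and> n \<in> {0, 1})"
        then have "{\<gamma> \<in> N - (N - {c}). \<tau> \<gamma> = (i', j') \<and> \<iota> \<gamma> = n} = {}" using True t by auto
        then show "data_sum (N - (N - {c})) \<tau> \<iota> i' j' n = 0" unfolding data_sum_def by (simp only: sum.empty)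
      next
        fix G assume G: "realization (N - {c} \<union> A) \<tau> \<iota> G"
        have "insert c (N - {c} \<union> A) = N \<union> A" using c by auto
        moreover have "equivalent \<tau> \<iota> (insert c (N - {c} \<union> A)) (N - {c} \<union> A)"
          using equivalent_insert_index_0[OF G, of c i] equivalent_insert_index_1[OF G, of c i] True t ij s cA by auto
        ultimately show "equivalent \<tau> \<iota> (N \<union> A) (N - {c} \<union> A)" by simp
      qed (use c in auto)
    next
      case False
      let ?C = "{\<gamma> \<in> N. \<tau> \<gamma> = (i, j) \<and> \<iota> \<gamma> = \<iota> c}"
      have sum: "sum chord_sign ?C = 0" using less.prems(3)[OF ij, of "\<iota> c"] False unfolding data_sum_def by blast
      have "\<exists>b\<in>?C. chord_sign b = - chord_sign c"
      proof (rule ccontr)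
        assume no: "\<not> (\<exists>b\<in>?C. chord_sign b = - chord_sign c)"
        have "chord_sign b = chord_sign c" if "b \<in> ?C" for b
          using no that s less.prems(1) unfolding proper_def by auto
        then have "sum chord_sign ?C = int (card ?C) * chord_sign c" by simp
        moreover have "card ?C \<noteq> 0" using fin c t by auto
        ultimately show False using sum s by auto
      qed
      then obtain b where b: "b \<in> N" "\<tau> b = (i, j)" "\<iota> b = \<iota> c" "chord_sign b = - chord_sign c" by blast
      have cb: "c \<noteq> b" using b(4) s by auto
      show ?thesis
      proof (rule step[of "N - {c, b}"])
        fix i' j' :: nat and n :: int
        have e: "N - (N - {c, b}) = {c, b}" using b(1) c by auto
        have "{\<gamma> \<in> {c, b}. \<tau> \<gamma> = (i', j') \<and> \<iota> \<gamma> = n} = (if i' = i \<and> j' = j \<and> n = \<iota> c then {c, b} else {})"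
          using t b by auto
        then show "data_sum (N - (N - {c, b})) \<tau> \<iota> i' j' n = 0" unfolding data_sum_def e using cb b(4) by simp
      next
        fix G assume G: "realization (N - {c, b} \<union> A) \<tau> \<iota> G"
        have "insert c (insert b (N - {c, b} \<union> A)) = N \<union> A" using c b(1) by auto
        moreover have "equivalent \<tau> \<iota> (insert c (insert b (N - {c, b} \<union> A))) (N - {c, b} \<union> A)"
          by (rule equivalent_insert_pair[OF G cb, where i = i and j = j]) (use b t ij s cA less.prems(2) in auto)
        ultimately show "equivalent \<tau> \<iota> (N \<union> A) (N - {c, b} \<union> A)" by simp
      qed (use c in auto)
    qed
  qed
qed

definition placement :: "diagram \<Rightarrow> chord \<Rightarrow> nat \<times> nat" where
  "placement G \<gamma> = (if Ini \<gamma> \<in> set (G ! 0) then 0 else 1, if Ter \<gamma> \<in> set (G ! 0) then 0 else 1)"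

lemma placement_iff:
  assumes G: "gauss_diagram 2 G" and \<gamma>: "\<gamma> \<in> chords G" and i: "i < 2"
  shows "Ini \<gamma> \<in> set (G ! i) \<longleftrightarrow> fst (placement G \<gamma>) = i" "Ter \<gamma> \<in> set (G ! i) \<longleftrightarrow> snd (placement G \<gamma>) = i"
proof -
  have len: "length G = 2" using G by (simp add: gauss_diagram_def)
  have *: "p \<in> set (G ! i) \<longleftrightarrow> (if p \<in> set (G ! 0) then 0 else 1) = i" if "chord_of p = \<gamma>" for p
  proof -
    have "p \<in> set (concat G)" using that \<gamma> endpoint_in_gauss_diagram[OF G] by blast
    then obtain k where k: "k < 2" "p \<in> set (G ! k)" unfolding in_concat_nth len by blast
    have on: "p \<in> set (G ! l) \<longleftrightarrow> l = k" if "l < 2" for l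
      using k gauss_diagram_same_index[OF G that k(1) _ k(2)] by blast
    have "(if p \<in> set (G ! 0) then 0 else 1) = k" using on[of 0] k(1) by (cases "k = 0") simp_all
    then show ?thesis using on[OF i] by auto
  qed
  show "Ini \<gamma> \<in> set (G ! i) \<longleftrightarrow> fst (placement G \<gamma>) = i" "Ter \<gamma> \<in> set (G ! i) \<longleftrightarrow> snd (placement G \<gamma>) = i"
    using *[of "Ini \<gamma>"] *[of "Ter \<gamma>"] by (simp_all add: placement_def)
qed

lemma realization_itself:
  assumes G: "gauss_diagram 2 G" and h: "potential G h"
    and eq: "\<And>\<gamma>. \<gamma> \<in> chords G \<Longrightarrow> \<tau> \<gamma> = placement G \<gamma> \<and> \<iota> \<gamma> = height_index h \<gamma>"
  shows "realization (chords G) \<tau> \<iota> G"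
proof -
  have len: "length G = 2" using G by (simp add: gauss_diagram_def)
  have "proper (chords G) \<tau>" unfolding proper_def
  proof (intro conjI ballI finite_chords)
    fix \<gamma> assume "\<gamma> \<in> chords G"
    then show "chord_sign \<gamma> \<in> {1, -1}" "fst (\<tau> \<gamma>) < 2" "snd (\<tau> \<gamma>) < 2"
      using chord_sign_in_gauss_diagram[OF G, of \<gamma>] eq[of \<gamma>] by (auto simp: placement_def)
  qed
  moreover have "arrangement (chords G) \<tau> G" unfolding arrangement_def
  proof (intro conjI allI impI len)
    fix i :: nat assume i: "i < 2"
    show "distinct (G ! i)" by (rule gauss_diagram_distinct_nth[OF G i])
    have in_G: "chord_of p \<in> chords G" if "p \<in> set (G ! i)" for p
      using that i len endpoint_in_gauss_diagram[OF G] in_concat_nth[of p G] by auto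
    have "p \<in> set (G ! i) \<longleftrightarrow> chord_of p \<in> chords G \<and> circle_of \<tau> p = i" for p
    proof (cases "chord_of p \<in> chords G")
      case True
      have "p \<in> set (G ! i) \<longleftrightarrow> circle_of \<tau> p = i"
      proof (cases p)
        case (Ini \<gamma>)
        then show ?thesis using True placement_iff(1)[OF G _ i, of \<gamma>] eq[of \<gamma>] by simp
      next
        case (Ter \<gamma>)
        then show ?thesis using True placement_iff(2)[OF G _ i, of \<gamma>] eq[of \<gamma>] by simp
      qed
      with True show ?thesis by blast
    next
      case False
      then show ?thesis using in_G by blast
    qed
    then show "set (G ! i) = {p. chord_of p \<in> chords G \<and> circle_of \<tau> p = i}" by blast
  qed
  moreover have "realizes G h \<iota> (shelled (\<lambda>_. []) G)"
  proof (rule realizesI[OF G h])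
    have "concat (map (\<lambda>_. []) xs) = ([] :: chord list)" for xs :: "chord endpoint list"
      by (induction xs) auto
    then have "all_shells (\<lambda>_. []) G = []" unfolding all_shells_def .
    then show "valid_shells (\<lambda>_. []) G" unfolding valid_shells_def by simp
  qed (use eq in \<open>simp add: shell_sum_def\<close>)
  then have "realizes G h \<iota> G" by (simp add: shelled_none)
  ultimately show ?thesis unfolding realization_def by blast
qed

lemma data_sum_index_sum:
  assumes G: "gauss_diagram 2 G" and ij: "i < 2" "j < 2"
    and eq: "\<And>\<gamma>. \<gamma> \<in> chords G \<Longrightarrow> \<tau> \<gamma> = placement G \<gamma> \<and> \<iota> \<gamma> = height_index h \<gamma>"
  shows "data_sum (chords G) \<tau> \<iota> i j n = index_sum h G i j n"
proof -
  have "{\<gamma> \<in> chords G. \<tau> \<gamma> = (i, j) \<and> \<iota> \<gamma> = n} = {\<gamma> \<in> chords_of_type G i j. height_index h \<gamma> = n}"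
  proof (intro set_eqI)
    fix \<gamma>
    have len: "length G = 2" using G by (simp add: gauss_diagram_def)
    have in_G: "\<gamma> \<in> chords G" if "\<gamma> \<in> chords_of_type G i j"
      using that ij len in_concat_nth[of "Ini \<gamma>" G] unfolding chords_of_type_def chords_def by auto
    show "\<gamma> \<in> {\<gamma> \<in> chords G. \<tau> \<gamma> = (i, j) \<and> \<iota> \<gamma> = n} \<longleftrightarrow>
        \<gamma> \<in> {\<gamma> \<in> chords_of_type G i j. height_index h \<gamma> = n}"
    proof (cases "\<gamma> \<in> chords G")
      case True
      have "\<gamma> \<in> chords_of_type G i j \<longleftrightarrow> \<tau> \<gamma> = (i, j)"
        using placement_iff(1)[OF G True ij(1)] placement_iff(2)[OF G True ij(2)] eq[OF True]
        unfolding chords_of_type_def by (simp add: prod_eq_iff)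
      then show ?thesis using True eq[OF True] by simp
    next
      case False
      then show ?thesis using in_G by blast
    qed
  qed
  then show ?thesis unfolding data_sum_def index_sum_def sign_sum_def by simp
qed

lemma fresh_copies:
  assumes "finite A" "finite S" "\<sigma> = 1 \<or> \<sigma> = -1"
  shows "\<exists>f. inj_on f A \<and> f ` A \<inter> S = {} \<and> (\<forall>\<gamma>\<in>A. chord_sign (f \<gamma>) = \<sigma> * chord_sign \<gamma>)"
proof -
  obtain l where l: "\<And>l' \<sigma>. Chord l' \<sigma> \<in> S \<Longrightarrow> l' < l" using fresh_label[OF assms(2)] by blast
  obtain g :: "chord \<Rightarrow> nat" where g: "inj_on g A" using finite_imp_inj_to_nat_seg[OF assms(1)] by metis
  let ?f = "\<lambda>\<gamma>. Chord (l + g \<gamma>) (\<sigma> * chord_sign \<gamma>)"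
  have "inj_on ?f A" using g by (auto simp: inj_on_def)
  moreover have "?f ` A \<inter> S = {}" using l by fastforce
  ultimately show ?thesis by (intro exI[of _ ?f]) auto
qed

text \<open>
  With a copy \<open>B\<close> of the chords of \<open>H\<close> with all signs reversed, the chords of \<open>G\<close>, of \<open>H\<close> and
  in \<open>B\<close> together reduce to those of \<open>G\<close> and also to those of \<open>H\<close>.
\<close>

lemma same_data_S_equiv_disjoint:
  assumes G: "gauss_diagram 2 G" and H: "gauss_diagram 2 H"
    and sd: "same_data {0, 1} G H" and disj: "chords G \<inter> chords H = {}"
  shows "G \<approx> H"
proof -
  obtain g h where g: "potential G g" and h: "potential H h"
    and eq: "\<And>i j n. i < 2 \<Longrightarrow> j < 2 \<Longrightarrow> i = j \<and> n \<in> {0, 1} \<or> index_sum g G i j n = index_sum h H i j n"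
    using sd unfolding same_data_def by blast
  let ?A = "chords G" and ?A' = "chords H"
  obtain f where f: "inj_on f ?A'" "f ` ?A' \<inter> (?A \<union> ?A') = {}"
    "\<And>\<gamma>. \<gamma> \<in> ?A' \<Longrightarrow> chord_sign (f \<gamma>) = - chord_sign \<gamma>"
    using fresh_copies[of ?A' "?A \<union> ?A'" "-1"] finite_chords by auto
  let ?B = "f ` ?A'"
  define \<tau> where "\<tau> c = (if c \<in> ?A then placement G c else if c \<in> ?A' then placement H c
    else placement H (inv_into ?A' f c))" for c
  define \<iota> where "\<iota> c = (if c \<in> ?A then height_index g c else if c \<in> ?A' then height_index h c
    else height_index h (inv_into ?A' f c))" for c
  have tA: "\<tau> c = placement G c \<and> \<iota> c = height_index g c" if "c \<in> ?A" for c
    using that by (simp add: \<tau>_def \<iota>_def)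
  have tA': "\<tau> c = placement H c \<and> \<iota> c = height_index h c" if "c \<in> ?A'" for c
    using that disj by (auto simp: \<tau>_def \<iota>_def)
  have tB: "\<tau> (f c) = \<tau> c \<and> \<iota> (f c) = \<iota> c" if "c \<in> ?A'" for c
  proof -
    have "f c \<notin> ?A" "f c \<notin> ?A'" using f(2) that by auto
    then show ?thesis using tA'[OF that] inv_into_f_f[OF f(1) that] by (simp add: \<tau>_def \<iota>_def)
  qed
  have rG: "realization ?A \<tau> \<iota> G" by (rule realization_itself[OF G g tA])
  have rH: "realization ?A' \<tau> \<iota> H" by (rule realization_itself[OF H h tA'])
  have proper: "proper ?A \<tau>" "proper ?A' \<tau>" using rG rH unfolding realization_def by auto
  have properB: "proper ?B \<tau>" using proper(2) tB f(3) unfolding proper_def by auto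
  have dataB: "data_sum ?B \<tau> \<iota> i j n = - data_sum ?A' \<tau> \<iota> i j n" for i j n
  proof -
    have "{\<gamma> \<in> ?B. \<tau> \<gamma> = (i, j) \<and> \<iota> \<gamma> = n} = f ` {\<gamma> \<in> ?A'. \<tau> \<gamma> = (i, j) \<and> \<iota> \<gamma> = n}" using tB by auto
    moreover have "inj_on f {\<gamma> \<in> ?A'. \<tau> \<gamma> = (i, j) \<and> \<iota> \<gamma> = n}" using f(1) by (rule inj_on_subset) auto
    ultimately show ?thesis unfolding data_sum_def using f(3) by (simp add: sum.reindex sum_negf)
  qed
  have fin: "finite ?A" "finite ?A'" "finite ?B" using finite_chords by auto
  have "equivalent \<tau> \<iota> ((?A' \<union> ?B) \<union> ?A) ?A"
  proof (rule equivalent_remove_zero_data[OF rG])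
    show "proper (?A' \<union> ?B) \<tau>" using proper(2) properB unfolding proper_def by auto
    show "(?A' \<union> ?B) \<inter> ?A = {}" using disj f(2) by auto
    have "data_sum (?A' \<union> ?B) \<tau> \<iota> i j n = 0" for i j n
      using data_sum_Un[OF fin(2,3)] f(2) dataB by (simp add: Int_Un_distrib Int_commute)
    then show "i = j \<and> n \<in> {0, 1} \<or> data_sum (?A' \<union> ?B) \<tau> \<iota> i j n = 0" for i j n by blast
  qed
  moreover have "equivalent \<tau> \<iota> ((?A \<union> ?B) \<union> ?A') ?A'"
  proof (rule equivalent_remove_zero_data[OF rH])
    show "proper (?A \<union> ?B) \<tau>" using proper(1) properB unfolding proper_def by auto
    show "(?A \<union> ?B) \<inter> ?A' = {}" using disj f(2) by auto
    fix i j :: nat and n :: int assume ij: "i < 2" "j < 2"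
    have "data_sum (?A \<union> ?B) \<tau> \<iota> i j n = data_sum ?A \<tau> \<iota> i j n - data_sum ?A' \<tau> \<iota> i j n"
      using data_sum_Un[OF fin(1,3)] f(2) dataB by (simp add: Int_Un_distrib Int_commute)
    also have "\<dots> = index_sum g G i j n - index_sum h H i j n"
      using data_sum_index_sum[OF G ij tA] data_sum_index_sum[OF H ij tA'] by simp
    finally show "i = j \<and> n \<in> {0, 1} \<or> data_sum (?A \<union> ?B) \<tau> \<iota> i j n = 0" using eq[OF ij, of n] by auto
  qed
  moreover have "(?A' \<union> ?B) \<union> ?A = (?A \<union> ?B) \<union> ?A'" by auto
  ultimately have "equivalent \<tau> \<iota> ?A ?A'" using equivalent_trans equivalent_sym by metis
  then obtain G1 H1 where "realization ?A \<tau> \<iota> G1" "realization ?A' \<tau> \<iota> H1" "G1 \<approx> H1"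
    unfolding equivalent_def by blast
  then show ?thesis using realization_unique[OF rG] realization_unique[OF _ rH] by (meson equivclp_trans)
qed

lemma gauss_diagram_relabel:
  assumes G: "gauss_diagram 2 G" and inj: "inj_on f (chords G)"
    and sgn: "\<And>\<gamma>. \<gamma> \<in> chords G \<Longrightarrow> chord_sign (f \<gamma>) = chord_sign \<gamma>"
  shows "gauss_diagram 2 (map (map (map_endpoint f)) G)" (is "gauss_diagram 2 ?H")
    and "chords (map (map (map_endpoint f)) G) = f ` chords G"
proof -
  have c: "concat ?H = map (map_endpoint f) (concat G)" by (simp add: map_concat)
  have in_G: "p \<in> set (concat G) \<longleftrightarrow> chord_of p \<in> chords G" for p by (rule endpoint_in_gauss_diagram[OF G])
  have in_H: "p \<in> set (concat ?H) \<longleftrightarrow> chord_of p \<in> f ` chords G" for p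
  proof
    assume "p \<in> set (concat ?H)"
    then obtain x where "x \<in> set (concat G)" "p = map_endpoint f x" unfolding c by auto
    moreover from this have "chord_of x \<in> chords G" using in_G by blast
    ultimately show "chord_of p \<in> f ` chords G" by (cases x rule: endpoint.exhaust) auto
  next
    assume "chord_of p \<in> f ` chords G"
    then obtain \<gamma> where \<gamma>: "\<gamma> \<in> chords G" "chord_of p = f \<gamma>" by blast
    then have "Ini \<gamma> \<in> set (concat G)" "Ter \<gamma> \<in> set (concat G)" using in_G by auto
    then have "map_endpoint f (Ini \<gamma>) \<in> set (concat ?H)" "map_endpoint f (Ter \<gamma>) \<in> set (concat ?H)"
      unfolding c by (metis imageI list.set_map)+
    then show "p \<in> set (concat ?H)" using \<gamma>(2) by (cases p) auto
  qed
  show "chords ?H = f ` chords G" unfolding chords_def[of ?H] in_H by auto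
  have "inj_on (map_endpoint f) (set (concat G))"
  proof (rule inj_onI)
    fix x y assume "x \<in> set (concat G)" "y \<in> set (concat G)" and eq: "map_endpoint f x = map_endpoint f y"
    then have "chord_of x \<in> chords G" "chord_of y \<in> chords G" using in_G by blast+
    with eq show "x = y" using inj by (cases x; cases y; auto dest: inj_onD)
  qed
  then have "distinct (concat ?H)" using G unfolding c gauss_diagram_def by (simp only: distinct_map)
  moreover have "chord_sign \<gamma> \<in> {1, -1}" if "\<gamma> \<in> f ` chords G" for \<gamma>
    using that sgn chord_sign_in_gauss_diagram[OF G] by fastforce
  ultimately show "gauss_diagram 2 ?H" using G in_H unfolding gauss_diagram_def by simp
qed

text \<open>
  The labels of \<open>H\<close> are changed to make the two sets of chords disjoint.
\<close>

lemma same_data_S_equiv: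
  assumes G: "gauss_diagram 2 G" and H: "gauss_diagram 2 H" and sd: "same_data {0, 1} G H"
  shows "G \<approx> H"
proof -
  obtain f where f: "inj_on f (chords H)" "f ` chords H \<inter> chords G = {}"
    "\<And>\<gamma>. \<gamma> \<in> chords H \<Longrightarrow> chord_sign (f \<gamma>) = chord_sign \<gamma>"
    using fresh_copies[of "chords H" "chords G" 1] finite_chords by auto
  let ?K = "map (map (map_endpoint f)) H"
  have K: "gauss_diagram 2 ?K" "chords ?K = f ` chords H" using gauss_diagram_relabel[OF H f(1,3)] by auto
  have iso: "isomorphic H ?K" by (rule isomorphic_relabel[OF H f(1,3)])
  have "balanced H" using sd potential_balanced unfolding same_data_def by blast
  then have "same_data {} H ?K" using isomorphic_invariants[OF H K(1) iso] unfolding same_invariants_def by blast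
  then have "same_data {0, 1} H ?K" using same_data_mono by blast
  with sd have "same_data {0, 1} G ?K" using same_data_trans H K(1) by blast
  then have "G \<approx> ?K" by (rule same_data_S_equiv_disjoint[OF G K(1)]) (use f(2) K(2) in auto)
  moreover have "H \<approx> ?K" by (rule isomorphic_S_equiv[OF iso H K(1)])
  ultimately show ?thesis by (meson equivclp_sym equivclp_trans)
qed

theorem theorem1p2:
  fixes L L' :: link
  assumes "L \<in> virtual_links 2" and "L' \<in> virtual_links 2"
    and "linking_difference L = 0" and "linking_difference L' = 0"
  shows "S_equivalent 2 L L' \<longleftrightarrow>
     (\<forall>n. n \<noteq> 0 \<and> n \<noteq> 1 \<longrightarrow> J L 0 n = J L' 0 n) \<and>
     (\<forall>n. n \<noteq> 0 \<and> n \<noteq> 1 \<longrightarrow> J L 1 n = J L' 1 n) \<and>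
     linking_class L = linking_class L'"
    (is "_ \<longleftrightarrow> ?invariants")
proof
  assume "S_equivalent 2 L L'"
  then obtain G G' where "G \<in> L" "G' \<in> L'" "same_data {0, 1} G G'"
    using S_equivalent_same_data assms by blast
  then show ?invariants using invariants_iff_same_data assms by blast
next
  assume inv: ?invariants
  obtain G G' where G: "G \<in> L" "G' \<in> L'" using link_members(1) assms by blast
  then have "same_data {0, 1} G G'" using invariants_iff_same_data inv assms by blast
  then have "G \<approx> G'" using same_data_S_equiv link_members(2) assms(1,2) G by blast
  then show "S_equivalent 2 L L'" unfolding S_equivalent_def using G by blast
qed

end
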